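(* Let $1\le r\le n$ be integers, let $N>0$, and let $f\in C^{4n}(\mathbb{R}^n\times\mathbb{R}^r;\mathbb{R}^n)$ satisfy $f(0,0)=0$. Put $A=\frac{\partial f}{\partial x}(0,0)$ and $B=\frac{\partial f}{\partial u}(0,0)$, and assume $$\operatorname{rank}\,(B, AB, A^2B,\ldots,A^{n-1}B)=n.$$ Then there exists $\varepsilon>0$ such that for every $\bar x\in\mathbb{R}^n$ with $\|\bar x\|<\varepsilon$ there exists a solution of the following boundary value problem: find functions $x\in C([0,1];\mathbb{R}^n)$ and $u\in C([0,1];\mathbb{R}^r)$ such that $$\dot x(t)=f(x(t),u(t)),\qquad \|u(t)\|<N\qquad\text{for } t\in[0,1],$$ $$x(0)=0,\qquad x(1)=\bar x .$$ Moreover, this solution can be found after solving, first, a problem of stabilizing a linear non-stationary system with exponential coefficients and, second, an initial value problem for an auxiliary system of ordinary differential equations (both systems are described in the context).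
   Context: $\|\cdot\|$ denotes a norm on $\mathbb{R}^n$ or $\mathbb{R}^r$. The matrix $(B,AB,\ldots,A^{n-1}B)$ is the $n\times nr$ block matrix with the indicated blocks. The two systems in the constructive clause arise as follows. Fix a suitable constant $\alpha>0$ and substitute $t=1-e^{-\alpha\tau}$, $\tau\in[0,\infty)$, $c(\tau)=x(t(\tau))-\bar x$, $d(\tau)=u(t(\tau))$. The problem becomes $\frac{dc}{d\tau}=\alpha e^{-\alpha\tau}f(\bar x+c,d)$, $c(0)=-\bar x$, $c(\tau)\to0$ as $\tau\to\infty$. Expand the right-hand side by Taylor's formula about $(\bar x,0)$, with terms of order up to $4n-2$ and a remainder of order $4n-1$. Then make $4n-1$ successive shifts $c^{(k-1)}(\tau)=c^{(k)}(\tau)+e^{-k\alpha\tau}\phi^{(k)}(\bar x)$, where $c^{(0)}=c$, $\phi^{(1)}(\bar x)=-f(\bar x,0)$ and $\phi^{(k)}(0)=0$. The $\phi^{(k)}$ are chosen so that after the $k$-th shift the terms not containing powers of the components of $c^{(k)}$ or $d$ are $O(e^{-(k+1)\alpha\tau}\|\bar x\|)$ as $\tau\to\infty$, $\|\bar x\|\to0$. The result is a system $\frac{dc^{(4n-1)}}{d\tau}=Pc^{(4n-1)}+Qd+R$. Here $P=P(\tau)$ collects the coefficients of the terms linear in $c^{(4n-1)}$ with factors $e^{-i\alpha\tau}$, $1\le i\le n$, and $Q=Q(\tau)$ collects the coefficients of the terms linear in $d$ with factors $e^{-i\alpha\tau}$, $1\le i\le 2n$; $R$ contains all remaining terms. The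 leading terms of $P$ and $Q$ are $\alpha e^{-\alpha\tau}\frac{\partial f}{\partial x}(\bar x,0)$ and $\alpha e^{-\alpha\tau}\frac{\partial f}{\partial u}(\bar x,0)$. (i) The linear non-stationary system with exponential coefficients is $\frac{dc^{(4n-1)}}{d\tau}=P(\tau)c^{(4n-1)}+Q(\tau)d$. Stabilizing it means finding a feedback $d=M(\tau)c^{(4n-1)}$ for which the fundamental matrix of the closed-loop system decreases exponentially. (ii) The auxiliary system is the full nonlinear system for $c^{(4n-1)}$ (including $R$) with $d=M(\tau)c^{(4n-1)}$ substituted. Its initial value is $c^{(4n-1)}(0)=-\bar x-\sum_{k=1}^{4n-1}\phi^{(k)}(\bar x)$. The solution $x(t),u(t)$ is recovered by returning to the original variables and passing to the limit $t\to1$. *)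

theory Defs
  imports "HOL-Analysis.Analysis" "HOL-Library.Landau_Symbols"
begin

definition is_norm :: "('a::real_vector \<Rightarrow> real) \<Rightarrow> bool" where
  "is_norm p \<longleftrightarrow>
     (\<forall>v. p v = 0 \<longleftrightarrow> v = 0) \<and>
     (\<forall>a v. p (a *\<^sub>R v) = \<bar>a\<bar> * p v) \<and>
     (\<forall>v w. p (v + w) \<le> p v + p w)"

text \<open>\<open>C_upto k f\<close>: \<open>f\<close> is of class \<open>C\<^sup>k\<close> on the whole space, that is, all iterated directional
  derivatives of order less than \<open>k\<close> are differentiable and those of order \<open>k\<close> are continuous.\<close>

primrec C_upto ::
  "nat \<Rightarrow> ('a::real_normed_vector \<Rightarrow> 'b::real_normed_vector) \<Rightarrow> bool" where
  "C_upto 0 f \<longleftrightarrow> continuous_on UNIV f"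
| "C_upto (Suc k) f \<longleftrightarrow>
     (\<forall>z. f differentiable (at z)) \<and> (\<forall>v. C_upto k (\<lambda>z. frechet_derivative f (at z) v))"

text \<open>\<open>iter_deriv f [v\<^sub>1, \<dots>, v\<^sub>m] z\<close> is the \<open>m\<close>-th derivative \<open>D\<^sup>m f(z)[v\<^sub>1, \<dots>, v\<^sub>m]\<close>.\<close>

primrec iter_deriv ::
  "('a::real_normed_vector \<Rightarrow> 'b::real_normed_vector) \<Rightarrow> 'a list \<Rightarrow> 'a \<Rightarrow> 'b" where
  "iter_deriv f [] = f"
| "iter_deriv f (v # vs) = (\<lambda>z. frechet_derivative (iter_deriv f vs) (at z) v)"

text \<open>The \<open>n \<times> nr\<close> block matrix \<open>(B, AB, \<dots>, A\<^sup>n\<^sup>-\<^sup>1B)\<close>. Its columns are indexed by pairs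
  (block, column of \<open>B\<close>); the \<open>n\<close> blocks are indexed by the type \<open>'n\<close> itself, enumerated as
  \<open>0, \<dots>, n - 1\<close> by \<open>to_nat_on UNIV\<close>. The order of the columns does not affect the rank.\<close>

definition controllability_matrix ::
  "real^'n^'n \<Rightarrow> real^'r^'n \<Rightarrow> real^('n \<times> 'r)^'n" where
  "controllability_matrix A B =
     (\<chi> i p. (((**) A ^^ to_nat_on (UNIV :: 'n set) (fst p)) B) $ i $ snd p)"

definition bvp_solution ::
  "((real^'n) \<times> (real^'r) \<Rightarrow> real^'n) \<Rightarrow> (real^'r \<Rightarrow> real) \<Rightarrow> real \<Rightarrow> real^'n
     \<Rightarrow> (real \<Rightarrow> real^'n) \<Rightarrow> (real \<Rightarrow> real^'r) \<Rightarrow> bool" where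
  "bvp_solution f norm_u N xb x u \<longleftrightarrow>
     continuous_on {0..1} x \<and> continuous_on {0..1} u \<and>
     (\<forall>t\<in>{0..1}. (x has_vector_derivative f (x t, u t)) (at t within {0..1}) \<and> norm_u (u t) < N) \<and>
     x 0 = 0 \<and> x 1 = xb"

text \<open>Right-hand side of the system for \<open>c\<^sup>(\<^sup>k\<^sup>)\<close>. For \<open>k = 0\<close> this is the system obtained from
  \<open>x' = f(x, u)\<close> by \<open>t = 1 - exp (- \<alpha> \<tau>)\<close>, \<open>c = x - xb\<close>, \<open>d = u\<close>; the step is the substitution
  \<open>c\<^sup>(\<^sup>k\<^sup>) = c\<^sup>(\<^sup>k\<^sup>+\<^sup>1\<^sup>) + exp (- (k+1) \<alpha> \<tau>) \<phi>\<^sub>k\<^sub>+\<^sub>1(xb)\<close>, whose last summand has the derivative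
  \<open>- (k+1) \<alpha> exp (- (k+1) \<alpha> \<tau>) \<phi>\<^sub>k\<^sub>+\<^sub>1(xb)\<close>.\<close>

primrec shifted_rhs ::
  "((real^'n) \<times> (real^'r) \<Rightarrow> real^'n) \<Rightarrow> real \<Rightarrow> (nat \<Rightarrow> real^'n \<Rightarrow> real^'n) \<Rightarrow> real^'n
     \<Rightarrow> nat \<Rightarrow> real \<Rightarrow> real^'n \<Rightarrow> real^'r \<Rightarrow> real^'n" where
  "shifted_rhs f \<alpha> \<phi> xb 0 = (\<lambda>\<tau> c d. (\<alpha> * exp (- \<alpha> * \<tau>)) *\<^sub>R f (xb + c, d))"
| "shifted_rhs f \<alpha> \<phi> xb (Suc k) = (\<lambda>\<tau> c d.
     shifted_rhs f \<alpha> \<phi> xb k \<tau> (c + exp (- real (Suc k) * \<alpha> * \<tau>) *\<^sub>R \<phi> (Suc k) xb) d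
     + (real (Suc k) * \<alpha> * exp (- real (Suc k) * \<alpha> * \<tau>)) *\<^sub>R \<phi> (Suc k) xb)"

text \<open>The requirements on \<open>\<phi>\<^sub>1, \<dots>, \<phi>\<^sub>4\<^sub>n\<^sub>-\<^sub>1\<close>. The terms of the \<open>k\<close>-th system that contain neither
  components of \<open>c\<^sup>(\<^sup>k\<^sup>)\<close> nor of \<open>d\<close> are what remains of its right-hand side at
  \<open>c\<^sup>(\<^sup>k\<^sup>) = 0\<close>, \<open>d = 0\<close>. By the equivalence of norms the estimate does not depend on the norm used.\<close>

definition shift_functions ::
  "((real^'n) \<times> (real^'r) \<Rightarrow> real^'n) \<Rightarrow> real \<Rightarrow> (nat \<Rightarrow> real^'n \<Rightarrow> real^'n) \<Rightarrow> bool" where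
  "shift_functions f \<alpha> \<phi> \<longleftrightarrow>
     (\<forall>xb. \<phi> 1 xb = - f (xb, 0)) \<and>
     (\<forall>k\<in>{1..4 * CARD('n) - 1}.
        \<phi> k 0 = 0 \<and>
        (\<lambda>(\<tau>, xb). norm (shifted_rhs f \<alpha> \<phi> xb k \<tau> 0 0))
          \<in> O[at_top \<times>\<^sub>F nhds 0](\<lambda>(\<tau>, xb). exp (- real (Suc k) * \<alpha> * \<tau>) * norm xb))"

text \<open>\<open>linear_term f \<phi> xb i w\<close> is the sum of the terms that are linear in \<open>w\<close> and carry the factor
  \<open>s\<^sup>i\<close> in the expansion of \<open>s\<close> times the Taylor polynomial of \<open>f\<close> at \<open>(xb, 0)\<close> of order
  \<open>4n - 2\<close>, evaluated at the increment \<open>h = w + (\<Sum>k=1..4n-1. s\<^sup>k (\<phi>\<^sub>k(xb), 0))\<close>: the part of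
  \<open>D\<^sup>m\<^sup>+\<^sup>1f(xb, 0)[h, \<dots>, h] / (m+1)!\<close> linear in \<open>w\<close> is
  \<open>(\<Sum>k\<^sub>1, \<dots>, k\<^sub>m. s^(k\<^sub>1 + \<dots> + k\<^sub>m) D\<^sup>m\<^sup>+\<^sup>1f(xb, 0)[w, \<phi>\<^sub>k\<^sub>1, \<dots>, \<phi>\<^sub>k\<^sub>m]) / m!\<close>. With
  \<open>s = exp (- \<alpha> \<tau>)\<close>, the choices \<open>w = (c, 0)\<close> and \<open>w = (0, d)\<close> give the terms linear in
  \<open>c\<close> and \<open>d\<close> of the system for \<open>c = c\<^sup>(\<^sup>4\<^sup>n\<^sup>-\<^sup>1\<^sup>)\<close>, up to the factor \<open>\<alpha>\<close>.\<close>

definition linear_term ::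
  "((real^'n) \<times> (real^'r) \<Rightarrow> real^'n) \<Rightarrow> (nat \<Rightarrow> real^'n \<Rightarrow> real^'n) \<Rightarrow> real^'n
     \<Rightarrow> nat \<Rightarrow> (real^'n) \<times> (real^'r) \<Rightarrow> real^'n" where
  "linear_term f \<phi> xb i w =
     (\<Sum>m<4 * CARD('n) - 2. (1 / fact m) *\<^sub>R
        (\<Sum>ks | length ks = m \<and> set ks \<subseteq> {1..4 * CARD('n) - 1} \<and> Suc (sum_list ks) = i.
           iter_deriv f (w # map (\<lambda>k. (\<phi> k xb, 0)) ks) (xb, 0)))"

definition P_mat ::
  "((real^'n) \<times> (real^'r) \<Rightarrow> real^'n) \<Rightarrow> real \<Rightarrow> (nat \<Rightarrow> real^'n \<Rightarrow> real^'n) \<Rightarrow> real^'n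
     \<Rightarrow> real \<Rightarrow> real^'n^'n" where
  "P_mat f \<alpha> \<phi> xb \<tau> = matrix (\<lambda>c.
     \<Sum>i=1..CARD('n). (\<alpha> * exp (- real i * \<alpha> * \<tau>)) *\<^sub>R linear_term f \<phi> xb i (c, 0))"

definition Q_mat ::
  "((real^'n) \<times> (real^'r) \<Rightarrow> real^'n) \<Rightarrow> real \<Rightarrow> (nat \<Rightarrow> real^'n \<Rightarrow> real^'n) \<Rightarrow> real^'n
     \<Rightarrow> real \<Rightarrow> real^'r^'n" where
  "Q_mat f \<alpha> \<phi> xb \<tau> = matrix (\<lambda>d.
     \<Sum>i=1..2 * CARD('n). (\<alpha> * exp (- real i * \<alpha> * \<tau>)) *\<^sub>R linear_term f \<phi> xb i (0, d))"

definition R_term ::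
  "((real^'n) \<times> (real^'r) \<Rightarrow> real^'n) \<Rightarrow> real \<Rightarrow> (nat \<Rightarrow> real^'n \<Rightarrow> real^'n) \<Rightarrow> real^'n
     \<Rightarrow> real \<Rightarrow> real^'n \<Rightarrow> real^'r \<Rightarrow> real^'n" where
  "R_term f \<alpha> \<phi> xb \<tau> c d =
     shifted_rhs f \<alpha> \<phi> xb (4 * CARD('n) - 1) \<tau> c d
       - P_mat f \<alpha> \<phi> xb \<tau> *v c - Q_mat f \<alpha> \<phi> xb \<tau> *v d"

definition stabilizing_feedback ::
  "(real \<Rightarrow> real^'n^'n) \<Rightarrow> (real \<Rightarrow> real^'r^'n) \<Rightarrow> (real \<Rightarrow> real^'n^'r) \<Rightarrow> bool" where
  "stabilizing_feedback P Q M \<longleftrightarrow>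
     continuous_on {0..} M \<and>
     (\<exists>\<Psi>. \<Psi> 0 = mat 1 \<and>
          (\<forall>\<tau>\<ge>0. (\<Psi> has_vector_derivative (P \<tau> + Q \<tau> ** M \<tau>) ** \<Psi> \<tau>) (at \<tau> within {0..})) \<and>
          (\<exists>K>0. \<exists>\<mu>>0. \<forall>\<tau>\<ge>0. norm (\<Psi> \<tau>) \<le> K * exp (- \<mu> * \<tau>)))"

definition auxiliary_ivp_solution ::
  "((real^'n) \<times> (real^'r) \<Rightarrow> real^'n) \<Rightarrow> real \<Rightarrow> (nat \<Rightarrow> real^'n \<Rightarrow> real^'n) \<Rightarrow> real^'n
     \<Rightarrow> (real \<Rightarrow> real^'n^'r) \<Rightarrow> (real \<Rightarrow> real^'n) \<Rightarrow> bool" where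
  "auxiliary_ivp_solution f \<alpha> \<phi> xb M c \<longleftrightarrow>
     c 0 = - xb - (\<Sum>k=1..4 * CARD('n) - 1. \<phi> k xb) \<and>
     (\<forall>\<tau>\<ge>0. (c has_vector_derivative
        P_mat f \<alpha> \<phi> xb \<tau> *v c \<tau> + Q_mat f \<alpha> \<phi> xb \<tau> *v (M \<tau> *v c \<tau>)
          + R_term f \<alpha> \<phi> xb \<tau> (c \<tau>) (M \<tau> *v c \<tau>)) (at \<tau> within {0..}))"

text \<open>Return from \<open>c = c\<^sup>(\<^sup>4\<^sup>n\<^sup>-\<^sup>1\<^sup>)\<close> to the original variables; here \<open>\<tau> = - ln (1 - t) / \<alpha>\<close>.\<close>

definition recovered_x ::
  "real \<Rightarrow> (nat \<Rightarrow> real^'n \<Rightarrow> real^'n) \<Rightarrow> real^'n \<Rightarrow> (real \<Rightarrow> real^'n) \<Rightarrow> real \<Rightarrow> real^'n" where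
  "recovered_x \<alpha> \<phi> xb c t = (let \<tau> = - ln (1 - t) / \<alpha> in
     xb + c \<tau> + (\<Sum>k=1..4 * CARD('n) - 1. exp (- real k * \<alpha> * \<tau>) *\<^sub>R \<phi> k xb))"

definition recovered_u ::
  "real \<Rightarrow> (real \<Rightarrow> real^'n^'r) \<Rightarrow> (real \<Rightarrow> real^'n) \<Rightarrow> real \<Rightarrow> real^'r" where
  "recovered_u \<alpha> M c t = (let \<tau> = - ln (1 - t) / \<alpha> in M \<tau> *v c \<tau>)"

definition recovered_from ::
  "real \<Rightarrow> (nat \<Rightarrow> real^'n \<Rightarrow> real^'n) \<Rightarrow> real^'n \<Rightarrow> (real \<Rightarrow> real^'n^'r) \<Rightarrow> (real \<Rightarrow> real^'n)
     \<Rightarrow> (real \<Rightarrow> real^'n) \<Rightarrow> (real \<Rightarrow> real^'r) \<Rightarrow> bool" where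
  "recovered_from \<alpha> \<phi> xb M c x u \<longleftrightarrow>
     (\<forall>t\<in>{0..<1}. x t = recovered_x \<alpha> \<phi> xb c t \<and> u t = recovered_u \<alpha> M c t) \<and>
     (recovered_x \<alpha> \<phi> xb c \<longlongrightarrow> x 1) (at_left 1) \<and>
     (recovered_u \<alpha> M c \<longlongrightarrow> u 1) (at_left 1)"

end

(* The system is reparametrised by s = exp (- \<tau>) = 1 - t. The shifts are the Taylor
   coefficients in s of the backward solution of y' = - f(y, 0), y(0) = xb, so that about the shifted
   origin the only terms left free of c and d are O(s^(4n) |xb|).

   Let P = s P0(s), Q = s Q0(s), let U be the fundamental matrix U' = U P0, U(0) = 1 of the polynomial
   system, Y = U Q0, and let G(s) be the Gramian, the integral over [0, s] of \<sigma>^q Y Y^T with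
   q = 6n - 3. Under the feedback d = - s^q Y^T G^(-1) U c the linear system is solved explicitly by
   c = U^(-1) G v with constant v, hence it is stabilised. Controllability gives
   G(s) >= \<kappa> s^(q + 2n - 1) uniformly for small xb, because the first n Taylor coefficients of Y at 0
   are close to A^k B / k!.

   In the nonlinear system v is no longer constant, but the weight q is chosen such that
   W = v . G v satisfies dW/d\<tau> <= \<Gamma> s (W + |xb|^2) as long as W <= 1: the truncation orders n of P,
   2n of Q and 4n - 1 of the shifts are just what makes each term of R contribute a factor s. Hence
   W = O(|xb|^2), and c and d are O(s |xb|). *)
theory Submission
  imports Defs
begin

section \<open>Iterated derivatives of functions of class C^k\<close>

text \<open>The obstacle is that the Gramian is anisotropic: G(s) is at most of size s^(q+1), may be
  as small as s^(q+2n-1) in some directions and vanishes at s = 0, so the gain of the feedback may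
  blow up like s^(-(2n-1)). Hence everything is measured by W: up to constants, |v| is at most
  s^(-(q+2n-1)/2) sqrt W, |c| at most s^((q+1)/2) sqrt W and, since d = - s^q Y^T v, |d| at most
  s^((q-2n+1)/2) sqrt W.

  When v is paired with the remainder, the truncation errors s^(n+1) |c| and s^(2n+1) |d| contribute
  s^2 W whatever q is. The quadratic terms s (|c| + |d|)^2 require q \<ge> 6n - 3, the residual
  s^(4n) |xb| requires q \<le> 6n - 1. The smallest such q also makes the exponents integers: 4n -
  2, 3n - 1 and 2n - 1.

  A second obstacle is uniformity: P, Q, U and G all change with xb. Estimates are therefore proved
  with constants that depend only on bounds for the coefficients, and such bounds hold near xb = 0
  because all coefficients but the leading ones tend to 0 there.\<close>

lemma C_upto_Suc_imp: "C_upto (Suc k) f \<Longrightarrow> C_upto k f"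
proof (induction k arbitrary: f)
  case 0
  then show ?case
    by (auto intro!: continuous_at_imp_continuous_on differentiable_imp_continuous_within)
qed auto

lemma C_upto_mono: "C_upto k f \<Longrightarrow> j \<le> k \<Longrightarrow> C_upto j f"
  by (induction k) (metis le_zero_eq, metis C_upto_Suc_imp le_Suc_eq)

lemma C_upto_continuous: "C_upto k f \<Longrightarrow> continuous_on UNIV f"
  using C_upto_mono[of k f 0] by simp

lemma iter_deriv_append: "iter_deriv f (vs @ ws) = iter_deriv (iter_deriv f ws) vs"
  by (induction vs) simp_all

lemma C_upto_iter_deriv: "C_upto (k + length vs) f \<Longrightarrow> C_upto k (iter_deriv f vs)"
proof (induction vs arbitrary: k)
  case (Cons v vs)
  have "C_upto (Suc k) (iter_deriv f vs)"
    using Cons.prems by (intro Cons.IH) simp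
  then show ?case by simp
qed simp

lemma iter_deriv_has_derivative:
  assumes "C_upto M f" "length vs < M"
  shows "(iter_deriv f vs has_derivative (\<lambda>v. iter_deriv f (v # vs) z)) (at z)"
proof -
  have "C_upto (Suc 0) (iter_deriv f vs)"
    using assms by (intro C_upto_iter_deriv C_upto_mono[OF assms(1)]) auto
  then have "iter_deriv f vs differentiable (at z)"
    by simp
  then show ?thesis
    by (simp add: frechet_derivative_works)
qed

lemma iter_deriv_along_segment:
  assumes "C_upto M f" "length vs < M"
  shows "((\<lambda>t. iter_deriv f vs (z + t *\<^sub>R v)) has_vector_derivative iter_deriv f (v # vs) (z + t *\<^sub>R v))
           (at t within S)"
proof -
  have lin: "linear (\<lambda>v. iter_deriv f (v # vs) (z + t *\<^sub>R v'))" for v'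
    using has_derivative_linear[OF iter_deriv_has_derivative[OF assms]] .
  have "((\<lambda>t. iter_deriv f vs (z + t *\<^sub>R v)) has_derivative
      (\<lambda>h. iter_deriv f ((h *\<^sub>R v) # vs) (z + t *\<^sub>R v))) (at t within S)"
    by (rule has_derivative_compose[OF _ iter_deriv_has_derivative[OF assms]])
       (auto intro!: derivative_eq_intros)
  moreover have "iter_deriv f ((h *\<^sub>R v) # vs) (z + t *\<^sub>R v) = h *\<^sub>R iter_deriv f (v # vs) (z + t *\<^sub>R v)" for h
    using linear_scale[OF lin] by simp
  ultimately show ?thesis
    unfolding has_vector_derivative_def by simp
qed

section \<open>Symmetry of higher derivatives\<close>

lemma second_difference_mvt:
  fixes g :: "'a::real_normed_vector \<Rightarrow> 'b::real_inner"
  assumes g: "C_upto 2 g" and t: "t > 0"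
  shows "\<exists>a\<in>{0..t}. \<exists>b\<in>{0..t}.
    (g (z + t *\<^sub>R v + t *\<^sub>R w) - g (z + t *\<^sub>R v) - g (z + t *\<^sub>R w) + g z) \<bullet> e
      = t^2 * (iter_deriv g [w, v] (z + a *\<^sub>R v + b *\<^sub>R w) \<bullet> e)"
proof -
  \<comment> \<open>\<open>h\<close> is the increment along w as a function of the position along v;
    \<open>k\<close> is the derivative along v on the line through the intermediate point. The mean
    value theorem is thus used once per direction. Pairing with \<open>e\<close> makes both
    functions real-valued, so the intermediate points depend on \<open>e\<close>.\<close>
  define h where "h r = (g ((z + t *\<^sub>R w) + r *\<^sub>R v) - g (z + r *\<^sub>R v)) \<bullet> e" for r
  define h' where "h' r = (iter_deriv g [v] ((z + t *\<^sub>R w) + r *\<^sub>R v) - iter_deriv g [v] (z + r *\<^sub>R v)) \<bullet> e" for r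
  have d0: "((\<lambda>r. g (y + r *\<^sub>R v)) has_vector_derivative iter_deriv g [v] (y + r *\<^sub>R v)) (at r)" for y r
    using iter_deriv_along_segment[OF g, of "[]"] by simp
  have "(h has_real_derivative h' r) (at r)" for r
    unfolding h_def h'_def has_real_derivative_iff_has_vector_derivative
    by (intro bounded_linear.has_vector_derivative[OF bounded_linear_inner_left]
        has_vector_derivative_diff d0)
  then obtain a where a: "0 < a" "a < t" "h t - h 0 = t * h' a"
    using MVT2[of 0 t h h'] t by auto
  define k where "k r = iter_deriv g [v] ((z + a *\<^sub>R v) + r *\<^sub>R w) \<bullet> e" for r
  define k' where "k' r = iter_deriv g [w, v] ((z + a *\<^sub>R v) + r *\<^sub>R w) \<bullet> e" for r
  have "(k has_real_derivative k' r) (at r)" for r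
    unfolding k_def k'_def has_real_derivative_iff_has_vector_derivative
    by (intro bounded_linear.has_vector_derivative[OF bounded_linear_inner_left]
        iter_deriv_along_segment[OF g]) simp
  then obtain b where b: "0 < b" "b < t" "k t - k 0 = t * k' b"
    using MVT2[of 0 t k k'] t by auto
  have "h' a = k t - k 0"
    by (simp add: h'_def k_def algebra_simps)
  then have "h t - h 0 = t^2 * k' b"
    using a b by (simp add: power2_eq_square)
  moreover have "h t - h 0 = (g (z + t *\<^sub>R v + t *\<^sub>R w) - g (z + t *\<^sub>R v) - g (z + t *\<^sub>R w) + g z) \<bullet> e"
    by (simp add: h_def algebra_simps)
  ultimately show ?thesis
    using a b unfolding k'_def by (metis atLeastAtMost_iff less_imp_le)
qed

text \<open>Schwarz's theorem. The second difference is symmetric in v and w, so after division by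
  t^2 it is a value of either mixed derivative at some point near z; continuity forces the two
  values at z to agree. It is needed because \<open>iter_deriv\<close> takes its directions in a
  fixed order.\<close>

lemma iter_deriv_swap2:
  fixes g :: "'a::real_normed_vector \<Rightarrow> 'b::real_inner"
  assumes g: "C_upto 2 g"
  shows "iter_deriv g [v, w] z = iter_deriv g [w, v] z"
proof -
  have "iter_deriv g [v, w] z \<bullet> e = iter_deriv g [w, v] z \<bullet> e" for e
  proof (rule ccontr)
    define H where "H x = iter_deriv g [w, v] x \<bullet> e" for x
    define K where "K x = iter_deriv g [v, w] x \<bullet> e" for x
    assume "iter_deriv g [v, w] z \<bullet> e \<noteq> iter_deriv g [w, v] z \<bullet> e"
    then have pos: "\<bar>H z - K z\<bar> / 2 > 0" (is "?\<epsilon> > 0")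
      by (auto simp: H_def K_def)
    have "continuous_on UNIV (iter_deriv g [v, w])" "continuous_on UNIV (iter_deriv g [w, v])"
      using C_upto_iter_deriv[of 0 "[v, w]" g] C_upto_iter_deriv[of 0 "[w, v]" g] g
      by (auto simp: numeral_2_eq_2)
    then have "continuous_on UNIV H" "continuous_on UNIV K"
      unfolding H_def K_def by (auto intro!: continuous_intros)
    then obtain d1 d2 where d: "d1 > 0" "\<And>x. dist x z < d1 \<Longrightarrow> dist (H x) (H z) < ?\<epsilon>"
      "d2 > 0" "\<And>x. dist x z < d2 \<Longrightarrow> dist (K x) (K z) < ?\<epsilon>"
      using pos unfolding continuous_on_iff by (metis UNIV_I)
    define d where "d = min d1 d2"
    \<comment> \<open>Keeps the whole parallelogram spanned by t v and t w within d of z; the 1 in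
      the denominator covers v = w = 0.\<close>
    define t where "t = d / (2 * (norm v + norm w + 1))"
    have d0: "d > 0" using d by (simp add: d_def)
    have n0: "norm v + norm w + 1 > 0"
      by (simp add: add_nonneg_pos)
    then have t0: "t > 0" using d0 by (simp add: t_def)
    have small: "dist (z + a *\<^sub>R v + b *\<^sub>R w) z < d" if "a \<in> {0..t}" "b \<in> {0..t}" for a b
    proof -
      have "dist (z + a *\<^sub>R v + b *\<^sub>R w) z = norm (a *\<^sub>R v + b *\<^sub>R w)"
        by (simp add: dist_norm)
      also have "\<dots> \<le> a * norm v + b * norm w"
        using that norm_triangle_ineq[of "a *\<^sub>R v" "b *\<^sub>R w"] by simp
      also have "\<dots> \<le> t * norm v + t * norm w"
        using that by (intro add_mono mult_right_mono) auto
      also have "\<dots> \<le> t * (norm v + norm w + 1)"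
        using t0 by (simp add: algebra_simps)
      also have "\<dots> = d / 2"
        using n0 unfolding t_def by (simp add: divide_simps del: distrib_left_numeral)
      finally show ?thesis using d0 by simp
    qed
    obtain a b where ab: "a \<in> {0..t}" "b \<in> {0..t}"
      "(g (z + t *\<^sub>R v + t *\<^sub>R w) - g (z + t *\<^sub>R v) - g (z + t *\<^sub>R w) + g z) \<bullet> e
        = t^2 * H (z + a *\<^sub>R v + b *\<^sub>R w)"
      using second_difference_mvt[OF g t0, of z v w e] unfolding H_def by blast
    obtain a' b' where ab': "a' \<in> {0..t}" "b' \<in> {0..t}"
      "(g (z + t *\<^sub>R w + t *\<^sub>R v) - g (z + t *\<^sub>R w) - g (z + t *\<^sub>R v) + g z) \<bullet> e
        = t^2 * K (z + a' *\<^sub>R w + b' *\<^sub>R v)"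
      using second_difference_mvt[OF g t0, of z w v e] unfolding K_def by blast
    have sw: "z + a' *\<^sub>R w + b' *\<^sub>R v = z + b' *\<^sub>R v + a' *\<^sub>R w"
      "z + t *\<^sub>R w + t *\<^sub>R v = z + t *\<^sub>R v + t *\<^sub>R w"
      by (simp_all add: algebra_simps)
    have "t^2 * H (z + a *\<^sub>R v + b *\<^sub>R w) = t^2 * K (z + b' *\<^sub>R v + a' *\<^sub>R w)"
      using ab(3) ab'(3) unfolding sw by (simp add: algebra_simps)
    then have eq: "H (z + a *\<^sub>R v + b *\<^sub>R w) = K (z + b' *\<^sub>R v + a' *\<^sub>R w)"
      using t0 by simp
    have "dist (H (z + a *\<^sub>R v + b *\<^sub>R w)) (H z) < ?\<epsilon>"
      using d small[OF ab(1,2)] unfolding d_def by auto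
    moreover have "dist (K (z + b' *\<^sub>R v + a' *\<^sub>R w)) (K z) < ?\<epsilon>"
      using d small[OF ab'(2,1)] unfolding d_def by auto
    ultimately show False
      unfolding eq dist_real_def by (auto simp: abs_if field_simps split: if_splits)
  qed
  then show ?thesis
    by (metis inner_commute vector_eq_rdot)
qed

text \<open>\<open>linear_term\<close> carries w as the outermost direction, whereas expanding D
  f[w] along the shifted curve needs w as the innermost one. Swaps of neighbours move it through the
  list.\<close>

lemma iter_deriv_Cons_eq_snoc:
  fixes f :: "'a::real_normed_vector \<Rightarrow> 'b::real_inner"
  assumes "C_upto (Suc (length vs)) f"
  shows "iter_deriv f (w # vs) = iter_deriv f (vs @ [w])"
  using assms
proof (induction vs)
  case (Cons v vs)
  have "C_upto 2 (iter_deriv f vs)"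
    using Cons.prems by (intro C_upto_iter_deriv) (simp add: numeral_2_eq_2)
  then have "iter_deriv f (w # v # vs) = iter_deriv f (v # w # vs)"
    using iter_deriv_swap2[of "iter_deriv f vs" w v] by (simp add: fun_eq_iff)
  also have "\<dots> = iter_deriv f (v # vs @ [w])"
    using Cons.IH[OF C_upto_Suc_imp] Cons.prems by (simp del: C_upto.simps)
  finally show ?case by simp
qed simp

section \<open>Multilinear expansion, uniform bounds and Taylor's formula\<close>

lemma lists_length_Suc_eq:
  "{ks. length ks = Suc m \<and> set ks \<subseteq> I} = (\<lambda>(k, ks). k # ks) ` (I \<times> {ks. length ks = m \<and> set ks \<subseteq> I})"
  by (auto simp: length_Suc_conv image_iff)

text \<open>Each argument has its own coefficient function, so that one expansion serves both
  vectors in coordinates and powers of a curve \<Sum> s^k \<eta>_k. The new direction is prepended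
  in the induction: the expansion already obtained is differentiated in z, and linearity is used in
  one slot only.\<close>

lemma iter_deriv_multilinear:
  fixes f :: "'a::real_normed_vector \<Rightarrow> 'b::real_normed_vector" and e :: "'k \<Rightarrow> 'a"
  assumes "C_upto M f" "length as \<le> M" and fin: "finite I"
  shows "iter_deriv f (map (\<lambda>a. \<Sum>k\<in>I. a k *\<^sub>R e k) as) =
    (\<lambda>z. \<Sum>ks | length ks = length as \<and> set ks \<subseteq> I.
       prod_list (map2 (\<lambda>a k. a k) as ks) *\<^sub>R iter_deriv f (map e ks) z)"
  using assms(2)
proof (induction as)
  case Nil
  have "{ks::'k list. ks = [] \<and> set ks \<subseteq> I} = {[]}" by auto
  then show ?case by (simp add: fun_eq_iff)
next
  case (Cons a as)
  let ?L = "{ks. length ks = length as \<and> set ks \<subseteq> I}"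
  let ?p = "\<lambda>ks. prod_list (map2 (\<lambda>a k. a k) as ks)"
  have IH: "iter_deriv f (map (\<lambda>a. \<Sum>k\<in>I. a k *\<^sub>R e k) as) =
      (\<lambda>z. \<Sum>ks\<in>?L. ?p ks *\<^sub>R iter_deriv f (map e ks) z)"
    using Cons by simp
  show ?case
  proof
    fix z
    have lt: "length (map e ks) < M" if "ks \<in> ?L" for ks
      using that Cons.prems by simp
    have "((\<lambda>z. \<Sum>ks\<in>?L. ?p ks *\<^sub>R iter_deriv f (map e ks) z) has_derivative
        (\<lambda>v. \<Sum>ks\<in>?L. ?p ks *\<^sub>R iter_deriv f (v # map e ks) z)) (at z)"
      by (intro has_derivative_sum has_derivative_scaleR_right iter_deriv_has_derivative[OF assms(1)] lt)
    note fd = frechet_derivative_at[OF this]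
    have "iter_deriv f (map (\<lambda>a. \<Sum>k\<in>I. a k *\<^sub>R e k) (a # as)) z =
        (\<Sum>ks\<in>?L. ?p ks *\<^sub>R iter_deriv f ((\<Sum>k\<in>I. a k *\<^sub>R e k) # map e ks) z)"
      unfolding list.map iter_deriv.simps(2) IH fd[symmetric] ..
    also have "\<dots> = (\<Sum>ks\<in>?L. ?p ks *\<^sub>R (\<Sum>k\<in>I. a k *\<^sub>R iter_deriv f (e k # map e ks) z))"
    proof (intro sum.cong refl arg_cong2[where f = scaleR])
      fix ks assume ks: "ks \<in> ?L"
      have lin: "linear (\<lambda>v. iter_deriv f (v # map e ks) z)"
        using has_derivative_linear[OF iter_deriv_has_derivative[OF assms(1) lt[OF ks]]] .
      show "iter_deriv f ((\<Sum>k\<in>I. a k *\<^sub>R e k) # map e ks) z =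
          (\<Sum>k\<in>I. a k *\<^sub>R iter_deriv f (e k # map e ks) z)"
        by (simp only: linear_sum[OF lin] linear_scale[OF lin])
    qed
    also have "\<dots> = (\<Sum>k\<in>I. \<Sum>ks\<in>?L. (a k * ?p ks) *\<^sub>R iter_deriv f (map e (k # ks)) z)"
      by (subst sum.swap) (simp add: scaleR_sum_right mult.commute)
    also have "\<dots> = (\<Sum>(k, ks)\<in>I \<times> ?L. (a k * ?p ks) *\<^sub>R iter_deriv f (map e (k # ks)) z)"
      by (simp add: sum.cartesian_product)
    also have "\<dots> = (\<Sum>ks | length ks = length (a # as) \<and> set ks \<subseteq> I.
       prod_list (map2 (\<lambda>a k. a k) (a # as) ks) *\<^sub>R iter_deriv f (map e ks) z)"
      unfolding length_Cons lists_length_Suc_eq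
      by (subst sum.reindex) (auto simp: inj_on_def intro!: sum.cong)
    finally show "iter_deriv f (map (\<lambda>a. \<Sum>k\<in>I. a k *\<^sub>R e k) (a # as)) z =
      (\<Sum>ks | length ks = length (a # as) \<and> set ks \<subseteq> I.
       prod_list (map2 (\<lambda>a k. a k) (a # as) ks) *\<^sub>R iter_deriv f (map e ks) z)" .
  qed
qed

lemma prod_list_map2_inner_le:
  fixes vs bs :: "'a::euclidean_space list"
  assumes "length bs = length vs" "set bs \<subseteq> Basis"
  shows "\<bar>prod_list (map2 (\<lambda>a k. a k) (map (\<lambda>v b. v \<bullet> b) vs) bs)\<bar> \<le> prod_list (map norm vs)"
  using assms
proof (induction vs arbitrary: bs)
  case (Cons v vs)
  then obtain b bs' where bs: "bs = b # bs'" by (cases bs) auto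
  have "\<bar>v \<bullet> b\<bar> \<le> norm v"
    using Cons.prems bs Basis_le_norm by auto
  then show ?case
    using Cons bs by (auto simp: abs_mult intro!: mult_mono)
qed simp

lemma prod_list_norm_nonneg: "prod_list (map norm vs) \<ge> (0::real)"
  by (induction vs) auto

text \<open>\<open>C_upto\<close> gives continuity only for each fixed list of directions. Expanding
  in basis vectors leaves finitely many continuous functions on a compact ball, whence one constant
  for all directions.\<close>

lemma iter_deriv_bound:
  fixes f :: "'a::euclidean_space \<Rightarrow> 'b::real_normed_vector"
  assumes f: "C_upto M f" and m: "m \<le> M"
  shows "\<exists>C\<ge>0. \<forall>vs z. length vs = m \<longrightarrow> norm z \<le> \<rho> \<longrightarrow>
           norm (iter_deriv f vs z) \<le> C * prod_list (map norm vs)"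
proof -
  let ?L = "{bs. length bs = m \<and> set bs \<subseteq> (Basis :: 'a set)}"
  have fin: "finite ?L"
    using finite_lists_length_eq[OF finite_Basis, of m] by (simp add: conj_commute)
  have "\<exists>C\<ge>0. \<forall>z. norm z \<le> \<rho> \<longrightarrow> norm (iter_deriv f bs z) \<le> C" if "bs \<in> ?L" for bs
  proof -
    have "C_upto 0 (iter_deriv f bs)"
      using that f m by (intro C_upto_iter_deriv) (auto intro: C_upto_mono)
    then have "compact (iter_deriv f bs ` cball 0 \<rho>)"
      by (intro compact_continuous_image) (auto intro: continuous_on_subset)
    then obtain C where "\<forall>y\<in>iter_deriv f bs ` cball 0 \<rho>. norm y \<le> C"
      using compact_imp_bounded bounded_iff by blast
    then show ?thesis
      by (intro exI[of _ "max 0 C"]) (auto simp: le_max_iff_disj)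
  qed
  then have "\<exists>C. \<forall>bs\<in>?L. C bs \<ge> 0 \<and> (\<forall>z. norm z \<le> \<rho> \<longrightarrow> norm (iter_deriv f bs z) \<le> C bs)"
    by (intro bchoice) auto
  then obtain C where C: "\<And>bs. bs \<in> ?L \<Longrightarrow> C bs \<ge> 0"
    "\<And>bs z. bs \<in> ?L \<Longrightarrow> norm z \<le> \<rho> \<Longrightarrow> norm (iter_deriv f bs z) \<le> C bs"
    by blast
  show ?thesis
  proof (intro exI[of _ "\<Sum>bs\<in>?L. C bs"] conjI allI impI)
    show "0 \<le> sum C ?L" by (rule sum_nonneg) (use C in auto)
    fix vs :: "'a list" and z :: 'a assume len: "length vs = m" and z: "norm z \<le> \<rho>"
    have "map (\<lambda>a. \<Sum>b\<in>Basis. a b *\<^sub>R b) (map (\<lambda>v b. v \<bullet> b) vs) = vs"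
      by (simp add: o_def euclidean_representation)
    then have "iter_deriv f vs z = (\<Sum>bs\<in>?L.
        prod_list (map2 (\<lambda>a k. a k) (map (\<lambda>v b. v \<bullet> b) vs) bs) *\<^sub>R iter_deriv f bs z)"
      using fun_cong[OF iter_deriv_multilinear[OF f _ finite_Basis, of "map (\<lambda>v b. v \<bullet> b) vs" "\<lambda>b. b"], of z]
        len m by simp
    also have "norm \<dots> \<le> (\<Sum>bs\<in>?L. prod_list (map norm vs) * C bs)"
    proof (intro sum_norm_le)
      fix bs assume bs: "bs \<in> ?L"
      show "norm (prod_list (map2 (\<lambda>a k. a k) (map (\<lambda>v b. v \<bullet> b) vs) bs) *\<^sub>R iter_deriv f bs z)
          \<le> prod_list (map norm vs) * C bs"
        using prod_list_map2_inner_le[of bs vs] bs len C(2)[OF bs z] prod_list_norm_nonneg[of vs]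
        by (auto intro!: mult_mono)
    qed
    also have "\<dots> = (\<Sum>bs\<in>?L. C bs) * prod_list (map norm vs)"
      by (simp add: sum_distrib_left mult.commute)
    finally show "norm (iter_deriv f vs z) \<le> (\<Sum>bs\<in>?L. C bs) * prod_list (map norm vs)" .
  qed
qed

text \<open>Induction on the order: the \<theta>-derivative of the remainder of order M + 1 is the
  remainder of order M of D h[\<eta>], whose bound is then integrated. This is why the estimate is
  claimed for every \<theta> in [0, 1] and not only for \<theta> = 1.\<close>

lemma taylor_along_segment:
  fixes h :: "'a::real_normed_vector \<Rightarrow> 'b::real_normed_vector"
  assumes "C_upto M h"
    and "\<And>\<theta>. \<theta> \<in> {0..1} \<Longrightarrow> norm (iter_deriv h (replicate M \<eta>) (x + \<theta> *\<^sub>R \<eta>)) \<le> B"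
    and "\<theta> \<in> {0..1}"
  shows "norm (h (x + \<theta> *\<^sub>R \<eta>) - (\<Sum>m<M. (\<theta>^m / fact m) *\<^sub>R iter_deriv h (replicate m \<eta>) x))
           \<le> B * \<theta>^M / fact M"
  using assms
proof (induction M arbitrary: h \<theta>)
  case (Suc M)
  let ?h = "iter_deriv h [\<eta>]"
  \<comment> \<open>The extra direction is the innermost one here, while \<open>iter_deriv\<close>
    adds directions on the outside; for a constant list both agree.\<close>
  have rep: "iter_deriv ?h (replicate m \<eta>) = iter_deriv h (replicate (Suc m) \<eta>)" for m
    by (metis iter_deriv_append replicate_append_same replicate_Suc)
  have hC: "C_upto M ?h" using Suc.prems(1) by simp
  define E where "E t = h (x + t *\<^sub>R \<eta>) - (\<Sum>m<Suc M. (t^m / fact m) *\<^sub>R iter_deriv h (replicate m \<eta>) x)" for t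
  define E' where "E' t = ?h (x + t *\<^sub>R \<eta>) - (\<Sum>m<M. (t^m / fact m) *\<^sub>R iter_deriv ?h (replicate m \<eta>) x)" for t
  define p where "p t = B * t ^ Suc M / fact (Suc M)" for t :: real
  have bd: "norm (E' t) \<le> B * t^M / fact M" if "t \<in> {0..1}" for t
    unfolding E'_def
  proof (rule Suc.IH[OF hC _ that])
    show "norm (iter_deriv ?h (replicate M \<eta>) (x + \<theta> *\<^sub>R \<eta>)) \<le> B" if "\<theta> \<in> {0..1}" for \<theta>
      using Suc.prems(2)[OF that] by (simp only: rep)
  qed
  have dE: "(E has_vector_derivative E' t) (at t within S)" for t S
  proof -
    have "((\<lambda>t. \<Sum>m<Suc M. (t^m / fact m) *\<^sub>R iter_deriv h (replicate m \<eta>) x) has_vector_derivative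
        (\<Sum>m<M. (t^m / fact m) *\<^sub>R iter_deriv ?h (replicate m \<eta>) x)) (at t within S)"
      unfolding sum.lessThan_Suc_shift rep
    proof (rule has_vector_derivative_eq_rhs)
      show "((\<lambda>t. (t^0 / fact 0) *\<^sub>R iter_deriv h (replicate 0 \<eta>) x +
              (\<Sum>i<M. (t ^ Suc i / fact (Suc i)) *\<^sub>R iter_deriv h (replicate (Suc i) \<eta>) x))
            has_vector_derivative 0 + (\<Sum>i<M. (real (Suc i) * t ^ i / fact (Suc i)) *\<^sub>R iter_deriv h (replicate (Suc i) \<eta>) x))
            (at t within S)"
      proof (intro has_vector_derivative_add has_vector_derivative_sum)
        show "((\<lambda>t. (t^0 / fact 0) *\<^sub>R iter_deriv h (replicate 0 \<eta>) x) has_vector_derivative 0) (at t within S)"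
          by simp
        show "((\<lambda>t. (t ^ Suc i / fact (Suc i)) *\<^sub>R iter_deriv h (replicate (Suc i) \<eta>) x) has_vector_derivative
            (real (Suc i) * t ^ i / fact (Suc i)) *\<^sub>R iter_deriv h (replicate (Suc i) \<eta>) x) (at t within S)" for i
          by (rule has_vector_derivative_eq_rhs, rule has_vector_derivative_scaleR)
             (rule DERIV_cdivide, rule DERIV_pow, rule has_vector_derivative_const, simp)
      qed
      show "0 + (\<Sum>i<M. (real (Suc i) * t ^ i / fact (Suc i)) *\<^sub>R iter_deriv h (replicate (Suc i) \<eta>) x) =
          (\<Sum>m<M. (t^m / fact m) *\<^sub>R iter_deriv h (replicate (Suc m) \<eta>) x)"
        by (simp add: divide_simps del: replicate_Suc)
    qed
    moreover have "((\<lambda>t. h (x + t *\<^sub>R \<eta>)) has_vector_derivative ?h (x + t *\<^sub>R \<eta>)) (at t within S)"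
      using iter_deriv_along_segment[OF Suc.prems(1), of "[]"] by simp
    ultimately show ?thesis
      unfolding E_def E'_def by (intro has_vector_derivative_diff)
  qed
  have dp: "(p has_vector_derivative B * t^M / fact M) (at t within S)" for t S
    unfolding p_def has_real_derivative_iff_has_vector_derivative[symmetric]
    by (rule DERIV_cdivide[THEN DERIV_cong], rule DERIV_cmult[OF DERIV_pow])
       (simp add: divide_simps del: of_nat_Suc)
  have "norm (E \<theta> - E 0) \<le> p \<theta> - p 0"
  proof (cases "\<theta> = 0")
    case False
    then have th: "0 < \<theta>" "\<theta> \<le> 1" using Suc.prems(3) by auto
    show ?thesis
    proof (rule differentiable_bound_general[OF th(1)])
      show "continuous_on {0..\<theta>} E" "continuous_on {0..\<theta>} p"
        using dE dp by (meson continuous_on_vector_derivative)+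
      show "(E has_vector_derivative E' t) (at t)" "(p has_vector_derivative B * t^M / fact M) (at t)" for t
        using dE dp by auto
      show "norm (E' t) \<le> B * t^M / fact M" if "0 < t" "t < \<theta>" for t
        using bd th that by auto
    qed
  qed simp
  moreover have "E 0 = 0" "p 0 = 0"
    by (simp_all add: E_def p_def sum.lessThan_Suc_shift del: sum.lessThan_Suc)
  ultimately show ?case
    unfolding E_def p_def by simp
qed simp

section \<open>Taylor expansion along a polynomial curve\<close>

text \<open>The coefficient of s^i in the Taylor polynomial of h at x of degree below L, evaluated
  at x + \<Sum> s^k \<eta>_k with k = 1..K. Both truncations are parameters because the shifts, the
  residual and \<open>linear_term\<close> use different ones; they are immaterial once i < L and i
  \<le> K.\<close>

definition taylor_coef ::
  "nat \<Rightarrow> nat \<Rightarrow> ('a::real_normed_vector \<Rightarrow> 'b::real_normed_vector) \<Rightarrow> (nat \<Rightarrow> 'a) \<Rightarrow> nat \<Rightarrow> 'a \<Rightarrow> 'b" where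
  "taylor_coef L K h \<eta> i x = (\<Sum>m<L. (1 / fact m) *\<^sub>R
     (\<Sum>ks | length ks = m \<and> set ks \<subseteq> {1..K} \<and> sum_list ks = i. iter_deriv h (map \<eta> ks) x))"

lemma length_le_sum_list:
  fixes ks :: "nat list"
  shows "set ks \<subseteq> {1..K} \<Longrightarrow> length ks \<le> sum_list ks"
  by (induction ks) auto

lemma taylor_coef_cong:
  assumes "\<And>k. k \<in> {1..K} \<Longrightarrow> \<eta> k = \<eta>' k"
  shows "taylor_coef L K h \<eta> i x = taylor_coef L K h \<eta>' i x"
proof -
  have "map \<eta> ks = map \<eta>' ks" if "set ks \<subseteq> {1..K}" for ks
    using that assms by (intro map_cong) auto
  then show ?thesis
    unfolding taylor_coef_def by (intro sum.cong refl arg_cong2[where f = scaleR]) (simp only: mem_Collect_eq)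
qed

text \<open>Parts are at least 1, so a list with sum i has at most i entries.\<close>

lemma taylor_coef_level:
  assumes "i < L"
  shows "taylor_coef L K h \<eta> i x = taylor_coef (Suc i) K h \<eta> i x"
  unfolding taylor_coef_def
proof (rule sum.mono_neutral_right)
  show "\<forall>m\<in>{..<L} - {..<Suc i}. (1 / fact m) *\<^sub>R
      (\<Sum>ks | length ks = m \<and> set ks \<subseteq> {1..K} \<and> sum_list ks = i. iter_deriv h (map \<eta> ks) x) = 0"
  proof
    fix m assume "m \<in> {..<L} - {..<Suc i}"
    then have e: "{ks. length ks = m \<and> set ks \<subseteq> {1..K} \<and> sum_list ks = i} = {}"
      using length_le_sum_list[of _ K] by fastforce
    show "(1 / fact m) *\<^sub>R
      (\<Sum>ks | length ks = m \<and> set ks \<subseteq> {1..K} \<and> sum_list ks = i. iter_deriv h (map \<eta> ks) x) = 0"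
      unfolding e by simp
  qed
qed (use assms in auto)

text \<open>No part exceeds the sum of all parts.\<close>

lemma taylor_coef_parts:
  assumes "i \<le> K"
  shows "taylor_coef L K h \<eta> i x = taylor_coef L i h \<eta> i x"
proof -
  have "set ks \<subseteq> {1..K} \<longleftrightarrow> set ks \<subseteq> {1..i}" if "sum_list ks = i" for ks :: "nat list"
    using member_le_sum_list[of _ ks] that assms by fastforce
  then have "{ks. length ks = m \<and> set ks \<subseteq> {1..K} \<and> sum_list ks = i} =
      {ks. length ks = m \<and> set ks \<subseteq> {1..i} \<and> sum_list ks = i}" for m
    by blast
  then show ?thesis
    unfolding taylor_coef_def by simp
qed

lemma taylor_coef_0: "L > 0 \<Longrightarrow> taylor_coef L K h \<eta> 0 x = h x"
proof -
  have e: "{ks. length ks = 0 \<and> set ks \<subseteq> {1..K} \<and> sum_list ks = 0} = {[]}" by auto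
  show "L > 0 \<Longrightarrow> ?thesis"
    unfolding taylor_coef_level[of 0] by (simp add: taylor_coef_def e[simplified])
qed

lemma prod_list_norm_le_power:
  assumes "\<And>k. k \<in> {1..K} \<Longrightarrow> norm (\<eta> k) \<le> e" "e \<ge> 0"
  shows "set ks \<subseteq> {1..K} \<Longrightarrow> prod_list (map norm (map \<eta> ks)) \<le> e ^ length ks"
  by (induction ks) (use assms prod_list_norm_nonneg[of "map \<eta> _"] in \<open>auto intro!: mult_mono\<close>)

lemma finite_part_lists: "finite {ks::nat list. length ks = m \<and> set ks \<subseteq> {1..K}}"
  using finite_lists_length_eq[of "{1..K}" m] by (simp add: conj_commute)

text \<open>For i \<ge> 1 no list of parts is empty, so each term has at least one factor of size e,
  and e \<le> 1 disposes of the others. Later e is a multiple of |xb|, which is what makes these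
  coefficients vanish as xb tends to 0.\<close>

lemma taylor_coef_bound:
  fixes h :: "'a::euclidean_space \<Rightarrow> 'b::real_normed_vector"
  assumes h: "C_upto i h" and i: "i \<ge> 1"
  shows "\<exists>C\<ge>0. \<forall>x \<eta> e. norm x \<le> \<rho> \<longrightarrow> (\<forall>k\<in>{1..K}. norm (\<eta> k) \<le> e) \<longrightarrow> 0 \<le> e \<longrightarrow> e \<le> 1 \<longrightarrow>
           norm (taylor_coef (Suc i) K h \<eta> i x) \<le> C * e"
proof -
  have "\<forall>m\<in>{..<Suc i}. \<exists>C\<ge>0. \<forall>vs z. length vs = m \<longrightarrow> norm z \<le> \<rho> \<longrightarrow>
           norm (iter_deriv h vs z) \<le> C * prod_list (map norm vs)"
    using iter_deriv_bound[OF h] by auto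
  then obtain C where C: "\<forall>m\<in>{..<Suc i}. C m \<ge> 0 \<and> (\<forall>vs z. length vs = m \<longrightarrow> norm z \<le> \<rho> \<longrightarrow>
           norm (iter_deriv h vs z) \<le> C m * prod_list (map norm vs))"
    by (rule bchoice[THEN exE])
  define L where "L m = {ks. length ks = m \<and> set ks \<subseteq> {1..K} \<and> sum_list ks = i}" for m
  show ?thesis
  proof (intro exI[of _ "\<Sum>m<Suc i. real (card (L m)) * C m"] conjI allI impI)
    show "0 \<le> (\<Sum>m<Suc i. real (card (L m)) * C m)"
      using C by (intro sum_nonneg mult_nonneg_nonneg) auto
    fix x :: 'a and \<eta> and e :: real assume a: "norm x \<le> \<rho>" "\<forall>k\<in>{1..K}. norm (\<eta> k :: 'a) \<le> e" "0 \<le> e" "e \<le> 1"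
    have "norm (taylor_coef (Suc i) K h \<eta> i x) \<le> (\<Sum>m<Suc i. (real (card (L m)) * C m) * e)"
      unfolding taylor_coef_def L_def[symmetric]
    proof (rule sum_norm_le)
      fix m assume m: "m \<in> {..<Suc i}"
      have "norm (\<Sum>ks\<in>L m. iter_deriv h (map \<eta> ks) x) \<le> (\<Sum>ks\<in>L m. C m * e)"
      proof (rule sum_norm_le)
        fix ks assume ks: "ks \<in> L m"
        have "ks \<noteq> []" using ks i by (auto simp: L_def)
        then have m1: "m \<ge> 1" using ks by (cases ks) (auto simp: L_def)
        have "norm (iter_deriv h (map \<eta> ks) x) \<le> C m * prod_list (map norm (map \<eta> ks))"
          using C m ks a(1) by (auto simp: L_def simp del: map_map)
        also have "\<dots> \<le> C m * e ^ m"
          using prod_list_norm_le_power[of K \<eta> e ks] a ks C m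
          by (intro mult_left_mono) (auto simp: L_def)
        also have "\<dots> \<le> C m * e"
          using C m power_decreasing[OF m1 a(3,4)] by (intro mult_left_mono) auto
        finally show "norm (iter_deriv h (map \<eta> ks) x) \<le> C m * e" .
      qed
      also have "\<dots> = real (card (L m)) * C m * e" by simp
      finally have *: "norm (\<Sum>ks\<in>L m. iter_deriv h (map \<eta> ks) x) \<le> real (card (L m)) * C m * e" .
      have "norm ((1 / fact m) *\<^sub>R (\<Sum>ks\<in>L m. iter_deriv h (map \<eta> ks) x)) \<le>
          1 * norm (\<Sum>ks\<in>L m. iter_deriv h (map \<eta> ks) x)"
        unfolding norm_scaleR by (intro mult_right_mono) (auto simp: divide_le_eq_1)
      then show "norm ((1 / fact m) *\<^sub>R (\<Sum>ks\<in>L m. iter_deriv h (map \<eta> ks) x)) \<le> real (card (L m)) * C m * e"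
        using * by linarith
    qed
    then show "norm (taylor_coef (Suc i) K h \<eta> i x) \<le> (\<Sum>m<Suc i. real (card (L m)) * C m) * e"
      by (simp only: sum_distrib_right)
  qed
qed

lemma prod_list_map2_replicate_power:
  "length ks = m \<Longrightarrow> prod_list (map2 (\<lambda>a k. a k) (replicate m (\<lambda>k. s ^ k)) ks) = (s::real) ^ sum_list ks"
  by (induction ks arbitrary: m) (auto simp: power_add)

lemma norm_curve_le:
  fixes \<eta> :: "nat \<Rightarrow> 'a::real_normed_vector"
  assumes "\<forall>k\<in>{1..K}. norm (\<eta> k) \<le> e" "0 \<le> s" "s \<le> 1"
  shows "norm (\<Sum>k=1..K. s ^ k *\<^sub>R \<eta> k) \<le> real K * e * s"
proof -
  have "norm (\<Sum>k=1..K. s ^ k *\<^sub>R \<eta> k) \<le> (\<Sum>k=1..K. s * e)"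
  proof (rule sum_norm_le)
    fix k assume k: "k \<in> {1..K}"
    then have "s ^ k \<le> s"
      using power_decreasing[of 1 k s] assms by auto
    then show "norm (s ^ k *\<^sub>R \<eta> k) \<le> s * e"
      using assms k by (auto intro!: mult_mono)
  qed
  then show ?thesis by (simp add: mult_ac)
qed

text \<open>Taylor's formula at the increment of the curve is expanded multilinearly and sorted by
  powers of s. Every discarded term has order at least J \<ge> 1 in s, hence at least one factor
  \<eta>_k, and the Taylor remainder has J such factors; so the error carries a factor e besides
  s^J.\<close>

lemma taylor_along_curve:
  fixes h :: "'a::euclidean_space \<Rightarrow> 'b::real_normed_vector"
  assumes h: "C_upto J h" and J: "1 \<le> J" "J \<le> L"
  shows "\<exists>C\<ge>0. \<forall>x \<eta> e s. norm x \<le> \<rho> \<longrightarrow> (\<forall>k\<in>{1..K}. norm (\<eta> k) \<le> e) \<longrightarrow> 0 \<le> e \<longrightarrow> e \<le> 1 \<longrightarrow>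
           0 \<le> s \<longrightarrow> s \<le> 1 \<longrightarrow>
           norm (h (x + (\<Sum>k=1..K. s ^ k *\<^sub>R \<eta> k)) - (\<Sum>i<J. s ^ i *\<^sub>R taylor_coef L K h \<eta> i x)) \<le> C * e * s ^ J"
proof -
  have "\<forall>m\<in>{..J}. \<exists>C\<ge>0. \<forall>vs z. length vs = m \<longrightarrow> norm z \<le> \<rho> + real K \<longrightarrow>
           norm (iter_deriv h vs z) \<le> C * prod_list (map norm vs)"
    using iter_deriv_bound[OF h] by auto
  then obtain C where C: "\<forall>m\<in>{..J}. C m \<ge> 0 \<and> (\<forall>vs z. length vs = m \<longrightarrow> norm z \<le> \<rho> + real K \<longrightarrow>
           norm (iter_deriv h vs z) \<le> C m * prod_list (map norm vs))"
    by (rule bchoice[THEN exE])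
  define A where "A m = {ks. length ks = m \<and> set ks \<subseteq> {1..K}}" for m
  have finA: "finite (A m)" for m
    unfolding A_def by (rule finite_part_lists)
  define D where "D = C J * real K ^ J + (\<Sum>m<J. real (card (A m)) * C m)"
  show ?thesis
  proof (intro exI[of _ D] conjI allI impI)
    show "0 \<le> D" unfolding D_def
      using C by (intro add_nonneg_nonneg sum_nonneg mult_nonneg_nonneg) auto
    fix x :: 'a and e and \<eta> :: "nat \<Rightarrow> 'a" and s :: real
    assume x: "norm x \<le> \<rho>" and \<eta>: "\<forall>k\<in>{1..K}. norm (\<eta> k) \<le> e" and e: "0 \<le> e" "e \<le> 1" and s: "0 \<le> s" "s \<le> 1"
    define w where "w = (\<Sum>k=1..K. s ^ k *\<^sub>R \<eta> k)"
    have w: "norm w \<le> real K * e * s"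
      unfolding w_def using norm_curve_le[OF \<eta> s] .
    also have "\<dots> \<le> real K * 1 * 1"
      using e s by (intro mult_mono) auto
    finally have wK: "norm w \<le> real K" by simp
    have near: "norm (x + \<theta> *\<^sub>R w) \<le> \<rho> + real K" if "\<theta> \<in> {0..1}" for \<theta>
    proof -
      have "norm (\<theta> *\<^sub>R w) \<le> 1 * norm w"
        unfolding norm_scaleR using that by (intro mult_right_mono) auto
      then show ?thesis
        using norm_triangle_ineq[of x "\<theta> *\<^sub>R w"] x wK by linarith
    qed
    have "norm (iter_deriv h (replicate J w) (x + \<theta> *\<^sub>R w)) \<le> C J * (real K * e * s) ^ J"
      if "\<theta> \<in> {0..1}" for \<theta>
    proof -
      have "norm (iter_deriv h (replicate J w) (x + \<theta> *\<^sub>R w)) \<le> C J * norm w ^ J"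
        using C near[OF that] by (metis atMost_iff length_replicate map_replicate order_refl prod_list_replicate)
      also have "\<dots> \<le> C J * (real K * e * s) ^ J"
        using C w by (intro mult_left_mono power_mono) auto
      finally show ?thesis .
    qed
    from taylor_along_segment[OF h this, of 1]
    have "norm (h (x + w) - (\<Sum>m<J. (1 / fact m) *\<^sub>R iter_deriv h (replicate m w) x)) \<le>
        C J * (real K * e * s) ^ J / fact J" by simp
    also have "\<dots> \<le> C J * (real K * e * s) ^ J / 1"
      using C e s by (intro divide_left_mono mult_nonneg_nonneg) auto
    also have "\<dots> = C J * real K ^ J * e ^ J * s ^ J"
      by (simp add: power_mult_distrib)
    also have "\<dots> \<le> C J * real K ^ J * e * s ^ J"
      using C e s power_decreasing[OF J(1) e] by (intro mult_right_mono mult_left_mono) auto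
    finally have R1: "norm (h (x + w) - (\<Sum>m<J. (1 / fact m) *\<^sub>R iter_deriv h (replicate m w) x)) \<le>
        C J * real K ^ J * e * s ^ J" .
    \<comment> \<open>\<open>B m i\<close> lists the m-fold terms of exact power s^i;
      \<open>T m\<close> lists those of power at least J, which go into the error.\<close>
    define B where "B m i = {ks. length ks = m \<and> set ks \<subseteq> {1..K} \<and> sum_list ks = i}" for m i
    define T where "T m = {ks\<in>A m. J \<le> sum_list ks}" for m
    have split: "iter_deriv h (replicate m w) x =
        (\<Sum>i<J. s ^ i *\<^sub>R (\<Sum>ks\<in>B m i. iter_deriv h (map \<eta> ks) x)) +
        (\<Sum>ks\<in>T m. s ^ sum_list ks *\<^sub>R iter_deriv h (map \<eta> ks) x)" if m: "m < J" for m
    proof -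
      have "iter_deriv h (replicate m w) x =
          (\<Sum>ks\<in>A m. prod_list (map2 (\<lambda>a k. a k) (replicate m (\<lambda>k. s ^ k)) ks) *\<^sub>R iter_deriv h (map \<eta> ks) x)"
        using fun_cong[OF iter_deriv_multilinear[OF h, of "replicate m (\<lambda>k. s ^ k)" "{1..K}" \<eta>], of x] m
        by (simp add: w_def A_def)
      also have "\<dots> = (\<Sum>ks\<in>A m. s ^ sum_list ks *\<^sub>R iter_deriv h (map \<eta> ks) x)"
        by (intro sum.cong refl arg_cong2[where f = scaleR] prod_list_map2_replicate_power) (simp add: A_def)
      also have "\<dots> = (\<Sum>ks\<in>A m - T m. s ^ sum_list ks *\<^sub>R iter_deriv h (map \<eta> ks) x) +
          (\<Sum>ks\<in>T m. s ^ sum_list ks *\<^sub>R iter_deriv h (map \<eta> ks) x)"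
        using finA by (intro sum.subset_diff) (auto simp: T_def)
      also have "A m - T m = (\<Union>i<J. B m i)"
        by (auto simp: A_def T_def B_def)
      also have "(\<Sum>ks\<in>(\<Union>i<J. B m i). s ^ sum_list ks *\<^sub>R iter_deriv h (map \<eta> ks) x) =
          (\<Sum>i<J. \<Sum>ks\<in>B m i. s ^ sum_list ks *\<^sub>R iter_deriv h (map \<eta> ks) x)"
        by (rule sum.UNION_disjoint) (auto simp: B_def intro: finite_subset[OF _ finA[of m]] simp: A_def)
      also have "\<dots> = (\<Sum>i<J. s ^ i *\<^sub>R (\<Sum>ks\<in>B m i. iter_deriv h (map \<eta> ks) x))"
        unfolding scaleR_sum_right by (intro sum.cong refl) (simp add: B_def)
      finally show ?thesis .
    qed
    have tail: "norm (\<Sum>ks\<in>T m. s ^ sum_list ks *\<^sub>R iter_deriv h (map \<eta> ks) x) \<le>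
        real (card (A m)) * C m * e * s ^ J" if m: "m < J" for m
    proof -
      have "norm (\<Sum>ks\<in>T m. s ^ sum_list ks *\<^sub>R iter_deriv h (map \<eta> ks) x) \<le> (\<Sum>ks\<in>T m. s ^ J * (C m * e))"
      proof (rule sum_norm_le)
        fix ks assume ks: "ks \<in> T m"
        then have ks': "length ks = m" "set ks \<subseteq> {1..K}" "J \<le> sum_list ks"
          by (auto simp: T_def A_def)
        have "ks \<noteq> []" using ks' J by auto
        then have m1: "m \<ge> 1" using ks'(1) by (cases ks) auto
        have Cm: "C m \<ge> 0" using C m by auto
        have "norm (iter_deriv h (map \<eta> ks) x) \<le> C m * prod_list (map norm (map \<eta> ks))"
          using C m ks'(1) x by (auto simp: add_increasing2 simp del: map_map)
        also have "\<dots> \<le> C m * e ^ m"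
          using prod_list_norm_le_power[of K \<eta> e ks] \<eta> e ks' Cm by (intro mult_left_mono) auto
        also have "\<dots> \<le> C m * e"
          using Cm power_decreasing[OF m1 e] by (intro mult_left_mono) auto
        finally have "norm (iter_deriv h (map \<eta> ks) x) \<le> C m * e" .
        moreover have "s ^ sum_list ks \<le> s ^ J"
          using s ks'(3) by (intro power_decreasing) auto
        ultimately show "norm (s ^ sum_list ks *\<^sub>R iter_deriv h (map \<eta> ks) x) \<le> s ^ J * (C m * e)"
          unfolding norm_scaleR using s Cm e by (intro mult_mono) auto
      qed
      also have "\<dots> = real (card (T m)) * (s ^ J * (C m * e))" by simp
      also have "\<dots> \<le> real (card (A m)) * (s ^ J * (C m * e))"
        using finA[of m] C m e s
        by (intro mult_right_mono mult_nonneg_nonneg) (auto intro!: card_mono simp: T_def)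
      finally show ?thesis by (simp add: mult_ac)
    qed
    \<comment> \<open>For indices i < J the sum over m < L may be cut to m < J, since longer lists
      have a sum larger than i.\<close>
    have coef: "taylor_coef L K h \<eta> i x = (\<Sum>m<J. (1 / fact m) *\<^sub>R (\<Sum>ks\<in>B m i. iter_deriv h (map \<eta> ks) x))"
      if "i < J" for i
      using taylor_coef_level[of i L K h \<eta> x] taylor_coef_level[of i J K h \<eta> x] that J
      by (simp add: taylor_coef_def B_def)
    have "(\<Sum>m<J. (1 / fact m) *\<^sub>R iter_deriv h (replicate m w) x) - (\<Sum>i<J. s ^ i *\<^sub>R taylor_coef L K h \<eta> i x)
        = (\<Sum>m<J. (1 / fact m) *\<^sub>R (\<Sum>ks\<in>T m. s ^ sum_list ks *\<^sub>R iter_deriv h (map \<eta> ks) x))"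
    proof -
      have "(\<Sum>i<J. s ^ i *\<^sub>R taylor_coef L K h \<eta> i x) =
         (\<Sum>i<J. \<Sum>m<J. (1 / fact m) *\<^sub>R (s ^ i *\<^sub>R (\<Sum>ks\<in>B m i. iter_deriv h (map \<eta> ks) x)))"
        by (intro sum.cong refl) (simp add: coef scaleR_sum_right mult.commute)
      also have "\<dots> = (\<Sum>m<J. (1 / fact m) *\<^sub>R (\<Sum>i<J. s ^ i *\<^sub>R (\<Sum>ks\<in>B m i. iter_deriv h (map \<eta> ks) x)))"
        by (subst sum.swap) (simp only: scaleR_sum_right)
      finally show ?thesis
        by (simp add: split scaleR_add_right sum.distrib)
    qed
    also have "norm \<dots> \<le> (\<Sum>m<J. real (card (A m)) * C m * e * s ^ J)"
    proof (rule sum_norm_le)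
      fix m assume m: "m \<in> {..<J}"
      have "norm ((1 / fact m) *\<^sub>R (\<Sum>ks\<in>T m. s ^ sum_list ks *\<^sub>R iter_deriv h (map \<eta> ks) x)) \<le>
          1 * norm (\<Sum>ks\<in>T m. s ^ sum_list ks *\<^sub>R iter_deriv h (map \<eta> ks) x)"
        unfolding norm_scaleR by (intro mult_right_mono) (auto simp: divide_le_eq_1)
      then show "norm ((1 / fact m) *\<^sub>R (\<Sum>ks\<in>T m. s ^ sum_list ks *\<^sub>R iter_deriv h (map \<eta> ks) x)) \<le>
          real (card (A m)) * C m * e * s ^ J"
        using tail[of m] m by simp
    qed
    finally have "norm (h (x + w) - (\<Sum>i<J. s ^ i *\<^sub>R taylor_coef L K h \<eta> i x)) \<le>
        C J * real K ^ J * e * s ^ J + (\<Sum>m<J. real (card (A m)) * C m * e * s ^ J)"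
      using R1 norm_triangle_ineq[of "h (x + w) - (\<Sum>m<J. (1 / fact m) *\<^sub>R iter_deriv h (replicate m w) x)"
        "(\<Sum>m<J. (1 / fact m) *\<^sub>R iter_deriv h (replicate m w) x) - (\<Sum>i<J. s ^ i *\<^sub>R taylor_coef L K h \<eta> i x)"]
      by simp
    also have "\<dots> = D * e * s ^ J"
      by (simp only: D_def distrib_right sum_distrib_right)
    finally show "norm (h (x + (\<Sum>k=1..K. s ^ k *\<^sub>R \<eta> k)) - (\<Sum>i<J. s ^ i *\<^sub>R taylor_coef L K h \<eta> i x)) \<le> D * e * s ^ J"
      by (simp only: w_def)
  qed
qed

section \<open>The shifts and the expansion of the shifted system\<close>

lemma shifted_rhs_closed_form:
  "shifted_rhs f \<alpha> \<phi> xb K \<tau> c d =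
     (\<alpha> * exp (- \<alpha> * \<tau>)) *\<^sub>R f (xb + c + (\<Sum>k=1..K. exp (- real k * \<alpha> * \<tau>) *\<^sub>R \<phi> k xb), d)
     + (\<Sum>k=1..K. (real k * \<alpha> * exp (- real k * \<alpha> * \<tau>)) *\<^sub>R \<phi> k xb)"
proof (induction K arbitrary: c)
  case (Suc K)
  show ?case
    unfolding shifted_rhs.simps Suc.IH by (simp add: algebra_simps del: of_nat_Suc)
qed simp

lemma exp_minus_power: "exp (- real k * \<tau>) = exp (- \<tau>) ^ k"
  by (metis exp_of_nat_mult mult_minus_left mult_minus_right)

lemma shifted_rhs_power:
  "shifted_rhs f 1 \<phi> xb K \<tau> c d =
     exp (- \<tau>) *\<^sub>R f (xb + c + (\<Sum>k=1..K. exp (- \<tau>) ^ k *\<^sub>R \<phi> k xb), d)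
     + (\<Sum>k=1..K. (real k * exp (- \<tau>) ^ k) *\<^sub>R \<phi> k xb)"
  unfolding shifted_rhs_closed_form by (simp add: exp_minus_power[symmetric])

text \<open>Comparing the coefficients of s^K in y' = - f(y, 0) for y = xb + \<Sum> s^k \<phi>_k
  gives (K + 1) \<phi>_(K+1). The whole table is passed on because this coefficient involves all of
  \<phi>_1, ..., \<phi>_K; the truncations K + 1 and K suffice to give it in full.\<close>

primrec shift_table ::
  "((real^'n) \<times> (real^'r) \<Rightarrow> real^'n) \<Rightarrow> nat \<Rightarrow> nat \<Rightarrow> real^'n \<Rightarrow> real^'n" where
  "shift_table f 0 = (\<lambda>k xb. 0)"
| "shift_table f (Suc K) = (shift_table f K)(Suc K := (\<lambda>xb. - (1 / real (Suc K)) *\<^sub>R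
     taylor_coef (Suc K) K f (\<lambda>j. (shift_table f K j xb, 0)) K (xb, 0)))"

definition shift :: "((real^'n) \<times> (real^'r) \<Rightarrow> real^'n) \<Rightarrow> nat \<Rightarrow> real^'n \<Rightarrow> real^'n" where
  "shift f k = shift_table f k k"

lemma shift_table_eq_shift: "j \<le> K \<Longrightarrow> shift_table f K j = shift f j"
  unfolding shift_def by (induction K) (auto simp: le_Suc_eq)

text \<open>The recursion with its truncations freed, so that all shifts can be compared with one
  and the same Taylor expansion.\<close>

lemma shift_Suc:
  assumes "k < L" "k \<le> K"
  shows "real (Suc k) *\<^sub>R shift f (Suc k) xb = - taylor_coef L K f (\<lambda>j. (shift f j xb, 0)) k (xb, 0)"
proof -
  have "real (Suc k) *\<^sub>R shift f (Suc k) xb =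
      - taylor_coef (Suc k) k f (\<lambda>j. (shift_table f k j xb, 0)) k (xb, 0)"
    by (simp add: shift_def del: of_nat_Suc)
  also have "\<dots> = - taylor_coef (Suc k) k f (\<lambda>j. (shift f j xb, 0)) k (xb, 0)"
    by (subst taylor_coef_cong[where \<eta>' = "\<lambda>j. (shift f j xb, 0)"]) (auto simp: shift_table_eq_shift)
  also have "\<dots> = - taylor_coef L K f (\<lambda>j. (shift f j xb, 0)) k (xb, 0)"
    using assms by (simp add: taylor_coef_level[of k L] taylor_coef_parts[of k K])
  finally show ?thesis .
qed

lemma C1_bound_at_zero:
  fixes f :: "'a::euclidean_space \<Rightarrow> 'b::real_normed_vector"
  assumes "C_upto 1 f" "f 0 = 0"
  shows "\<exists>C\<ge>0. \<forall>x. norm x \<le> 1 \<longrightarrow> norm (f x) \<le> C * norm x"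
proof -
  obtain C where C: "C \<ge> 0" and *: "\<And>x \<eta> e s. norm (x::'a) \<le> 0 \<Longrightarrow> (\<forall>k\<in>{1..1}. norm (\<eta> k) \<le> e) \<Longrightarrow>
      0 \<le> e \<Longrightarrow> e \<le> 1 \<Longrightarrow> 0 \<le> s \<Longrightarrow> s \<le> 1 \<Longrightarrow>
      norm (f (x + (\<Sum>k=1..1. s ^ k *\<^sub>R \<eta> k)) - (\<Sum>i<1. s ^ i *\<^sub>R taylor_coef 1 1 f \<eta> i x)) \<le> C * e * s ^ 1"
    using taylor_along_curve[OF assms(1) order_refl order_refl, of 0 1] by blast
  \<comment> \<open>The point x is reached from 0 along the curve s x at s = 1, with e = |x|; at
    order 1 the error bound is then linear in |x|.\<close>
  show ?thesis
    using *[of 0 "\<lambda>_. x" "norm x" 1 for x] C assms(2) by (intro exI[of _ C]) (auto simp: taylor_coef_0)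
qed

text \<open>Induction along the recursion. The bounds already found enter as e = C |xb|, which must
  be at most 1 for the coefficient bound; therefore \<delta> shrinks as C grows. The first shift -
  f(xb, 0) is treated apart: it contains no earlier shift, and its smallness comes from f(0) =
  0.\<close>

lemma shift_bound:
  fixes f :: "(real^'n) \<times> (real^'r) \<Rightarrow> real^'n"
  assumes f: "C_upto (Suc K) f" "f 0 = 0"
  shows "\<exists>\<delta>>0. \<exists>C\<ge>0. \<delta> \<le> 1 \<and> C * \<delta> \<le> 1 \<and>
    (\<forall>k\<in>{1..K}. \<forall>xb. norm xb \<le> \<delta> \<longrightarrow> norm (shift f k xb) \<le> C * norm xb)"
  using f(1)
proof (induction K)
  case 0
  show ?case by (intro exI[of _ 1] conjI exI[of _ 0]) auto
next
  case (Suc K)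
  have CK: "C_upto K f" and C1: "C_upto 1 f"
    by (rule C_upto_mono[OF Suc.prems], simp)+
  obtain \<delta> C where d: "\<delta> > 0" "C \<ge> 0" "\<delta> \<le> 1" "C * \<delta> \<le> 1"
    "\<And>k xb. k \<in> {1..K} \<Longrightarrow> norm xb \<le> \<delta> \<Longrightarrow> norm (shift f k xb) \<le> C * norm xb"
    using Suc.IH[OF C_upto_Suc_imp[OF Suc.prems]] by blast
  have "\<exists>C'\<ge>0. \<forall>xb. norm xb \<le> \<delta> \<longrightarrow> norm (shift f (Suc K) xb) \<le> C' * norm xb"
  proof (cases "K = 0")
    case True
    obtain C' where C': "C' \<ge> 0" "\<And>x. norm x \<le> 1 \<Longrightarrow> norm (f x) \<le> C' * norm x"
      using C1_bound_at_zero[OF C1 f(2)] by blast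
    have "shift f (Suc K) xb = - f (xb, 0)" for xb
      using shift_Suc[of 0 1 0 f xb] True by (simp add: taylor_coef_0)
    moreover have "norm (f (xb, 0)) \<le> C' * norm xb" if "norm xb \<le> \<delta>" for xb :: "real^'n"
      using C'(2)[of "(xb, 0)"] d(3) that by (simp add: norm_Pair1)
    ultimately show ?thesis
      using C'(1) by (intro exI[of _ C']) simp
  next
    case False
    then have "K \<ge> 1" by simp
    from taylor_coef_bound[OF CK this, of 1 K] obtain C' where
      C': "C' \<ge> 0" "\<And>x \<eta> e. norm x \<le> 1 \<Longrightarrow> (\<forall>k\<in>{1..K}. norm (\<eta> k) \<le> e) \<Longrightarrow> 0 \<le> e \<Longrightarrow> e \<le> 1 \<Longrightarrow>
        norm (taylor_coef (Suc K) K f \<eta> K x) \<le> C' * e"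
      by blast
    show ?thesis
    proof (intro exI[of _ "C' * C"] conjI allI impI)
      show "0 \<le> C' * C" using C'(1) d(2) by simp
      fix xb :: "real^'n" assume xb: "norm xb \<le> \<delta>"
      have e: "C * norm xb \<le> 1"
        using mult_left_mono[OF xb d(2)] d(4) by linarith
      have "norm (shift f (Suc K) xb) \<le> norm (real (Suc K) *\<^sub>R shift f (Suc K) xb)"
        using mult_right_mono[of 1 "real (Suc K)" "norm (shift f (Suc K) xb)"] by simp
      also have "\<dots> = norm (taylor_coef (Suc K) K f (\<lambda>j. (shift f j xb, 0)) K (xb, 0))"
        by (simp only: shift_Suc[of K "Suc K" K] lessI order_refl norm_minus_cancel)
      also have "\<dots> \<le> C' * (C * norm xb)"
        using d xb e by (intro C') (auto simp: norm_Pair1)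
      finally show "norm (shift f (Suc K) xb) \<le> C' * C * norm xb" by (simp add: mult_ac)
    qed
  qed
  then obtain C' where C': "C' \<ge> 0" "\<And>xb. norm xb \<le> \<delta> \<Longrightarrow> norm (shift f (Suc K) xb) \<le> C' * norm xb"
    by blast
  define E where "E = max C C'"
  define \<delta>' where "\<delta>' = min \<delta> (1 / (E + 1))"
  have E: "E \<ge> 0" "E \<ge> C" "E \<ge> C'" using d C' by (auto simp: E_def)
  have pos: "\<delta>' > 0" using d E by (auto simp: \<delta>'_def)
  show ?case
  proof (rule exI[of _ \<delta>'], rule conjI[OF pos], rule exI[of _ E], intro conjI ballI allI impI)
    show "0 \<le> E" "\<delta>' \<le> 1" using d E by (auto simp: \<delta>'_def)
    have "E * \<delta>' \<le> E * (1 / (E + 1))" using E by (intro mult_left_mono) (auto simp: \<delta>'_def)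
    also have "\<dots> \<le> 1" using E by (simp add: divide_le_eq_1)
    finally show "E * \<delta>' \<le> 1" .
    fix k and xb :: "real^'n" assume k: "k \<in> {1..Suc K}" and xb: "norm xb \<le> \<delta>'"
    then have xb': "norm xb \<le> \<delta>" by (simp add: \<delta>'_def)
    have "norm (shift f k xb) \<le> C * norm xb \<or> norm (shift f k xb) \<le> C' * norm xb"
      using k d(5)[OF _ xb'] C'(2)[OF xb'] by (cases "k = Suc K") auto
    moreover have "C * norm xb \<le> E * norm xb" "C' * norm xb \<le> E * norm xb"
      using E by (intro mult_right_mono; simp)+
    ultimately show "norm (shift f k xb) \<le> E * norm xb" by linarith
  qed
qed

lemma curve_Pair: "(xb, 0) + (\<Sum>k=1..K. s ^ k *\<^sub>R (\<eta> k, 0)) = (xb + (\<Sum>k=1..K. s ^ k *\<^sub>R \<eta> k), 0)"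
  by (simp add: prod_eq_iff fst_sum snd_sum)

text \<open>By the recursion \<Sum> j s^j \<phi>_j is minus s times the Taylor polynomial of f along
  the curve up to s^(k-1). What remains is s times a Taylor error of order k.\<close>

lemma shift_residual_bound:
  fixes f :: "(real^'n) \<times> (real^'r) \<Rightarrow> real^'n"
  assumes f: "C_upto k f" and k: "k \<ge> 1" and d: "C \<ge> 0" "\<delta> \<le> 1" "C * \<delta> \<le> 1"
    "\<And>j xb. j \<in> {1..k} \<Longrightarrow> norm xb \<le> \<delta> \<Longrightarrow> norm (shift f j xb) \<le> C * norm xb"
  shows "\<exists>D\<ge>0. \<forall>xb s. norm xb \<le> \<delta> \<longrightarrow> 0 \<le> s \<longrightarrow> s \<le> 1 \<longrightarrow>
    norm (s *\<^sub>R f (xb + (\<Sum>j=1..k. s ^ j *\<^sub>R shift f j xb), 0) + (\<Sum>j=1..k. (real j * s ^ j) *\<^sub>R shift f j xb))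
      \<le> D * s ^ Suc k * norm xb"
proof -
  from taylor_along_curve[OF f k order_refl, of 1 k] obtain D where
    D: "D \<ge> 0" "\<And>x \<eta> e s. norm x \<le> 1 \<Longrightarrow> (\<forall>k\<in>{1..k}. norm (\<eta> k) \<le> e) \<Longrightarrow> 0 \<le> e \<Longrightarrow> e \<le> 1 \<Longrightarrow>
      0 \<le> s \<Longrightarrow> s \<le> 1 \<Longrightarrow> norm (f (x + (\<Sum>k=1..k. s ^ k *\<^sub>R \<eta> k)) - (\<Sum>i<k. s ^ i *\<^sub>R taylor_coef k k f \<eta> i x))
      \<le> D * e * s ^ k" by blast
  show ?thesis
  proof (intro exI[of _ "D * C"] conjI allI impI)
    show "0 \<le> D * C" using D(1) d(1) by simp
    fix xb :: "real^'n" and s :: real assume xb: "norm xb \<le> \<delta>" and s: "0 \<le> s" "s \<le> 1"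
    let ?\<eta> = "\<lambda>j. (shift f j xb, 0) :: (real^'n) \<times> (real^'r)"
    have e: "C * norm xb \<le> 1"
      using mult_left_mono[OF xb d(1)] d(3) by linarith
    have "(\<Sum>j=1..k. (real j * s ^ j) *\<^sub>R shift f j xb) = (\<Sum>i<k. (real (Suc i) * s ^ Suc i) *\<^sub>R shift f (Suc i) xb)"
      by (rule sum.reindex_bij_witness[of _ Suc "\<lambda>j. j - 1"]) auto
    also have "\<dots> = (\<Sum>i<k. s ^ Suc i *\<^sub>R - taylor_coef k k f ?\<eta> i (xb, 0))"
    proof (rule sum.cong[OF refl])
      fix i assume "i \<in> {..<k}"
      then have "s ^ Suc i *\<^sub>R (real (Suc i) *\<^sub>R shift f (Suc i) xb) = s ^ Suc i *\<^sub>R - taylor_coef k k f ?\<eta> i (xb, 0)"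
        by (subst shift_Suc[of i k k]) auto
      then show "(real (Suc i) * s ^ Suc i) *\<^sub>R shift f (Suc i) xb = s ^ Suc i *\<^sub>R - taylor_coef k k f ?\<eta> i (xb, 0)"
        by (simp add: mult_ac del: of_nat_Suc)
    qed
    also have "\<dots> = s *\<^sub>R - (\<Sum>i<k. s ^ i *\<^sub>R taylor_coef k k f ?\<eta> i (xb, 0))"
      by (simp add: scaleR_sum_right sum_negf)
    finally have "s *\<^sub>R f (xb + (\<Sum>j=1..k. s ^ j *\<^sub>R shift f j xb), 0) + (\<Sum>j=1..k. (real j * s ^ j) *\<^sub>R shift f j xb)
       = s *\<^sub>R (f ((xb, 0) + (\<Sum>j=1..k. s ^ j *\<^sub>R ?\<eta> j)) - (\<Sum>i<k. s ^ i *\<^sub>R taylor_coef k k f ?\<eta> i (xb, 0)))"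
      by (simp only: curve_Pair scaleR_right_diff_distrib scaleR_minus_right diff_conv_add_uminus scaleR_add_right)
    also have "norm \<dots> \<le> s * (D * (C * norm xb) * s ^ k)"
      unfolding norm_scaleR using s d xb e
      by (intro mult_mono D(2)) (auto simp: norm_Pair1)
    finally show "norm (s *\<^sub>R f (xb + (\<Sum>j=1..k. s ^ j *\<^sub>R shift f j xb), 0) + (\<Sum>j=1..k. (real j * s ^ j) *\<^sub>R shift f j xb))
      \<le> D * C * s ^ Suc k * norm xb"
      by (simp add: mult_ac)
  qed
qed

lemma shift_functions_shift:
  fixes f :: "(real^'n) \<times> (real^'r) \<Rightarrow> real^'n"
  assumes f: "C_upto (4 * CARD('n)) f" "f 0 = 0"
  shows "shift_functions f 1 (shift f)"
  unfolding shift_functions_def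
proof (intro conjI ballI allI)
  show "shift f 1 xb = - f (xb, 0)" for xb
    using shift_Suc[of 0 1 0 f xb] by (simp add: taylor_coef_0)
  fix k assume k: "k \<in> {1..4 * CARD('n) - 1}"
  then have "C_upto (Suc k) f"
    by (intro C_upto_mono[OF f(1)]) auto
  from shift_bound[OF this f(2)] obtain \<delta> C where d: "\<delta> > 0" "C \<ge> 0" "\<delta> \<le> 1" "C * \<delta> \<le> 1"
    "\<And>j xb. j \<in> {1..k} \<Longrightarrow> norm xb \<le> \<delta> \<Longrightarrow> norm (shift f j xb) \<le> C * norm xb"
    by blast
  show "shift f k 0 = 0"
    using d(5)[of k 0] d(1) k by simp
  have "C_upto k f" using k by (intro C_upto_mono[OF f(1)]) auto
  from shift_residual_bound[OF this _ d(2-5)] k obtain D where D: "D \<ge> 0"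
    "\<And>xb s. norm xb \<le> \<delta> \<Longrightarrow> 0 \<le> s \<Longrightarrow> s \<le> 1 \<Longrightarrow>
    norm (s *\<^sub>R f (xb + (\<Sum>j=1..k. s ^ j *\<^sub>R shift f j xb), 0) + (\<Sum>j=1..k. (real j * s ^ j) *\<^sub>R shift f j xb))
      \<le> D * s ^ Suc k * norm xb"
    by auto
  show "(\<lambda>(\<tau>, xb). norm (shifted_rhs f 1 (shift f) xb k \<tau> 0 0))
          \<in> O[at_top \<times>\<^sub>F nhds 0](\<lambda>(\<tau>, xb). exp (- real (Suc k) * 1 * \<tau>) * norm xb)"
  proof (rule bigoI[where c = D])
    have "eventually (\<lambda>\<tau>::real. \<tau> \<ge> 0) at_top"
      by (rule eventually_ge_at_top)
    moreover have "eventually (\<lambda>xb::real^'n. norm xb \<le> \<delta>) (nhds 0)"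
      using d(1) unfolding eventually_nhds_metric by (intro exI[of _ \<delta>]) auto
    ultimately show "\<forall>\<^sub>F x in at_top \<times>\<^sub>F nhds 0.
         norm (case x of (\<tau>, xb) \<Rightarrow> norm (shifted_rhs f 1 (shift f) xb k \<tau> 0 0))
         \<le> D * norm (case x of (\<tau>, xb) \<Rightarrow> exp (- real (Suc k) * 1 * \<tau>) * norm xb)"
      unfolding eventually_prod_filter
    proof (intro exI conjI allI impI)
      fix \<tau> :: real and xb :: "real^'n" assume "\<tau> \<ge> 0" "norm xb \<le> \<delta>"
      then have "norm (shifted_rhs f 1 (shift f) xb k \<tau> 0 0) \<le> D * exp (- \<tau>) ^ Suc k * norm xb"
        unfolding shifted_rhs_power using D(2)[of xb "exp (- \<tau>)"] by simp
      then show "norm (case (\<tau>, xb) of (\<tau>, xb) \<Rightarrow> norm (shifted_rhs f 1 (shift f) xb k \<tau> 0 0))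
         \<le> D * norm (case (\<tau>, xb) of (\<tau>, xb) \<Rightarrow> exp (- real (Suc k) * 1 * \<tau>) * norm xb)"
        using exp_minus_power[of "Suc k" \<tau>] by (simp add: abs_mult mult_ac del: of_nat_Suc)
    qed
  qed
qed

section \<open>Terms linear in c and d, and the remainder of second order\<close>

lemma linear_term_eq_taylor_coef:
  fixes f :: "(real^'n) \<times> (real^'r) \<Rightarrow> real^'n"
  assumes "C_upto (4 * CARD('n)) f"
  shows "linear_term f \<phi> xb (Suc i) w =
    taylor_coef (4 * CARD('n) - 2) (4 * CARD('n) - 1) (iter_deriv f [w]) (\<lambda>k. (\<phi> k xb, 0)) i (xb, 0)"
proof -
  \<comment> \<open>With w innermost, the terms linear in w are Taylor coefficients of the single
    function D f[w]. The prefactor s of the right-hand side accounts for the passage from i to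
    \<open>Suc i\<close>.\<close>
  have "iter_deriv f (w # vs) = iter_deriv (iter_deriv f [w]) vs" if "Suc (length vs) \<le> 4 * CARD('n)" for vs
    using iter_deriv_Cons_eq_snoc[OF C_upto_mono[OF assms that]] iter_deriv_append by metis
  then show ?thesis
    unfolding linear_term_def taylor_coef_def
    by (intro sum.cong refl arg_cong2[where f = scaleR]) auto
qed

lemma linear_linear_term:
  fixes f :: "(real^'n) \<times> (real^'r) \<Rightarrow> real^'n"
  assumes "C_upto (4 * CARD('n)) f"
  shows "linear (linear_term f \<phi> xb i)"
proof -
  have "linear (\<lambda>w. iter_deriv f (w # map (\<lambda>k. (\<phi> k xb, 0)) ks) (xb, 0))"
    if "length ks < 4 * CARD('n) - 2" for ks
    using has_derivative_linear[OF iter_deriv_has_derivative[OF assms]] that by simp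
  then show ?thesis
    unfolding linear_term_def [abs_def]
    by (intro linear_compose_sum ballI linear_compose_scale_right) auto
qed

text \<open>Bounds obtained direction by direction have constants depending on the direction. By
  linearity only the basis vectors matter, and the sum of their constants serves for every
  w.\<close>

lemma linear_bound_Basis:
  fixes F :: "'a::euclidean_space \<Rightarrow> 'b::real_normed_vector"
  assumes "linear F" "\<And>b. b \<in> Basis \<Longrightarrow> norm (F b) \<le> C b * m"
  shows "norm (F w) \<le> (\<Sum>b\<in>Basis. C b) * m * norm w"
proof -
  have "F w = (\<Sum>b\<in>Basis. (w \<bullet> b) *\<^sub>R F b)"
    by (subst euclidean_representation[of w, symmetric])
       (simp only: linear_sum[OF assms(1)] linear_scale[OF assms(1)])
  also have "norm \<dots> \<le> (\<Sum>b\<in>Basis. norm w * (C b * m))"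
    using assms(2) by (intro sum_norm_le) (auto intro!: mult_mono Basis_le_norm)
  also have "\<dots> = (\<Sum>b\<in>Basis. C b) * m * norm w"
    by (simp add: sum_distrib_left[symmetric] sum_distrib_right[symmetric] mult.assoc mult.commute)
  finally show ?thesis .
qed

text \<open>Meant for J = n in P and J = 2n in Q. The error of order J from Taylor's formula gains
  one power from the prefactor s. The shifts are only bounded by 1 here, since no factor |xb| is
  wanted.\<close>

lemma linear_part_bound:
  fixes f :: "(real^'n) \<times> (real^'r) \<Rightarrow> real^'n"
  assumes f: "C_upto (4 * CARD('n)) f" and J: "1 \<le> J" "J \<le> 4 * CARD('n) - 2"
    and d: "\<delta> \<le> 1" "\<And>k xb. k \<in> {1..4 * CARD('n) - 1} \<Longrightarrow> norm xb \<le> \<delta> \<Longrightarrow> norm (\<phi> k xb) \<le> 1"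
  shows "\<exists>C\<ge>0. \<forall>xb s w. norm xb \<le> \<delta> \<longrightarrow> 0 \<le> s \<longrightarrow> s \<le> 1 \<longrightarrow>
    norm (s *\<^sub>R iter_deriv f [w] (xb + (\<Sum>k=1..4 * CARD('n) - 1. s ^ k *\<^sub>R \<phi> k xb), 0)
          - (\<Sum>i=1..J. s ^ i *\<^sub>R linear_term f \<phi> xb i w)) \<le> C * s ^ Suc J * norm w"
proof -
  let ?K = "4 * CARD('n) - 1" and ?L = "4 * CARD('n) - 2"
  have CJ: "C_upto J (iter_deriv f [w])" for w
    using J by (intro C_upto_iter_deriv C_upto_mono[OF f]) simp
  have "\<forall>b. \<exists>C\<ge>0. \<forall>x \<eta> e s. norm x \<le> 1 \<longrightarrow> (\<forall>k\<in>{1..?K}. norm (\<eta> k) \<le> e) \<longrightarrow> 0 \<le> e \<longrightarrow> e \<le> 1 \<longrightarrow>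
           0 \<le> s \<longrightarrow> s \<le> 1 \<longrightarrow>
           norm (iter_deriv f [b] (x + (\<Sum>k=1..?K. s ^ k *\<^sub>R \<eta> k)) -
             (\<Sum>i<J. s ^ i *\<^sub>R taylor_coef ?L ?K (iter_deriv f [b]) \<eta> i x)) \<le> C * e * s ^ J"
    using taylor_along_curve[OF CJ J] by blast
  then obtain C where C: "\<forall>b. C b \<ge> 0 \<and> (\<forall>x \<eta> e s. norm x \<le> 1 \<longrightarrow> (\<forall>k\<in>{1..?K}. norm (\<eta> k) \<le> e) \<longrightarrow> 0 \<le> e \<longrightarrow> e \<le> 1 \<longrightarrow>
           0 \<le> s \<longrightarrow> s \<le> 1 \<longrightarrow>
           norm (iter_deriv f [b] (x + (\<Sum>k=1..?K. s ^ k *\<^sub>R \<eta> k)) -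
             (\<Sum>i<J. s ^ i *\<^sub>R taylor_coef ?L ?K (iter_deriv f [b]) \<eta> i x)) \<le> C b * e * s ^ J)"
    by (rule choice[THEN exE])
  show ?thesis
  proof (intro exI[of _ "sum C Basis"] conjI allI impI)
    show "0 \<le> sum C Basis" using C by (intro sum_nonneg) auto
    fix xb :: "real^'n" and s :: real and w :: "(real^'n) \<times> (real^'r)"
    assume xb: "norm xb \<le> \<delta>" and s: "0 \<le> s" "s \<le> 1"
    define z where "z = (xb + (\<Sum>k=1..?K. s ^ k *\<^sub>R \<phi> k xb), 0 :: real^'r)"
    define F where "F w = s *\<^sub>R iter_deriv f [w] z - (\<Sum>i=1..J. s ^ i *\<^sub>R linear_term f \<phi> xb i w)" for w
    have "linear (\<lambda>w. iter_deriv f [w] z)"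
      using has_derivative_linear[OF iter_deriv_has_derivative[OF f, of "[]"]] by simp
    then have lin: "linear F"
      unfolding F_def
      by (intro linear_compose_sub linear_compose_sum ballI linear_compose_scale_right linear_linear_term[OF f])
    have "norm (F b) \<le> C b * s ^ Suc J" for b
    proof -
      let ?\<eta> = "\<lambda>k. (\<phi> k xb, 0) :: (real^'n) \<times> (real^'r)"
      have "(\<Sum>i=1..J. s ^ i *\<^sub>R linear_term f \<phi> xb i b) =
          (\<Sum>i<J. s ^ Suc i *\<^sub>R linear_term f \<phi> xb (Suc i) b)"
        by (rule sum.reindex_bij_witness[of _ Suc "\<lambda>j. j - 1"]) auto
      also have "\<dots> = s *\<^sub>R (\<Sum>i<J. s ^ i *\<^sub>R taylor_coef ?L ?K (iter_deriv f [b]) ?\<eta> i (xb, 0))"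
        by (simp add: scaleR_sum_right linear_term_eq_taylor_coef[OF f])
      finally have "F b = s *\<^sub>R (iter_deriv f [b] ((xb, 0) + (\<Sum>k=1..?K. s ^ k *\<^sub>R ?\<eta> k)) -
          (\<Sum>i<J. s ^ i *\<^sub>R taylor_coef ?L ?K (iter_deriv f [b]) ?\<eta> i (xb, 0)))"
        unfolding F_def z_def by (simp only: curve_Pair scaleR_diff_right)
      also have "norm \<dots> \<le> s * (C b * 1 * s ^ J)"
        unfolding norm_scaleR using s d xb C
        by (intro mult_mono C[rule_format, THEN conjunct2, rule_format]) (auto simp: norm_Pair1)
      finally show ?thesis by (simp add: mult_ac)
    qed
    from linear_bound_Basis[OF lin this, of w]
    show "norm (s *\<^sub>R iter_deriv f [w] (xb + (\<Sum>k=1..?K. s ^ k *\<^sub>R \<phi> k xb), 0)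
          - (\<Sum>i=1..J. s ^ i *\<^sub>R linear_term f \<phi> xb i w)) \<le> sum C Basis * s ^ Suc J * norm w"
      unfolding F_def z_def by simp
  qed
qed

lemma quadratic_remainder_bound:
  fixes f :: "'a::euclidean_space \<Rightarrow> 'b::real_normed_vector"
  assumes f: "C_upto 2 f"
  shows "\<exists>C\<ge>0. \<forall>x h. norm x \<le> \<rho> \<longrightarrow> norm h \<le> \<rho> \<longrightarrow> norm (f (x + h) - f x - iter_deriv f [h] x) \<le> C * (norm h)^2"
proof -
  obtain C where C: "C \<ge> 0" "\<And>vs z. length vs = 2 \<Longrightarrow> norm z \<le> 2 * \<rho> \<Longrightarrow>
           norm (iter_deriv f vs z) \<le> C * prod_list (map norm vs)"
    using iter_deriv_bound[OF f order_refl, of "2 * \<rho>"] by blast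
  show ?thesis
  proof (intro exI[of _ C] conjI C(1) allI impI)
    fix x h :: 'a assume a: "norm x \<le> \<rho>" "norm h \<le> \<rho>"
    have "norm (iter_deriv f (replicate 2 h) (x + \<theta> *\<^sub>R h)) \<le> C * (norm h)^2" if "\<theta> \<in> {0..1}" for \<theta>
    proof -
      have "norm (\<theta> *\<^sub>R h) \<le> 1 * norm h"
        unfolding norm_scaleR using that by (intro mult_right_mono) auto
      then have "norm (x + \<theta> *\<^sub>R h) \<le> 2 * \<rho>"
        using norm_triangle_ineq[of x "\<theta> *\<^sub>R h"] a by linarith
      from C(2)[OF _ this, of "replicate 2 h"] show ?thesis
        by (simp add: prod_list_replicate)
    qed
    from taylor_along_segment[OF f this, of 1]
    have "norm (f (x + h) - (f x + iter_deriv f [h] x)) \<le> C * (norm h)^2 / 2"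
      by (simp add: numeral_2_eq_2)
    also have "\<dots> \<le> C * (norm h)^2" using C(1) by simp
    finally show "norm (f (x + h) - f x - iter_deriv f [h] x) \<le> C * (norm h)^2"
      by (simp add: diff_diff_eq)
  qed
qed

section \<open>Coefficient matrices of P and Q and their limits as xb tends to 0\<close>

definition matrix_poly :: "(nat \<Rightarrow> real^'m^'k) \<Rightarrow> nat \<Rightarrow> real \<Rightarrow> real^'m^'k" where
  "matrix_poly A m s = (\<Sum>i<m. s ^ i *\<^sub>R A i)"

text \<open>The index is lowered by one: coefficient i belongs to s^(i+1) in P, so that P = s P0(s)
  with a polynomial P0 starting at s^0.\<close>

definition P_coef :: "((real^'n) \<times> (real^'r) \<Rightarrow> real^'n) \<Rightarrow> (nat \<Rightarrow> real^'n \<Rightarrow> real^'n) \<Rightarrow> real^'n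
     \<Rightarrow> nat \<Rightarrow> real^'n^'n" where
  "P_coef f \<phi> xb i = matrix (\<lambda>c. linear_term f \<phi> xb (Suc i) (c, 0))"

definition Q_coef :: "((real^'n) \<times> (real^'r) \<Rightarrow> real^'n) \<Rightarrow> (nat \<Rightarrow> real^'n \<Rightarrow> real^'n) \<Rightarrow> real^'n
     \<Rightarrow> nat \<Rightarrow> real^'r^'n" where
  "Q_coef f \<phi> xb i = matrix (\<lambda>d. linear_term f \<phi> xb (Suc i) (0, d))"

lemma matrix_poly_mult: "matrix_poly A m s *v c = (\<Sum>i<m. s ^ i *\<^sub>R (A i *v c))"
  unfolding matrix_poly_def
  by (induction m) (auto simp: matrix_vector_mult_add_rdistrib scaleR_matrix_vector_assoc)

lemma linear_linear_term_compose:
  fixes f :: "(real^'n) \<times> (real^'r) \<Rightarrow> real^'n"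
  assumes f: "C_upto (4 * CARD('n)) f"
  shows "linear (\<lambda>c. linear_term f \<phi> xb i (c, 0))" "linear (\<lambda>d. linear_term f \<phi> xb i (0, d))"
  using linear_compose[OF _ linear_linear_term[OF f], of "\<lambda>c. (c, 0)"]
    linear_compose[OF _ linear_linear_term[OF f], of "\<lambda>d. (0, d)"]
  by (auto simp: o_def linear_iff)

lemma matrix_mult_vector:
  fixes F :: "real^'k \<Rightarrow> real^'n"
  shows "linear F \<Longrightarrow> matrix F *v w = F w"
  by (rule matrix_works) (simp only: linear_matrix_vector_mul_eq)

lemma matrix_exp_sum:
  fixes F :: "nat \<Rightarrow> real^'k \<Rightarrow> real^'n"
  assumes F: "\<And>i. linear (F i)"
  shows "matrix (\<lambda>w. \<Sum>i=1..m. (1 * exp (- real i * 1 * \<tau>)) *\<^sub>R F i w) *v w = (\<Sum>i=1..m. exp (- \<tau>) ^ i *\<^sub>R F i w)"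
    and "matrix (\<lambda>w. \<Sum>i=1..m. (1 * exp (- real i * 1 * \<tau>)) *\<^sub>R F i w) =
      exp (- \<tau>) *\<^sub>R matrix_poly (\<lambda>i. matrix (F (Suc i))) m (exp (- \<tau>))" (is "?M = ?R")
proof -
  show mult: "?M *v w = (\<Sum>i=1..m. exp (- \<tau>) ^ i *\<^sub>R F i w)" for w
    by (subst matrix_mult_vector)
       (auto intro!: linear_compose_sum linear_compose_scale_right F simp: exp_minus_power[symmetric])
  have "?M *v w = ?R *v w" for w
  proof -
    have "?M *v w = (\<Sum>i<m. exp (- \<tau>) ^ Suc i *\<^sub>R F (Suc i) w)"
      unfolding mult by (rule sum.reindex_bij_witness[of _ Suc "\<lambda>j. j - 1"]) auto
    then show ?thesis
      by (simp add: matrix_poly_mult matrix_mult_vector[OF F] scaleR_matrix_vector_assoc[symmetric] scaleR_sum_right)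
  qed
  then show "?M = ?R" by (simp add: matrix_eq)
qed

lemma P_mat_Q_mat_eq:
  fixes f :: "(real^'n) \<times> (real^'r) \<Rightarrow> real^'n"
  assumes f: "C_upto (4 * CARD('n)) f"
  shows "P_mat f 1 \<phi> xb \<tau> *v c = (\<Sum>i=1..CARD('n). exp (- \<tau>) ^ i *\<^sub>R linear_term f \<phi> xb i (c, 0))"
    and "Q_mat f 1 \<phi> xb \<tau> *v d = (\<Sum>i=1..2 * CARD('n). exp (- \<tau>) ^ i *\<^sub>R linear_term f \<phi> xb i (0, d))"
    and "P_mat f 1 \<phi> xb \<tau> = exp (- \<tau>) *\<^sub>R matrix_poly (P_coef f \<phi> xb) CARD('n) (exp (- \<tau>))"
    and "Q_mat f 1 \<phi> xb \<tau> = exp (- \<tau>) *\<^sub>R matrix_poly (Q_coef f \<phi> xb) (2 * CARD('n)) (exp (- \<tau>))"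
  unfolding P_mat_def Q_mat_def P_coef_def [abs_def] Q_coef_def [abs_def]
  by (rule matrix_exp_sum linear_linear_term_compose[OF f])+

text \<open>For i = 0 the term is D f(xb, 0)[w], continuous in xb; every later one contains at least
  one shift and is O(|xb|). So the linear part reduces to s (A c + B d) at xb = 0.\<close>

lemma tendsto_linear_term_shift:
  fixes f :: "(real^'n) \<times> (real^'r) \<Rightarrow> real^'n"
  assumes f: "C_upto (4 * CARD('n)) f" "f 0 = 0" and i: "i < 2 * CARD('n)"
  shows "((\<lambda>xb. linear_term f (shift f) xb (Suc i) w) \<longlongrightarrow> (if i = 0 then iter_deriv f [w] 0 else 0)) (nhds 0)"
proof -
  let ?K = "4 * CARD('n) - 1" and ?L = "4 * CARD('n) - 2"
  have L: "i < ?L" "Suc i \<le> 4 * CARD('n)"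
    using i one_le_card_finite[where 'a = 'n] by linarith+
  have Ci: "C_upto i (iter_deriv f [w])"
    using L by (intro C_upto_iter_deriv C_upto_mono[OF f(1)]) simp
  show ?thesis
  proof (cases "i = 0")
    case True
    have "continuous_on UNIV (\<lambda>xb. iter_deriv f [w] (xb, 0))"
      by (rule continuous_on_compose2[OF C_upto_continuous[OF Ci]]) (auto intro!: continuous_intros)
    then have "isCont (\<lambda>xb. iter_deriv f [w] (xb, 0)) 0"
      by (simp only: continuous_on_eq_continuous_at open_UNIV) simp
    then have "((\<lambda>xb. iter_deriv f [w] (xb, 0)) \<longlongrightarrow> iter_deriv f [w] 0) (nhds 0)"
      unfolding isCont_def tendsto_at_iff_tendsto_nhds[of "\<lambda>xb. iter_deriv f [w] (xb, 0)" 0] zero_prod_def .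
    then show ?thesis
      using True L by (simp add: linear_term_eq_taylor_coef[OF f(1)] taylor_coef_0)
  next
    case False
    have "C_upto (Suc ?K) f" using f(1) by simp
    from shift_bound[OF this f(2)] obtain \<delta> C where d: "\<delta> > 0" "C \<ge> 0" "\<delta> \<le> 1" "C * \<delta> \<le> 1"
      "\<And>j xb. j \<in> {1..?K} \<Longrightarrow> norm xb \<le> \<delta> \<Longrightarrow> norm (shift f j xb) \<le> C * norm xb"
      by blast
    from taylor_coef_bound[OF Ci, of 1 ?K] False obtain D where
      D: "D \<ge> 0" "\<And>x \<eta> e. norm x \<le> 1 \<Longrightarrow> (\<forall>k\<in>{1..?K}. norm (\<eta> k) \<le> e) \<Longrightarrow> 0 \<le> e \<Longrightarrow> e \<le> 1 \<Longrightarrow>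
        norm (taylor_coef (Suc i) ?K (iter_deriv f [w]) \<eta> i x) \<le> D * e"
      by auto
    have bd: "norm (linear_term f (shift f) xb (Suc i) w) \<le> D * (C * norm xb)" if xb: "norm xb \<le> \<delta>" for xb
    proof -
      have e: "C * norm xb \<le> 1"
        using mult_left_mono[OF xb d(2)] d(4) by linarith
      have "linear_term f (shift f) xb (Suc i) w =
          taylor_coef (Suc i) ?K (iter_deriv f [w]) (\<lambda>k. (shift f k xb, 0)) i (xb, 0)"
        using L by (simp only: linear_term_eq_taylor_coef[OF f(1)] taylor_coef_level[of i ?L])
      also have "norm \<dots> \<le> D * (C * norm xb)"
        using d xb e by (intro D(2)) (auto simp: norm_Pair1)
      finally show ?thesis .
    qed
    have "((\<lambda>xb. linear_term f (shift f) xb (Suc i) w) \<longlongrightarrow> 0) (nhds 0)"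
    proof (rule Lim_null_comparison)
      show "\<forall>\<^sub>F xb in nhds 0. norm (linear_term f (shift f) xb (Suc i) w) \<le> D * (C * norm xb)"
        unfolding eventually_nhds_metric using d(1) bd by (intro exI[of _ \<delta>]) auto
      have "((\<lambda>xb::real^'n. D * (C * norm xb)) \<longlongrightarrow> D * (C * norm (0::real^'n))) (nhds 0)"
        by (intro tendsto_intros filterlim_ident)
      then show "((\<lambda>xb::real^'n. D * (C * norm xb)) \<longlongrightarrow> 0) (nhds 0)" by simp
    qed
    then show ?thesis using False by simp
  qed
qed

lemma tendsto_matrix:
  assumes "\<And>w. ((\<lambda>x. F x w) \<longlongrightarrow> G w) X"
  shows "((\<lambda>x. matrix (F x)) \<longlongrightarrow> matrix G) X"
  unfolding matrix_def
  by (intro vec_tendstoI) (simp add: tendsto_vec_nth assms)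

lemma tendsto_P_coef:
  fixes f :: "(real^'n) \<times> (real^'r) \<Rightarrow> real^'n"
  assumes f: "C_upto (4 * CARD('n)) f" "f 0 = 0" and i: "i < CARD('n)"
  shows "((\<lambda>xb. P_coef f (shift f) xb i) \<longlongrightarrow>
    (if i = 0 then jacobian (\<lambda>x. f (x, 0)) (at 0) else 0)) (nhds 0)"
proof -
  have "((\<lambda>x. f (x, 0)) has_derivative (\<lambda>c. iter_deriv f [(c, 0)] (0, 0))) (at 0)"
    by (rule has_derivative_compose[OF _ iter_deriv_has_derivative[OF f(1), of "[]", simplified iter_deriv.simps(1)]])
       (auto intro!: derivative_eq_intros)
  from frechet_derivative_at[OF this]
  have J: "jacobian (\<lambda>x. f (x, 0)) (at 0) = matrix (\<lambda>c. iter_deriv f [(c, 0)] 0)"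
    unfolding jacobian_def zero_prod_def by simp
  have Z: "matrix (\<lambda>c::real^'n. 0) = (0::real^'n^'n)"
    by (simp add: matrix_def vec_eq_iff)
  have "((\<lambda>xb. P_coef f (shift f) xb i) \<longlongrightarrow> matrix (\<lambda>c. if i = 0 then iter_deriv f [(c, 0)] 0 else 0)) (nhds 0)"
    unfolding P_coef_def using i by (intro tendsto_matrix tendsto_linear_term_shift[OF f]) simp
  then show ?thesis
    by (cases "i = 0") (simp_all only: J Z simp_thms if_True if_False)
qed

lemma tendsto_Q_coef:
  fixes f :: "(real^'n) \<times> (real^'r) \<Rightarrow> real^'n"
  assumes f: "C_upto (4 * CARD('n)) f" "f 0 = 0" and i: "i < 2 * CARD('n)"
  shows "((\<lambda>xb. Q_coef f (shift f) xb i) \<longlongrightarrow>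
    (if i = 0 then jacobian (\<lambda>u. f (0, u)) (at 0) else 0)) (nhds 0)"
proof -
  have "((\<lambda>u. f (0, u)) has_derivative (\<lambda>d. iter_deriv f [(0, d)] (0, 0))) (at 0)"
    by (rule has_derivative_compose[OF _ iter_deriv_has_derivative[OF f(1), of "[]", simplified iter_deriv.simps(1)]])
       (auto intro!: derivative_eq_intros)
  from frechet_derivative_at[OF this]
  have J: "jacobian (\<lambda>u. f (0, u)) (at 0) = matrix (\<lambda>d. iter_deriv f [(0, d)] 0)"
    unfolding jacobian_def zero_prod_def by simp
  have Z: "matrix (\<lambda>d::real^'r. 0) = (0::real^'r^'n)"
    by (simp add: matrix_def vec_eq_iff)
  have "((\<lambda>xb. Q_coef f (shift f) xb i) \<longlongrightarrow> matrix (\<lambda>d. if i = 0 then iter_deriv f [(0, d)] 0 else 0)) (nhds 0)"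
    unfolding Q_coef_def using i by (intro tendsto_matrix tendsto_linear_term_shift[OF f]) simp
  then show ?thesis
    by (cases "i = 0") (simp_all only: J Z simp_thms if_True if_False)
qed

text \<open>The four terms have separate origins: the residual of the 4n - 1 shifts, the truncation
  of P after s^n, that of Q after s^(2n), and the second-order Taylor remainder in (c, d) about the
  shifted origin with its prefactor s. The radius \<rho> is free because it is dictated later by the
  linear theory.\<close>

lemma R_term_bound:
  fixes f :: "(real^'n) \<times> (real^'r) \<Rightarrow> real^'n"
  assumes f: "C_upto (4 * CARD('n)) f" and d: "C \<ge> 0" "\<delta> \<le> 1" "C * \<delta> \<le> 1"
    "\<And>j xb. j \<in> {1..4 * CARD('n) - 1} \<Longrightarrow> norm xb \<le> \<delta> \<Longrightarrow> norm (shift f j xb) \<le> C * norm xb"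
  shows "\<exists>D\<ge>0. \<forall>xb \<tau> c d. norm xb \<le> \<delta> \<longrightarrow> 0 \<le> \<tau> \<longrightarrow> norm c \<le> \<rho> \<longrightarrow> norm d \<le> \<rho> \<longrightarrow>
    norm (R_term f 1 (shift f) xb \<tau> c d) \<le>
      D * (exp (- \<tau>) ^ (4 * CARD('n)) * norm xb + exp (- \<tau>) ^ (CARD('n) + 1) * norm c
           + exp (- \<tau>) ^ (2 * CARD('n) + 1) * norm d + exp (- \<tau>) * (norm c + norm d)^2)"
proof -
  let ?n = "CARD('n)" and ?K = "4 * CARD('n) - 1"
  have K: "?K \<ge> 1" "Suc ?K = 4 * ?n"
    using one_le_card_finite[where 'a = 'n] by linarith+
  have unit: "norm (shift f k xb) \<le> 1" if "k \<in> {1..?K}" "norm xb \<le> \<delta>" for k xb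
    using d(4)[OF that] mult_left_mono[OF that(2) d(1)] d(3) by linarith
  have "C_upto ?K f" by (rule C_upto_mono[OF f]) simp
  from shift_residual_bound[OF this K(1) d(1-3)] d(4) obtain D1 where D1: "D1 \<ge> 0"
    "\<And>xb s. norm xb \<le> \<delta> \<Longrightarrow> 0 \<le> s \<Longrightarrow> s \<le> 1 \<Longrightarrow>
      norm (s *\<^sub>R f (xb + (\<Sum>j=1..?K. s ^ j *\<^sub>R shift f j xb), 0) + (\<Sum>j=1..?K. (real j * s ^ j) *\<^sub>R shift f j xb))
      \<le> D1 * s ^ Suc ?K * norm xb"
    by blast
  have n1: "1 \<le> ?n" "?n \<le> 4 * ?n - 2" "1 \<le> 2 * ?n" "2 * ?n \<le> 4 * ?n - 2"
    using one_le_card_finite[where 'a = 'n] by linarith+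
  have "\<exists>C\<ge>0. \<forall>xb s w. norm xb \<le> \<delta> \<longrightarrow> 0 \<le> s \<longrightarrow> s \<le> 1 \<longrightarrow>
    norm (s *\<^sub>R iter_deriv f [w] (xb + (\<Sum>k=1..?K. s ^ k *\<^sub>R shift f k xb), 0)
          - (\<Sum>i=1..?n. s ^ i *\<^sub>R linear_term f (shift f) xb i w)) \<le> C * s ^ Suc (?n) * norm w"
    by (rule linear_part_bound[OF f n1(1,2) d(2)]) (rule unit)
  then obtain D2 where D2: "D2 \<ge> 0"
    "\<forall>xb s w. norm xb \<le> \<delta> \<longrightarrow> 0 \<le> s \<longrightarrow> s \<le> 1 \<longrightarrow>
    norm (s *\<^sub>R iter_deriv f [w] (xb + (\<Sum>k=1..?K. s ^ k *\<^sub>R shift f k xb), 0)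
          - (\<Sum>i=1..?n. s ^ i *\<^sub>R linear_term f (shift f) xb i w)) \<le> D2 * s ^ Suc (?n) * norm w"
    by (elim exE conjE)
  have "\<exists>C\<ge>0. \<forall>xb s w. norm xb \<le> \<delta> \<longrightarrow> 0 \<le> s \<longrightarrow> s \<le> 1 \<longrightarrow>
    norm (s *\<^sub>R iter_deriv f [w] (xb + (\<Sum>k=1..?K. s ^ k *\<^sub>R shift f k xb), 0)
          - (\<Sum>i=1..2 * ?n. s ^ i *\<^sub>R linear_term f (shift f) xb i w)) \<le> C * s ^ Suc (2 * ?n) * norm w"
    by (rule linear_part_bound[OF f n1(3,4) d(2)]) (rule unit)
  then obtain D3 where D3: "D3 \<ge> 0"
    "\<forall>xb s w. norm xb \<le> \<delta> \<longrightarrow> 0 \<le> s \<longrightarrow> s \<le> 1 \<longrightarrow>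
    norm (s *\<^sub>R iter_deriv f [w] (xb + (\<Sum>k=1..?K. s ^ k *\<^sub>R shift f k xb), 0)
          - (\<Sum>i=1..2 * ?n. s ^ i *\<^sub>R linear_term f (shift f) xb i w)) \<le> D3 * s ^ Suc (2 * ?n) * norm w"
    by (elim exE conjE)
  \<comment> \<open>Large enough for the shifted origin z, of norm at most 1 + (4n - 1), and for the
    increment (c, d).\<close>
  define \<rho>' where "\<rho>' = max (1 + real ?K) (2 * \<rho>)"
  have "C_upto 2 f" by (rule C_upto_mono[OF f]) (use n1(1) in linarith)
  from quadratic_remainder_bound[OF this, of \<rho>'] obtain D4 where D4: "D4 \<ge> 0"
    "\<And>x h. norm x \<le> \<rho>' \<Longrightarrow> norm h \<le> \<rho>' \<Longrightarrow> norm (f (x + h) - f x - iter_deriv f [h] x) \<le> D4 * (norm h)^2"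
    by blast
  define D where "D = D1 + D2 + D3 + D4"
  show ?thesis
  proof (intro exI[of _ D] conjI allI impI)
    show "0 \<le> D" using D1(1) D2(1) D3(1) D4(1) by (simp add: D_def)
    fix xb :: "real^'n" and \<tau> :: real and c :: "real^'n" and d' :: "real^'r"
    assume xb: "norm xb \<le> \<delta>" and \<tau>: "0 \<le> \<tau>" and c: "norm c \<le> \<rho>" and d': "norm d' \<le> \<rho>"
    define s where "s = exp (- \<tau>)"
    have s: "0 \<le> s" "s \<le> 1" using \<tau> by (auto simp: s_def)
    define z where "z = (xb + (\<Sum>k=1..?K. s ^ k *\<^sub>R shift f k xb), 0 :: real^'r)"
    define S where "S = (\<Sum>j=1..?K. (real j * s ^ j) *\<^sub>R shift f j xb)"
    have "norm (\<Sum>k=1..?K. s ^ k *\<^sub>R shift f k xb) \<le> real ?K * 1 * s"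
      using unit xb s by (intro norm_curve_le) auto
    also have "\<dots> \<le> real ?K * 1 * 1"
      by (rule mult_left_mono[OF s(2)]) (simp only: mult_1_right of_nat_0_le_iff)
    finally have "norm (xb + (\<Sum>k=1..?K. s ^ k *\<^sub>R shift f k xb)) \<le> 1 + real ?K"
      using xb d(2) norm_triangle_ineq[of xb "\<Sum>k=1..?K. s ^ k *\<^sub>R shift f k xb"] by linarith
    then have nz: "norm z \<le> \<rho>'" unfolding z_def \<rho>'_def by (simp add: norm_Pair1)
    have nh: "norm (c, d') \<le> norm c + norm d'" by (rule norm_Pair_le)
    then have nh': "norm (c, d') \<le> \<rho>'" using c d' by (simp add: \<rho>'_def)
    have "linear (\<lambda>w. iter_deriv f [w] z)"
      using has_derivative_linear[OF iter_deriv_has_derivative[OF f, of "[]"]] by simp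
    from linear_add[OF this, of "(c, 0)" "(0, d')"]
    have lin: "iter_deriv f [(c, d')] z = iter_deriv f [(c, 0)] z + iter_deriv f [(0, d')] z"
      by simp
    have "R_term f 1 (shift f) xb \<tau> c d' =
        s *\<^sub>R (f (z + (c, d')) - f z - iter_deriv f [(c, d')] z) + (s *\<^sub>R f z + S)
        + (s *\<^sub>R iter_deriv f [(c, 0)] z - (\<Sum>i=1..?n. s ^ i *\<^sub>R linear_term f (shift f) xb i (c, 0)))
        + (s *\<^sub>R iter_deriv f [(0, d')] z - (\<Sum>i=1..2 * ?n. s ^ i *\<^sub>R linear_term f (shift f) xb i (0, d')))"
      unfolding R_term_def shifted_rhs_power P_mat_Q_mat_eq(1,2)[OF f] s_def[symmetric] S_def[symmetric] lin
      by (simp add: z_def scaleR_diff_right scaleR_add_right add_ac)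
    then have "norm (R_term f 1 (shift f) xb \<tau> c d') \<le>
        norm (s *\<^sub>R (f (z + (c, d')) - f z - iter_deriv f [(c, d')] z)) + norm (s *\<^sub>R f z + S)
        + norm (s *\<^sub>R iter_deriv f [(c, 0)] z - (\<Sum>i=1..?n. s ^ i *\<^sub>R linear_term f (shift f) xb i (c, 0)))
        + norm (s *\<^sub>R iter_deriv f [(0, d')] z - (\<Sum>i=1..2 * ?n. s ^ i *\<^sub>R linear_term f (shift f) xb i (0, d')))"
      by (simp only:) (intro norm_triangle_mono order_refl)
    also have "\<dots> \<le> D4 * (s * (norm c + norm d')^2) + D1 * (s ^ (4 * ?n) * norm xb)
        + D2 * (s ^ (?n + 1) * norm c) + D3 * (s ^ (2 * ?n + 1) * norm d')"
    proof (intro add_mono)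
      have "norm (f (z + (c, d')) - f z - iter_deriv f [(c, d')] z) \<le> D4 * (norm (c, d'))^2"
        by (rule D4(2)[OF nz nh'])
      also have "\<dots> \<le> D4 * (norm c + norm d')^2"
        using nh D4(1) by (intro mult_left_mono power_mono) auto
      finally have "s * norm (f (z + (c, d')) - f z - iter_deriv f [(c, d')] z) \<le> s * (D4 * (norm c + norm d')^2)"
        using s by (intro mult_left_mono)
      then show "norm (s *\<^sub>R (f (z + (c, d')) - f z - iter_deriv f [(c, d')] z)) \<le> D4 * (s * (norm c + norm d')^2)"
        using s by (simp add: mult_ac)
      show "norm (s *\<^sub>R f z + S) \<le> D1 * (s ^ (4 * ?n) * norm xb)"
        using D1(2)[OF xb s] unfolding z_def S_def K(2) by (simp add: mult_ac)
      show "norm (s *\<^sub>R iter_deriv f [(c, 0)] z - (\<Sum>i=1..?n. s ^ i *\<^sub>R linear_term f (shift f) xb i (c, 0)))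
          \<le> D2 * (s ^ (?n + 1) * norm c)"
        using D2(2)[rule_format, OF xb s, of "(c, 0)"] unfolding z_def by (simp add: norm_Pair1 mult_ac)
      show "norm (s *\<^sub>R iter_deriv f [(0, d')] z - (\<Sum>i=1..2 * ?n. s ^ i *\<^sub>R linear_term f (shift f) xb i (0, d')))
          \<le> D3 * (s ^ (2 * ?n + 1) * norm d')"
        using D3(2)[rule_format, OF xb s, of "(0, d')"] unfolding z_def by (simp add: norm_Pair2 mult_ac)
    qed
    also have "\<dots> \<le> D * (s * (norm c + norm d')^2) + D * (s ^ (4 * ?n) * norm xb)
        + D * (s ^ (?n + 1) * norm c) + D * (s ^ (2 * ?n + 1) * norm d')"
      using D1(1) D2(1) D3(1) D4(1) s by (intro add_mono mult_right_mono) (auto simp: D_def)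
    also have "\<dots> = D * (s ^ (4 * ?n) * norm xb + s ^ (?n + 1) * norm c
           + s ^ (2 * ?n + 1) * norm d' + s * (norm c + norm d')^2)"
      by (simp add: algebra_simps)
    finally show "norm (R_term f 1 (shift f) xb \<tau> c d') \<le>
      D * (exp (- \<tau>) ^ (4 * ?n) * norm xb + exp (- \<tau>) ^ (?n + 1) * norm c
           + exp (- \<tau>) ^ (2 * ?n + 1) * norm d' + exp (- \<tau>) * (norm c + norm d')^2)"
      unfolding s_def .
  qed
qed

section \<open>Ordinary differential equations\<close>

lemma at_within_nonneg: "t > 0 \<Longrightarrow> at t within {0..} = at (t::real)"
  by (rule at_within_interior) (simp add: interior_real_atLeast)

lemma has_vector_derivative_nonneg_extend:
  assumes "(x has_vector_derivative y) (at t within {0..T})" "0 \<le> t" "t < T"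
  shows "(x has_vector_derivative y) (at t within {0..})"
proof -
  have "at t within {0..} = at t within {0..T}"
    by (rule at_within_nhd[of _ "{..<T}"]) (use assms in auto)
  then show ?thesis using assms(1) by simp
qed

text \<open>Multiplication by exp(- K) turns the inequality into monotonicity. It is required in the
  open interval only, because the bootstrap below knows W \<le> 1 strictly before the first exit
  time.\<close>

lemma gronwall_interior:
  fixes W K :: "real \<Rightarrow> real"
  assumes W: "\<And>t. t \<in> {0..T} \<Longrightarrow> (W has_real_derivative W' t) (at t within {0..})"
    and K: "\<And>t. t \<in> {0..T} \<Longrightarrow> (K has_real_derivative k t) (at t within {0..})"
    and le: "\<And>t. t \<in> {0<..<T} \<Longrightarrow> W' t \<le> k t * W t"
    and t: "t \<in> {0..T}"
  shows "W t \<le> W 0 * exp (K t - K 0)"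
proof -
  define g where "g t = W t * exp (- K t)" for t
  define g' where "g' t = (W' t - k t * W t) * exp (- K t)" for t
  have g: "(g has_real_derivative g' r) (at r within {0..})" if "r \<in> {0..T}" for r
    unfolding g_def g'_def
    by (auto intro!: derivative_eq_intros W[OF that] K[OF that] simp: algebra_simps)
  have "g t \<le> g 0"
  proof (rule DERIV_nonpos_imp_decreasing_open[of 0 t g])
    show "0 \<le> t" using t by simp
    have "continuous_on {0..T} g"
      unfolding continuous_on_eq_continuous_within
      using g by (meson DERIV_continuous atLeastAtMost_iff atLeast_iff continuous_within_subset subsetI)
    then show "continuous_on {0..t} g"
      by (rule continuous_on_subset) (use t in auto)
    fix r assume "0 < r" "r < t"
    then have "DERIV g r :> g' r" "g' r \<le> 0"
      using g[of r] le[of r] t by (auto simp: at_within_nonneg g'_def mult_le_0_iff)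
    then show "\<exists>y. DERIV g r :> y \<and> y \<le> 0" by blast
  qed
  then have "W t * exp (- K t) * exp (K t) \<le> W 0 * exp (- K 0) * exp (K t)"
    unfolding g_def by (intro mult_right_mono) auto
  moreover have "exp (- K t) * exp (K t) = 1" "exp (- K 0) * exp (K t) = exp (K t - K 0)"
    unfolding exp_add[symmetric] by simp_all
  ultimately show ?thesis
    by (simp only: mult.assoc mult_1_right)
qed

lemma gronwall:
  fixes W K :: "real \<Rightarrow> real"
  assumes "\<And>t. t \<in> {0..T} \<Longrightarrow> (W has_real_derivative W' t) (at t within {0..})"
    and "\<And>t. t \<in> {0..T} \<Longrightarrow> (K has_real_derivative k t) (at t within {0..})"
    and "\<And>t. t \<in> {0..T} \<Longrightarrow> W' t \<le> k t * W t"
    and "t \<in> {0..T}"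
  shows "W t \<le> W 0 * exp (K t - K 0)"
  by (rule gronwall_interior[OF assms(1,2) _ assms(4)]) (auto intro: assms(3))

text \<open>The norm may fail to be differentiable where x vanishes, its square does not; Gronwall's
  inequality is applied to |x|^2 with rate 2L.\<close>

lemma linear_growth_bound:
  fixes x :: "real \<Rightarrow> 'a::real_inner"
  assumes x: "\<And>t. t \<in> {0..T} \<Longrightarrow> (x has_vector_derivative x' t) (at t within {0..})"
    and L: "\<And>t. t \<in> {0..T} \<Longrightarrow> norm (x' t) \<le> L * norm (x t)"
    and t: "t \<in> {0..T}"
  shows "norm (x t) \<le> norm (x 0) * exp (L * t)"
proof -
  have "((\<lambda>t. x t \<bullet> x t) has_real_derivative 2 * (x t \<bullet> x' t)) (at t within {0..})" if "t \<in> {0..T}" for t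
  proof -
    have "((\<lambda>t. x t \<bullet> x t) has_vector_derivative x t \<bullet> x' t + x' t \<bullet> x t) (at t within {0..})"
      by (intro bounded_bilinear.has_vector_derivative[OF bounded_bilinear_inner] x that)
    then show ?thesis
      by (simp add: has_real_derivative_iff_has_vector_derivative inner_commute)
  qed
  moreover have "((\<lambda>t. 2 * L * t) has_real_derivative 2 * L) (at t within {0..})" for t
    by (auto intro!: derivative_eq_intros)
  moreover have "2 * (x t \<bullet> x' t) \<le> 2 * L * (x t \<bullet> x t)" if "t \<in> {0..T}" for t
  proof -
    have "x t \<bullet> x' t \<le> norm (x t) * norm (x' t)"
      by (rule norm_cauchy_schwarz)
    also have "\<dots> \<le> norm (x t) * (L * norm (x t))"
      by (intro mult_left_mono L that) auto
    finally show ?thesis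
      by (simp add: power2_norm_eq_inner[symmetric] power2_eq_square mult_ac)
  qed
  ultimately have "x t \<bullet> x t \<le> (x 0 \<bullet> x 0) * exp (2 * L * t - 2 * L * 0)"
    by (rule gronwall[where T = T and W = "\<lambda>t. x t \<bullet> x t" and K = "\<lambda>t. 2 * L * t"]) (assumption | rule t)+
  also have "exp (2 * L * t - 2 * L * 0) = (exp (L * t))^2"
    by (simp add: exp_double[symmetric] mult.assoc)
  finally have "(norm (x t))^2 \<le> (norm (x 0) * exp (L * t))^2"
    by (simp add: power2_norm_eq_inner[symmetric] power_mult_distrib)
  then show ?thesis by (rule power2_le_imp_le) simp
qed

lemma ode_unique:
  fixes x y :: "real \<Rightarrow> 'a::real_inner"
  assumes x: "\<And>t. t \<in> {0..T} \<Longrightarrow> (x has_vector_derivative x' t) (at t within {0..})"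
    and y: "\<And>t. t \<in> {0..T} \<Longrightarrow> (y has_vector_derivative y' t) (at t within {0..})"
    and L: "\<And>t. t \<in> {0..T} \<Longrightarrow> norm (x' t - y' t) \<le> L * norm (x t - y t)"
    and "x 0 = y 0" and t: "t \<in> {0..T}"
  shows "x t = y t"
proof -
  have "norm (x t - y t) \<le> norm (x 0 - y 0) * exp (L * t)"
    by (rule linear_growth_bound[where x = "\<lambda>t. x t - y t", OF has_vector_derivative_diff[OF x y] L t])
  then show ?thesis using assms(4) by simp
qed

lemma continuous_on_nonneg_bounded:
  fixes A :: "real \<Rightarrow> 'z::real_normed_vector"
  assumes "continuous_on {0..} A"
  shows "\<exists>B\<ge>0. \<forall>t\<in>{0..T}. norm (A t) \<le> B"
proof -
  have "compact (A ` {0..T})"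
    by (intro compact_continuous_image continuous_on_subset[OF assms]) auto
  then have "bounded (A ` {0..T})" by (rule compact_imp_bounded)
  then obtain B where "\<forall>x\<in>A ` {0..T}. norm x \<le> B" unfolding bounded_iff by blast
  then show ?thesis by (intro exI[of _ "max 0 B"]) (auto simp: le_max_iff_disj)
qed

section \<open>Global existence by Picard iteration\<close>

primrec picard_iterate :: "(real \<Rightarrow> 'a::banach \<Rightarrow> 'a) \<Rightarrow> 'a \<Rightarrow> nat \<Rightarrow> real \<Rightarrow> 'a" where
  "picard_iterate F x0 0 = (\<lambda>t. x0)"
| "picard_iterate F x0 (Suc k) = (\<lambda>t. x0 + integral {0..t} (\<lambda>r. F r (picard_iterate F x0 k r)))"

text \<open>The Lipschitz constant may grow with T, but the iterates do not involve T. So one limit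
  function is defined on the whole half-line, and uniform convergence is checked on each [0, T]
  separately.\<close>

theorem picard_global:
  fixes F :: "real \<Rightarrow> 'a::banach \<Rightarrow> 'a"
  assumes cont: "continuous_on ({0..} \<times> UNIV) (\<lambda>(t, x). F t x)"
    and lip: "\<And>T. T \<ge> 0 \<Longrightarrow> \<exists>L. \<forall>t\<in>{0..T}. \<forall>x y. norm (F t x - F t y) \<le> L * norm (x - y)"
  shows "\<exists>x. x 0 = x0 \<and> (\<forall>t\<ge>0. (x has_vector_derivative F t (x t)) (at t within {0..}))"
proof -
  let ?X = "picard_iterate F x0"
  have contF: "continuous_on {0..T} (\<lambda>r. F r (x r))" if "continuous_on {0..T} x" for x T
  proof -
    have "continuous_on {0..T} (\<lambda>r. (\<lambda>(t, x). F t x) (r, x r))"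
      by (rule continuous_on_compose2[OF cont]) (auto intro!: continuous_intros that)
    then show ?thesis by simp
  qed
  have contX: "continuous_on {0..T} (?X k)" for k T
  proof (induction k)
    case (Suc k)
    have "continuous_on {0..T} (\<lambda>t. integral {0..t} (\<lambda>r. F r (?X k r)))"
      by (intro indefinite_integral_continuous_1 integrable_continuous_real contF Suc)
    then show ?case unfolding picard_iterate.simps by (intro continuous_on_add continuous_on_const)
  qed simp
  have derX: "(?X (Suc k) has_vector_derivative F t (?X k t)) (at t within {0..T})" if "t \<in> {0..T}" for k t T
    unfolding picard_iterate.simps
    by (rule has_vector_derivative_eq_rhs[OF has_vector_derivative_add[OF has_vector_derivative_const
          integral_has_vector_derivative[OF contF[OF contX] that]]]) simp
  have X0: "?X k 0 = x0" for k by (cases k) auto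
  define x where "x t = x0 + (\<Sum>i. ?X (Suc i) t - ?X i t)" for t
  have lim: "uniform_limit {0..T} ?X x sequentially" and
      lipT: "\<exists>L>0. \<forall>t\<in>{0..T}. \<forall>x y. norm (F t x - F t y) \<le> L * norm (x - y)" if T: "T \<ge> 0" for T
  proof -
    obtain L' where L': "\<forall>t\<in>{0..T}. \<forall>x y. norm (F t x - F t y) \<le> L' * norm (x - y)"
      using lip[OF T] by blast
    define L where "L = max 1 L'"
    have L0: "L > 0" by (simp add: L_def)
    have L: "norm (F t x - F t y) \<le> L * norm (x - y)" if "t \<in> {0..T}" for t x y
    proof -
      have "norm (F t x - F t y) \<le> L' * norm (x - y)" using L' that by blast
      also have "\<dots> \<le> L * norm (x - y)" by (intro mult_right_mono) (auto simp: L_def)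
      finally show ?thesis .
    qed
    show "\<exists>L>0. \<forall>t\<in>{0..T}. \<forall>x y. norm (F t x - F t y) \<le> L * norm (x - y)"
      using L L0 by blast
    have "compact ((\<lambda>t. ?X 1 t - ?X 0 t) ` {0..T})"
      by (intro compact_continuous_image continuous_on_diff contX compact_Icc)
    then have "bounded ((\<lambda>t. ?X 1 t - ?X 0 t) ` {0..T})" by (rule compact_imp_bounded)
    then obtain M where M: "\<And>t. t \<in> {0..T} \<Longrightarrow> norm (?X 1 t - ?X 0 t) \<le> M"
      unfolding bounded_iff by blast
    have "0 \<in> {0..T}" using T by simp
    then have M0: "M \<ge> 0" using M norm_ge_zero order_trans by blast
    \<comment> \<open>The weight exp(2 L t) gains the factor 1/2: the integral of L exp(2 L r) over
      [0, t] is at most exp(2 L t) / 2. So the telescoping series converges geometrically however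
      large T is.\<close>
    have step: "norm (?X (Suc k) t - ?X k t) \<le> M * (1/2)^k * exp (2 * L * t)" if "t \<in> {0..T}" for k t
      using that
    proof (induction k arbitrary: t)
      case 0
      have "M * 1 \<le> M * exp (2 * L * t)"
        using 0 L0 M0 by (intro mult_left_mono) auto
      then show ?case using M[OF 0] by simp
    next
      case (Suc k)
      show ?case
      proof (cases "t = 0")
        case True
        then show ?thesis using M0 X0[of "Suc k"] X0[of "Suc (Suc k)"] by (simp del: picard_iterate.simps)
      next
        case False
        define \<phi> where "\<phi> t = M * (1/2)^Suc k * exp (2 * L * t)" for t
        have d\<phi>: "(\<phi> has_vector_derivative M * (1/2)^Suc k * (2 * L * exp (2 * L * t))) (at t)" for t
          unfolding \<phi>_def has_real_derivative_iff_has_vector_derivative[symmetric]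
          by (auto intro!: derivative_eq_intros)
        have "norm ((?X (Suc (Suc k)) t - ?X (Suc k) t) - (?X (Suc (Suc k)) 0 - ?X (Suc k) 0)) \<le> \<phi> t - \<phi> 0"
        proof (rule differentiable_bound_general[where f = "\<lambda>t. ?X (Suc (Suc k)) t - ?X (Suc k) t" and \<phi> = \<phi>])
          show "0 < t" using False Suc.prems by simp
          show "continuous_on {0..t} (\<lambda>t. ?X (Suc (Suc k)) t - ?X (Suc k) t)"
            by (intro continuous_on_diff contX)
          show "continuous_on {0..t} \<phi>" unfolding \<phi>_def by (intro continuous_intros)
          fix r assume r: "0 < r" "r < t"
          then have "at r within {0..T} = at r"
            using Suc.prems by (intro at_within_interior) (simp add: interior_atLeastAtMost_real)
          then show "((\<lambda>t. ?X (Suc (Suc k)) t - ?X (Suc k) t) has_vector_derivative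
              F r (?X (Suc k) r) - F r (?X k r)) (at r)"
            using derX[of r T "Suc k"] derX[of r T k] r Suc.prems by (intro has_vector_derivative_diff) auto
          show "(\<phi> has_vector_derivative M * (1/2)^Suc k * (2 * L * exp (2 * L * r))) (at r)" by (rule d\<phi>)
          have "norm (F r (?X (Suc k) r) - F r (?X k r)) \<le> L * norm (?X (Suc k) r - ?X k r)"
            using r Suc.prems by (intro L) auto
          also have "\<dots> \<le> L * (M * (1/2)^k * exp (2 * L * r))"
            using r Suc.prems L0 by (intro mult_left_mono Suc.IH) auto
          finally show "norm (F r (?X (Suc k) r) - F r (?X k r)) \<le> M * (1/2)^Suc k * (2 * L * exp (2 * L * r))"
            by (simp add: mult_ac)
        qed
        moreover have "\<phi> 0 \<ge> 0" using M0 by (simp add: \<phi>_def)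
        ultimately show ?thesis
          unfolding \<phi>_def X0 by simp
      qed
    qed
    have "norm (?X (Suc k) t - ?X k t) \<le> M * (1/2)^k * exp (2 * L * T)" if "t \<in> {0..T}" for k t
    proof -
      have "M * (1/2)^k * exp (2 * L * t) \<le> M * (1/2)^k * exp (2 * L * T)"
        using that L0 M0 by (intro mult_left_mono) auto
      then show ?thesis using step[OF that, of k] by linarith
    qed
    moreover have "summable (\<lambda>k. M * (1/2)^k * exp (2 * L * T))"
      by (intro summable_mult summable_mult2 summable_geometric) simp
    ultimately have "uniform_limit {0..T} (\<lambda>n t. \<Sum>i<n. ?X (Suc i) t - ?X i t) (\<lambda>t. \<Sum>i. ?X (Suc i) t - ?X i t) sequentially"
      by (rule Weierstrass_m_test)
    then have "uniform_limit {0..T} (\<lambda>n t. x0 + (\<Sum>i<n. ?X (Suc i) t - ?X i t)) x sequentially"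
      unfolding x_def [abs_def] by (intro uniform_limit_intros)
    moreover have "x0 + (\<Sum>i<n. ?X (Suc i) t - ?X i t) = ?X n t" for n t
      using sum_lessThan_telescope[of "\<lambda>i. ?X i t" n] by simp
    ultimately show "uniform_limit {0..T} ?X x sequentially" by simp
  qed
  have contx: "continuous_on {0..T} x" if "T \<ge> 0" for T
    by (rule uniform_limit_theorem[OF _ lim[OF that]]) (intro always_eventually allI contX, simp)
  have eq: "x t = x0 + integral {0..t} (\<lambda>r. F r (x r))" if t: "t \<ge> 0" for t
  proof -
    obtain L where L: "L > 0" "\<And>r x y. r \<in> {0..t} \<Longrightarrow> norm (F r x - F r y) \<le> L * norm (x - y)"
      using lipT[OF t] by blast
    have ul: "uniform_limit {0..t} (\<lambda>k r. F r (?X k r)) (\<lambda>r. F r (x r)) sequentially"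
    proof (rule uniform_limitI)
      fix e :: real assume "e > 0"
      then have "e / L > 0" using L by simp
      from uniform_limitD[OF lim[OF t] this]
      show "\<forall>\<^sub>F k in sequentially. \<forall>r\<in>{0..t}. dist (F r (?X k r)) (F r (x r)) < e"
      proof eventually_elim
        case (elim k)
        show ?case
        proof
          fix r assume r: "r \<in> {0..t}"
          have "dist (F r (?X k r)) (F r (x r)) \<le> L * dist (?X k r) (x r)"
            using L(2)[OF r] by (simp add: dist_norm)
          also have "\<dots> < L * (e / L)"
            using elim r L(1) by (intro mult_strict_left_mono) auto
          finally show "dist (F r (?X k r)) (F r (x r)) < e" using L(1) by simp
        qed
      qed
    qed
    obtain I J where IJ: "\<And>k. ((\<lambda>r. F r (?X k r)) has_integral I k) {0..t}"
      "((\<lambda>r. F r (x r)) has_integral J) {0..t}" "I \<longlonglongrightarrow> J"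
      using uniform_limit_integral[OF ul contF[OF contX] sequentially_bot] by blast
    have "(\<lambda>k. ?X (Suc k) t) \<longlonglongrightarrow> x0 + J"
      using tendsto_add[OF tendsto_const IJ(3), of x0] by (simp add: integral_unique[OF IJ(1)])
    moreover have "(\<lambda>k. ?X k t) \<longlonglongrightarrow> x t"
      using tendsto_uniform_limitI[OF lim[OF t]] t by simp
    then have "(\<lambda>k. ?X (Suc k) t) \<longlonglongrightarrow> x t"
      by (rule LIMSEQ_Suc)
    ultimately show ?thesis
      using LIMSEQ_unique integral_unique[OF IJ(2)] by blast
  qed
  show ?thesis
  proof (intro exI[of _ x] conjI allI impI)
    show "x 0 = x0" using eq[of 0] by simp
    fix t :: real assume t: "t \<ge> 0"
    have "((\<lambda>t. x0 + integral {0..t} (\<lambda>r. F r (x r))) has_vector_derivative F t (x t)) (at t within {0..t + 1})"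
      using integral_has_vector_derivative[OF contF[OF contx], of "t + 1" t] t
      by (auto intro!: derivative_eq_intros)
    then have "(x has_vector_derivative F t (x t)) (at t within {0..t + 1})"
      by (rule has_vector_derivative_transform[rotated 2]) (use t eq in auto)
    then show "(x has_vector_derivative F t (x t)) (at t within {0..})"
      by (rule has_vector_derivative_nonneg_extend) (use t in auto)
  qed
qed

section \<open>Products of matrices in the Frobenius norm\<close>

lemma norm_matrix_vector_mult_le:
  fixes A :: "real^'n^'m"
  shows "norm (A *v x) \<le> norm A * norm x"
proof -
  have "norm (A *v x) \<le> L2_set (\<lambda>i. norm (A $ i) * norm x) UNIV"
    unfolding norm_vec_def[of "A *v x"]
    by (rule L2_set_mono) (auto simp: matrix_vector_mul_component Cauchy_Schwarz_ineq2)
  also have "\<dots> = norm A * norm x"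
    by (simp add: norm_vec_def[of A] L2_set_left_distrib)
  finally show ?thesis .
qed

lemma norm_transpose_matrix:
  fixes A :: "real^'n^'m"
  shows "norm (transpose A) = norm A"
proof -
  have "(norm (transpose A))^2 = (norm A)^2"
    unfolding power2_norm_eq_inner inner_vec_def transpose_def
    by (simp add: sum.swap[of _ "UNIV :: 'n set"])
  then show ?thesis by simp
qed

text \<open>Row i of A B is B^T applied to row i of A, so the vector estimate applies row by row;
  the Frobenius norm does not change under transposition.\<close>

lemma norm_matrix_mult_le:
  fixes A :: "real^'n^'m" and B :: "real^'k^'n"
  shows "norm (A ** B) \<le> norm A * norm B"
proof -
  have row: "(A ** B) $ i = transpose B *v (A $ i)" for i
    by (simp add: matrix_matrix_mult_def matrix_vector_mult_def transpose_def vec_eq_iff mult.commute)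
  have "norm (A ** B) \<le> L2_set (\<lambda>i. norm B * norm (A $ i)) UNIV"
    unfolding norm_vec_def[of "A ** B"]
  proof (rule L2_set_mono)
    show "norm ((A ** B) $ i) \<le> norm B * norm (A $ i)" for i
      using norm_matrix_vector_mult_le[of "transpose B" "A $ i"] by (simp add: row norm_transpose_matrix)
  qed auto
  also have "\<dots> = norm B * norm A"
    by (simp add: norm_vec_def[of A] L2_set_right_distrib)
  finally show ?thesis by (simp add: mult.commute)
qed

lemma bounded_bilinear_matrix_mult: "bounded_bilinear ((**) :: real^'n^'m \<Rightarrow> real^'k^'n \<Rightarrow> real^'k^'m)"
proof (rule bounded_bilinear.intro)
  show "\<exists>K. \<forall>A B. norm (A ** B :: real^'k^'m) \<le> norm (A :: real^'n^'m) * norm B * K"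
    by (intro exI[of _ 1]) (simp add: norm_matrix_mult_le)
qed (simp_all add: matrix_matrix_mult_def vec_eq_iff algebra_simps sum.distrib sum_distrib_left)

lemma bounded_bilinear_matrix_vector: "bounded_bilinear ((*v) :: real^'n^'m \<Rightarrow> real^'n \<Rightarrow> real^'m)"
proof (rule bounded_bilinear.intro)
  show "\<exists>K. \<forall>A x. norm (A *v x :: real^'m) \<le> norm (A :: real^'n^'m) * norm x * K"
    by (intro exI[of _ 1]) (simp add: norm_matrix_vector_mult_le)
qed (simp_all add: matrix_vector_mult_def vec_eq_iff algebra_simps sum.distrib sum_distrib_left)

lemma bounded_linear_transpose: "bounded_linear (transpose :: real^'n^'m \<Rightarrow> real^'m^'n)"
  by (rule bounded_linear_intro[of _ 1]) (auto simp: transpose_def vec_eq_iff norm_transpose_matrix[unfolded transpose_def])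

section \<open>Frames of linear systems with polynomial coefficients\<close>

lemmas matrix_mult_continuous_on = bounded_bilinear.continuous_on[OF bounded_bilinear_matrix_mult]
lemmas matrix_mult_has_vector_derivative = bounded_bilinear.has_vector_derivative[OF bounded_bilinear_matrix_mult]
lemmas matrix_vector_continuous_on = bounded_bilinear.continuous_on[OF bounded_bilinear_matrix_vector]
lemmas matrix_vector_has_vector_derivative = bounded_bilinear.has_vector_derivative[OF bounded_bilinear_matrix_vector]

lemma inner_matrix_vector_transpose:
  fixes A :: "real^'n^'m"
  shows "x \<bullet> (A *v y) = (transpose A *v x) \<bullet> y"
  by (simp add: dot_lmul_matrix)

lemma continuous_on_matrix_poly: "continuous_on S (matrix_poly A m)"
  unfolding matrix_poly_def [abs_def] by (intro continuous_intros)

lemma norm_matrix_poly_le: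
  assumes "\<And>i. norm (A i) \<le> B" "0 \<le> s" "s \<le> 1"
  shows "norm (matrix_poly A m s) \<le> real m * B"
proof -
  have "norm (matrix_poly A m s) \<le> (\<Sum>i<m. B)"
    unfolding matrix_poly_def
  proof (rule sum_norm_le)
    fix i
    have "s ^ i * norm (A i) \<le> 1 * B"
      using assms by (intro mult_mono power_le_one) auto
    then show "norm (s ^ i *\<^sub>R A i) \<le> B" using assms by simp
  qed
  then show ?thesis by simp
qed

text \<open>A general bilinear \<open>F\<close> covers both U' = U P, where the unknown is the left
  factor, and V' = - P V.\<close>

lemma linear_matrix_ode_exists:
  fixes A :: "real \<Rightarrow> real^'n^'n" and F :: "real^'n^'n \<Rightarrow> real^'n^'n \<Rightarrow> real^'n^'n"
  assumes A: "continuous_on {0..} A" and F: "bounded_bilinear F"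
  shows "\<exists>X. X 0 = X0 \<and> (\<forall>s\<ge>0. (X has_vector_derivative F (A s) (X s)) (at s within {0..}))"
proof (rule picard_global)
  have "continuous_on ({0..} \<times> UNIV) (\<lambda>p. F (A (fst p)) (snd p))"
    by (intro bounded_bilinear.continuous_on[OF F] continuous_on_compose2[OF A] continuous_intros) auto
  then show "continuous_on ({0..} \<times> UNIV) (\<lambda>(t, x). F (A t) x)"
    by (simp add: case_prod_beta)
  fix T :: real assume "T \<ge> 0"
  obtain K where K: "K > 0" "\<And>a b. norm (F a b) \<le> norm a * norm b * K"
    using bounded_bilinear.pos_bounded[OF F] by blast
  obtain M where M: "\<And>t. t \<in> {0..T} \<Longrightarrow> norm (A t) \<le> M"
    using continuous_on_nonneg_bounded[OF A] by blast
  have "norm (F (A t) x - F (A t) y) \<le> M * K * norm (x - y)" if "t \<in> {0..T}" for t x y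
  proof -
    have "norm (F (A t) (x - y)) \<le> norm (A t) * norm (x - y) * K" by (rule K(2))
    also have "\<dots> \<le> M * norm (x - y) * K"
      using M[OF that] K(1) by (intro mult_right_mono) auto
    finally show ?thesis
      by (simp add: bounded_bilinear.diff_right[OF F] mult_ac)
  qed
  then show "\<exists>L. \<forall>t\<in>{0..T}. \<forall>x y. norm (F (A t) x - F (A t) y) \<le> L * norm (x - y)" by blast
qed

text \<open>In s = exp (- \<tau>) the system dc/d\<tau> = s P(s) c reads dc/ds = - P c.
  \<open>V\<close> is its fundamental matrix normalised at s = 0, the image of \<tau> = \<infinity>,
  and \<open>U\<close> is the inverse of \<open>V\<close>. Both carry their own equation, so that no
  inverse has to be differentiated.\<close>

definition ode_frame :: "(real \<Rightarrow> real^'n^'n) \<Rightarrow> (real \<Rightarrow> real^'n^'n) \<Rightarrow> (real \<Rightarrow> real^'n^'n) \<Rightarrow> bool" where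
  "ode_frame P U V \<longleftrightarrow> U 0 = mat 1 \<and> V 0 = mat 1 \<and>
     (\<forall>s\<ge>0. (U has_vector_derivative U s ** P s) (at s within {0..})) \<and>
     (\<forall>s\<ge>0. (V has_vector_derivative - (P s ** V s)) (at s within {0..})) \<and>
     (\<forall>s\<ge>0. U s ** V s = mat 1 \<and> V s ** U s = mat 1)"

lemma ode_frame_exists:
  assumes P: "continuous_on {0..} (P :: real \<Rightarrow> real^'n^'n)"
  shows "\<exists>U V. ode_frame P U V"
proof -
  have "bounded_bilinear (\<lambda>A X :: real^'n^'n. X ** A)"
    by (rule bounded_bilinear.flip[OF bounded_bilinear_matrix_mult])
  from linear_matrix_ode_exists[OF P this] obtain U where
    U: "U 0 = mat 1" "\<forall>s\<ge>0. (U has_vector_derivative U s ** P s) (at s within {0..})" by blast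
  have "continuous_on {0..} (\<lambda>s. - P s)" using P by (rule continuous_on_minus)
  from linear_matrix_ode_exists[OF this bounded_bilinear_matrix_mult] obtain V where
    V: "V 0 = mat 1" "\<forall>s\<ge>0. (V has_vector_derivative - P s ** V s) (at s within {0..})" by blast
  have neg: "- P s ** V s = - (P s ** V s)" for s
    by (simp add: bounded_bilinear.minus_left[OF bounded_bilinear_matrix_mult])
  \<comment> \<open>The product is constant, as its derivative is - U P V + U P V.\<close>
  obtain c where c: "\<And>s. s \<in> {0..} \<Longrightarrow> U s ** V s = c"
  proof (rule has_vector_derivative_zero_constant[of "{0..}" "\<lambda>s. U s ** V s"])
    fix s :: real assume "s \<in> {0..}"
    then have "((\<lambda>s. U s ** V s) has_vector_derivative U s ** (- P s ** V s) + (U s ** P s) ** V s) (at s within {0..})"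
      using U V by (intro matrix_mult_has_vector_derivative) auto
    then show "((\<lambda>s. U s ** V s) has_vector_derivative 0) (at s within {0..})"
      by (simp add: neg bounded_bilinear.minus_right[OF bounded_bilinear_matrix_mult] matrix_mul_assoc)
  qed auto
  have "U s ** V s = mat 1" if "s \<ge> 0" for s
    using c[of 0] c[of s] U(1) V(1) that by simp
  moreover from this have "V s ** U s = mat 1" if "s \<ge> 0" for s
    using matrix_left_right_inverse that by blast
  ultimately have "ode_frame P U V"
    using U V unfolding ode_frame_def neg by simp
  then show ?thesis by blast
qed

lemma ode_frame_bound:
  fixes P :: "real \<Rightarrow> real^'n^'n"
  assumes fr: "ode_frame P U V" and P: "\<And>s. s \<in> {0..1} \<Longrightarrow> norm (P s) \<le> \<beta>" and s: "s \<in> {0..1}" and b: "\<beta> \<ge> 0"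
  shows "norm (U s) \<le> norm (mat 1 :: real^'n^'n) * exp \<beta>" "norm (V s) \<le> norm (mat 1 :: real^'n^'n) * exp \<beta>"
proof -
  have e: "norm (mat 1 :: real^'n^'n) * exp (\<beta> * s) \<le> norm (mat 1 :: real^'n^'n) * exp \<beta>"
    using s b by (intro mult_left_mono) (auto simp: mult_left_le)
  have "norm (U s) \<le> norm (U 0) * exp (\<beta> * s)"
  proof (rule linear_growth_bound[OF _ _ s])
    fix t :: real assume t: "t \<in> {0..1}"
    then show "(U has_vector_derivative U t ** P t) (at t within {0..})"
      using fr by (simp add: ode_frame_def)
    have "norm (U t ** P t) \<le> norm (U t) * norm (P t)" by (rule norm_matrix_mult_le)
    also have "\<dots> \<le> norm (U t) * \<beta>" by (intro mult_left_mono P t) auto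
    finally show "norm (U t ** P t) \<le> \<beta> * norm (U t)" by (simp add: mult.commute)
  qed
  then show "norm (U s) \<le> norm (mat 1 :: real^'n^'n) * exp \<beta>"
    using e fr by (simp add: ode_frame_def)
  have "norm (V s) \<le> norm (V 0) * exp (\<beta> * s)"
  proof (rule linear_growth_bound[OF _ _ s])
    fix t :: real assume t: "t \<in> {0..1}"
    then show "(V has_vector_derivative - (P t ** V t)) (at t within {0..})"
      using fr by (simp add: ode_frame_def)
    have "norm (P t ** V t) \<le> norm (P t) * norm (V t)" by (rule norm_matrix_mult_le)
    also have "\<dots> \<le> \<beta> * norm (V t)" by (intro mult_right_mono P t) auto
    finally show "norm (- (P t ** V t)) \<le> \<beta> * norm (V t)" by simp
  qed
  then show "norm (V s) \<le> norm (mat 1 :: real^'n^'n) * exp \<beta>"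
    using e fr by (simp add: ode_frame_def)
qed

text \<open>Cauchy product of an approximated factor with a polynomial: the terms s^(a+k) are split
  along a + k < K, and those outside this triangle are O(s^K). The condition K \<le> m ensures that
  the polynomial has every term inside the triangle.\<close>

lemma truncated_product_bound:
  fixes X :: "real^'n^'m" and x :: "nat \<Rightarrow> real^'n^'m" and B :: "nat \<Rightarrow> real^'k^'n"
  assumes X: "norm (X - (\<Sum>k<K. s ^ k *\<^sub>R x k)) \<le> C * s ^ K"
    and x: "\<And>k. k < K \<Longrightarrow> norm (x k) \<le> c" and B: "\<And>i. norm (B i) \<le> b" and s: "0 \<le> s" "s \<le> 1"
    and K: "K \<le> m" and c: "c \<ge> 0"
  shows "norm (X ** matrix_poly B m s - (\<Sum>j<K. s ^ j *\<^sub>R (\<Sum>a\<le>j. x (j - a) ** B a)))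
    \<le> (C * (real m * b) + real (m * K) * (c * b)) * s ^ K"
proof -
  let ?S = "\<Sum>k<K. s ^ k *\<^sub>R x k"
  define g where "g a k = s ^ (a + k) *\<^sub>R (x k ** B a)" for a k
  have b0: "b \<ge> 0" using B[of 0] norm_ge_zero order_trans by blast
  have t1: "norm ((X - ?S) ** matrix_poly B m s) \<le> C * s ^ K * (real m * b)"
  proof -
    have "norm ((X - ?S) ** matrix_poly B m s) \<le> norm (X - ?S) * norm (matrix_poly B m s)"
      by (rule norm_matrix_mult_le)
    also have "\<dots> \<le> C * s ^ K * (real m * b)"
      using order_trans[OF norm_ge_zero X] by (intro mult_mono X norm_matrix_poly_le B s) auto
    finally show ?thesis .
  qed
  have "?S ** matrix_poly B m s = (\<Sum>(a, k)\<in>{..<m} \<times> {..<K}. g a k)"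
  proof -
    have "?S ** matrix_poly B m s = (\<Sum>a<m. \<Sum>k<K. g a k)"
      unfolding matrix_poly_def g_def
      by (simp add: bounded_bilinear.sum_left[OF bounded_bilinear_matrix_mult]
          bounded_bilinear.sum_right[OF bounded_bilinear_matrix_mult]
          bounded_bilinear.scaleR_left[OF bounded_bilinear_matrix_mult]
          bounded_bilinear.scaleR_right[OF bounded_bilinear_matrix_mult] power_add scaleR_sum_right)
    then show ?thesis by (simp add: sum.cartesian_product)
  qed
  also have "\<dots> = (\<Sum>(a, k)\<in>{..<m} \<times> {..<K} - {(a, k). a + k < K}. g a k) + (\<Sum>(a, k)\<in>{(a, k). a + k < K}. g a k)"
    using K by (intro sum.subset_diff) auto
  also have "(\<Sum>(a, k)\<in>{(a, k). a + k < K}. g a k) = (\<Sum>j<K. \<Sum>a\<le>j. g a (j - a))"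
    by (rule sum.triangle_reindex)
  also have "\<dots> = (\<Sum>j<K. s ^ j *\<^sub>R (\<Sum>a\<le>j. x (j - a) ** B a))"
    by (simp add: g_def scaleR_sum_right)
  finally have eq: "X ** matrix_poly B m s - (\<Sum>j<K. s ^ j *\<^sub>R (\<Sum>a\<le>j. x (j - a) ** B a)) =
      (X - ?S) ** matrix_poly B m s + (\<Sum>(a, k)\<in>{..<m} \<times> {..<K} - {(a, k). a + k < K}. g a k)"
    by (simp add: bounded_bilinear.diff_left[OF bounded_bilinear_matrix_mult])
  have "norm (\<Sum>(a, k)\<in>{..<m} \<times> {..<K} - {(a, k). a + k < K}. g a k)
      \<le> (\<Sum>(a, k)\<in>{..<m} \<times> {..<K} - {(a, k). a + k < K}. s ^ K * (c * b))"
  proof (rule sum_norm_le)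
    fix p assume "p \<in> {..<m} \<times> {..<K} - {(a, k). a + k < K}"
    then obtain a k where p: "p = (a, k)" and "a \<in> {..<m}" "k \<in> {..<K}" "\<not> a + k < K" by auto
    then have "s ^ (a + k) \<le> s ^ K" "k < K"
      using s by (auto intro!: power_decreasing)
    moreover have "norm (x k ** B a) \<le> c * b"
      using norm_matrix_mult_le[of "x k" "B a"] mult_mono[OF x[OF \<open>k < K\<close>] B[of a]] c by auto
    ultimately show "norm (case p of (a, k) \<Rightarrow> g a k) \<le> (case p of (a, k) \<Rightarrow> s ^ K * (c * b))"
      unfolding p prod.case g_def norm_scaleR using s by (intro mult_mono) auto
  qed
  also have "\<dots> = real (card ({..<m} \<times> {..<K} - {(a, k). a + k < K})) * (s ^ K * (c * b))"
    by (simp add: case_prod_beta)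
  also have "\<dots> \<le> real (m * K) * (s ^ K * (c * b))"
    using s b0 c card_mono[of "{..<m} \<times> {..<K}" "{..<m} \<times> {..<K} - {(a, k). a + k < K}"]
    by (intro mult_right_mono) (auto simp: card_cartesian_product simp del: of_nat_mult)
  finally show ?thesis
    unfolding eq using t1
      norm_triangle_ineq[of "(X - ?S) ** matrix_poly B m s" "\<Sum>(a, k)\<in>{..<m} \<times> {..<K} - {(a, k). a + k < K}. g a k"]
    by (simp add: algebra_simps)
qed

text \<open>Comparison of coefficients in U' = U P with U(0) = 1.\<close>

fun frame_coef :: "(nat \<Rightarrow> real^'n^'n) \<Rightarrow> nat \<Rightarrow> real^'n^'n" where
  "frame_coef Pc 0 = mat 1"
| "frame_coef Pc (Suc k) = (1 / real (Suc k)) *\<^sub>R (\<Sum>a\<le>k. frame_coef Pc (k - a) ** Pc a)"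

text \<open>The constant must precede the family \<open>Pc\<close>, because the family varies with
  xb.\<close>

lemma frame_coef_bound:
  "\<exists>c\<ge>0. \<forall>Pc :: nat \<Rightarrow> real^'n^'n. (\<forall>i. norm (Pc i) \<le> b) \<longrightarrow> (\<forall>k\<le>m. norm (frame_coef Pc k) \<le> c)"
proof (induction m)
  case 0
  show ?case by (intro exI[of _ "norm (mat 1 :: real^'n^'n)"]) auto
next
  case (Suc m)
  then obtain c where c: "c \<ge> 0" "\<And>(Pc :: nat \<Rightarrow> real^'n^'n) k. (\<forall>i. norm (Pc i) \<le> b) \<Longrightarrow> k \<le> m \<Longrightarrow> norm (frame_coef Pc k) \<le> c"
    by blast
  define c' where "c' = max c (real (Suc m) * (c * b))"
  show ?case
  proof (intro exI[of _ c'] conjI allI impI)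
    show "0 \<le> c'" using c(1) by (simp add: c'_def)
    fix Pc :: "nat \<Rightarrow> real^'n^'n" and k assume P: "\<forall>i. norm (Pc i) \<le> b" and k: "k \<le> Suc m"
    show "norm (frame_coef Pc k) \<le> c'"
    proof (cases "k \<le> m")
      case True
      then show ?thesis using c(2)[OF P] by (simp add: c'_def le_max_iff_disj)
    next
      case False
      then have k: "k = Suc m" using k by simp
      let ?S = "\<Sum>a\<le>m. frame_coef Pc (m - a) ** Pc a"
      have "norm ?S \<le> (\<Sum>a\<le>m. c * b)"
      proof (rule sum_norm_le)
        fix a
        show "norm (frame_coef Pc (m - a) ** Pc a) \<le> c * b"
          using norm_matrix_mult_le[of "frame_coef Pc (m - a)" "Pc a"]
            mult_mono[OF c(2)[OF P, of "m - a"] P[rule_format, of a]] c(1) by auto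
      qed
      then have "norm ?S \<le> real (Suc m) * (c * b)" by simp
      moreover have "norm (frame_coef Pc k) \<le> 1 * norm ?S"
        unfolding k frame_coef.simps norm_scaleR by (intro mult_right_mono) (auto simp: divide_le_eq_1)
      ultimately show ?thesis unfolding c'_def by linarith
    qed
  qed
qed

text \<open>Induction on the order with one integration per step: the derivative of the error of
  order K + 1 is the error of the product U P truncated at order K. The start K = 0 is the growth
  bound for U. The constant depends on b, K and m but not on the coefficients.\<close>

lemma frame_expansion:
  fixes b :: real
  assumes b: "b \<ge> 0" and K: "K \<le> m"
  shows "\<exists>C\<ge>0. \<forall>(Pc :: nat \<Rightarrow> real^'n^'n) U V. (\<forall>i. norm (Pc i) \<le> b) \<longrightarrow> ode_frame (matrix_poly Pc m) U V \<longrightarrow>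
    (\<forall>s\<in>{0..1}. norm (U s - (\<Sum>k<K. s ^ k *\<^sub>R frame_coef Pc k)) \<le> C * s ^ K)"
  using K
proof (induction K)
  case 0
  show ?case
  proof (intro exI[of _ "norm (mat 1 :: real^'n^'n) * exp (real m * b)"] conjI allI impI ballI)
    fix Pc :: "nat \<Rightarrow> real^'n^'n" and U V and s :: real
    assume P: "\<forall>i. norm (Pc i) \<le> b" and fr: "ode_frame (matrix_poly Pc m) U V" and s: "s \<in> {0..1}"
    have "norm (matrix_poly Pc m s) \<le> real m * b" if "s \<in> {0..1}" for s
      using P that by (intro norm_matrix_poly_le) auto
    then have "norm (U s) \<le> norm (mat 1 :: real^'n^'n) * exp (real m * b)"
      by (rule ode_frame_bound(1)[OF fr _ s]) (use b in auto)
    then show "norm (U s - (\<Sum>k<0. s ^ k *\<^sub>R frame_coef Pc k)) \<le> norm (mat 1 :: real^'n^'n) * exp (real m * b) * s ^ 0"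
      by simp
  qed simp
next
  case (Suc K)
  then have Km: "K \<le> m" by simp
  from Suc.IH[OF Km] obtain C where C: "C \<ge> 0" "\<And>(Pc :: nat \<Rightarrow> real^'n^'n) U V s. (\<forall>i. norm (Pc i) \<le> b) \<Longrightarrow>
      ode_frame (matrix_poly Pc m) U V \<Longrightarrow> s \<in> {0..1} \<Longrightarrow>
      norm (U s - (\<Sum>k<K. s ^ k *\<^sub>R frame_coef Pc k)) \<le> C * s ^ K" by blast
  from frame_coef_bound[where 'n = 'n, of b K] obtain c where c: "c \<ge> 0"
    "\<And>(Pc :: nat \<Rightarrow> real^'n^'n) k. (\<forall>i. norm (Pc i) \<le> b) \<Longrightarrow> k \<le> K \<Longrightarrow> norm (frame_coef Pc k) \<le> c" by blast
  define D where "D = C * (real m * b) + real (m * K) * (c * b)"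
  have D: "D \<ge> 0" using C(1) c(1) b by (simp add: D_def)
  show ?case
  proof (intro exI[of _ D] conjI allI impI ballI D)
    fix Pc :: "nat \<Rightarrow> real^'n^'n" and U V and s :: real
    assume P: "\<forall>i. norm (Pc i) \<le> b" and fr: "ode_frame (matrix_poly Pc m) U V" and s: "s \<in> {0..1}"
    define E where "E s = U s - (\<Sum>k<Suc K. s ^ k *\<^sub>R frame_coef Pc k)" for s
    define E' where "E' s = U s ** matrix_poly Pc m s -
      (\<Sum>j<K. s ^ j *\<^sub>R (\<Sum>a\<le>j. frame_coef Pc (j - a) ** Pc a))" for s
    have bound: "norm (E' t) \<le> D * t ^ K" if "t \<in> {0..1}" for t
      unfolding E'_def D_def
      by (rule truncated_product_bound[OF C(2)[OF P fr that]]) (use c P that Km in auto)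
    have der: "(E has_vector_derivative E' t) (at t within {0..})" if "t \<ge> 0" for t
    proof -
      have "((\<lambda>s. \<Sum>k<Suc K. s ^ k *\<^sub>R frame_coef Pc k) has_vector_derivative
          (\<Sum>j<K. t ^ j *\<^sub>R (\<Sum>a\<le>j. frame_coef Pc (j - a) ** Pc a))) (at t within {0..})"
        unfolding sum.lessThan_Suc_shift
      proof (rule has_vector_derivative_eq_rhs)
        show "((\<lambda>s. s ^ 0 *\<^sub>R frame_coef Pc 0 + (\<Sum>i<K. s ^ Suc i *\<^sub>R frame_coef Pc (Suc i))) has_vector_derivative
            0 + (\<Sum>i<K. (real (Suc i) * t ^ i) *\<^sub>R frame_coef Pc (Suc i))) (at t within {0..})"
        proof (intro has_vector_derivative_add has_vector_derivative_sum)
          show "((\<lambda>s. s ^ 0 *\<^sub>R frame_coef Pc 0) has_vector_derivative 0) (at t within {0..})" by simp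
          show "((\<lambda>s. s ^ Suc i *\<^sub>R frame_coef Pc (Suc i)) has_vector_derivative
              (real (Suc i) * t ^ i) *\<^sub>R frame_coef Pc (Suc i)) (at t within {0..})" for i
            by (rule has_vector_derivative_eq_rhs, rule has_vector_derivative_scaleR)
               (rule DERIV_pow, rule has_vector_derivative_const, simp)
        qed
        show "0 + (\<Sum>i<K. (real (Suc i) * t ^ i) *\<^sub>R frame_coef Pc (Suc i)) =
            (\<Sum>j<K. t ^ j *\<^sub>R (\<Sum>a\<le>j. frame_coef Pc (j - a) ** Pc a))"
          by (simp del: of_nat_Suc)
      qed
      then show ?thesis
        unfolding E_def E'_def using fr that by (intro has_vector_derivative_diff) (auto simp: ode_frame_def)
    qed
    have E0: "E 0 = 0"
      using fr unfolding E_def sum.lessThan_Suc_shift by (simp add: ode_frame_def)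
    show "norm (U s - (\<Sum>k<Suc K. s ^ k *\<^sub>R frame_coef Pc k)) \<le> D * s ^ Suc K"
    proof (cases "s = 0")
      case True
      then show ?thesis using E0 D unfolding E_def by simp
    next
      case False
      \<comment> \<open>Its derivative D (K + 1) t^K dominates the bound D t^K; the factor K + 1 is
        simply given away.\<close>
      define \<phi> where "\<phi> t = D * t ^ Suc K" for t :: real
      have "norm (E s - E 0) \<le> \<phi> s - \<phi> 0"
      proof (rule differentiable_bound_general[where f = E and \<phi> = \<phi>])
        show "0 < s" using False s by simp
        show "continuous_on {0..s} E"
          unfolding continuous_on_eq_continuous_within
          using der by (meson atLeastAtMost_iff atLeast_iff continuous_within_subset has_vector_derivative_continuous subsetI)
        show "continuous_on {0..s} \<phi>" unfolding \<phi>_def by (intro continuous_intros)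
        fix t assume t: "0 < t" "t < s"
        then show "(E has_vector_derivative E' t) (at t)"
          using der[of t] by (simp add: at_within_nonneg)
        show "(\<phi> has_vector_derivative D * (real (Suc K) * t ^ K)) (at t)"
          unfolding \<phi>_def has_real_derivative_iff_has_vector_derivative[symmetric]
          by (rule DERIV_cmult[THEN DERIV_cong], rule DERIV_pow) simp
        have "D * (1 * t ^ K) \<le> D * (real (Suc K) * t ^ K)"
          using D t by (intro mult_left_mono mult_right_mono) auto
        then show "norm (E' t) \<le> D * (real (Suc K) * t ^ K)"
          using bound[of t] t s by auto
      qed
      then show ?thesis using E0 by (simp add: \<phi>_def E_def)
    qed
  qed
qed

section \<open>The weighted Gramian\<close>

definition gram :: "nat \<Rightarrow> (real \<Rightarrow> real^'r^'n) \<Rightarrow> real \<Rightarrow> real^'n^'n" where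
  "gram q Y s = integral {0..s} (\<lambda>\<sigma>. \<sigma> ^ q *\<^sub>R (Y \<sigma> ** transpose (Y \<sigma>)))"

lemma continuous_on_gram_integrand:
  fixes Y :: "real \<Rightarrow> real^'r^'n"
  assumes "continuous_on S Y"
  shows "continuous_on S (\<lambda>\<sigma>. \<sigma> ^ q *\<^sub>R (Y \<sigma> ** transpose (Y \<sigma>)))"
  by (intro continuous_intros matrix_mult_continuous_on assms
      bounded_linear.continuous_on[OF bounded_linear_transpose])

lemma gram_has_integral:
  fixes Y :: "real \<Rightarrow> real^'r^'n"
  assumes "continuous_on {0..} Y"
  shows "((\<lambda>\<sigma>. \<sigma> ^ q *\<^sub>R (Y \<sigma> ** transpose (Y \<sigma>))) has_integral gram q Y s) {0..s}"
  unfolding gram_def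
  by (intro integrable_integral integrable_continuous_real continuous_on_gram_integrand continuous_on_subset[OF assms]) auto

lemma gram_has_vector_derivative:
  fixes Y :: "real \<Rightarrow> real^'r^'n"
  assumes Y: "continuous_on {0..} Y" and s: "s \<ge> 0"
  shows "(gram q Y has_vector_derivative s ^ q *\<^sub>R (Y s ** transpose (Y s))) (at s within {0..})"
proof (rule has_vector_derivative_nonneg_extend)
  show "(gram q Y has_vector_derivative s ^ q *\<^sub>R (Y s ** transpose (Y s))) (at s within {0..s + 1})"
    unfolding gram_def [abs_def]
    by (rule integral_has_vector_derivative)
       (use s in \<open>auto intro!: continuous_on_gram_integrand continuous_on_subset[OF Y]\<close>)
qed (use s in auto)

lemma gram_quadratic_form:
  fixes Y :: "real \<Rightarrow> real^'r^'n"
  assumes "continuous_on {0..} Y"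
  shows "((\<lambda>\<sigma>. \<sigma> ^ q * (norm (transpose (Y \<sigma>) *v v))^2) has_integral v \<bullet> (gram q Y s *v v)) {0..s}"
proof -
  have "bounded_linear (\<lambda>A :: real^'n^'n. v \<bullet> (A *v v))"
    by (rule bounded_linear_compose[OF bounded_linear_inner_right
          bounded_bilinear.bounded_linear_left[OF bounded_bilinear_matrix_vector]])
  from has_integral_linear[OF gram_has_integral[OF assms] this]
  have "((\<lambda>\<sigma>. v \<bullet> ((\<sigma> ^ q *\<^sub>R (Y \<sigma> ** transpose (Y \<sigma>))) *v v)) has_integral v \<bullet> (gram q Y s *v v)) {0..s}"
    by (simp add: o_def)
  moreover have "v \<bullet> ((\<sigma> ^ q *\<^sub>R (Y \<sigma> ** transpose (Y \<sigma>))) *v v) = \<sigma> ^ q * (norm (transpose (Y \<sigma>) *v v))^2" for \<sigma>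
  proof -
    have "v \<bullet> ((Y \<sigma> ** transpose (Y \<sigma>)) *v v) = (transpose (Y \<sigma>) *v v) \<bullet> (transpose (Y \<sigma>) *v v)"
      by (simp only: matrix_vector_mul_assoc[symmetric] inner_matrix_vector_transpose)
    then show ?thesis
      by (simp only: scaleR_matrix_vector_assoc[symmetric] inner_scaleR_right power2_norm_eq_inner)
  qed
  ultimately show ?thesis by simp
qed

lemma transpose_gram:
  fixes Y :: "real \<Rightarrow> real^'r^'n"
  assumes "continuous_on {0..} Y"
  shows "transpose (gram q Y s) = gram q Y s"
proof -
  have "((\<lambda>\<sigma>. transpose (\<sigma> ^ q *\<^sub>R (Y \<sigma> ** transpose (Y \<sigma>)))) has_integral transpose (gram q Y s)) {0..s}"
    using has_integral_linear[OF gram_has_integral[OF assms] bounded_linear_transpose] by (simp add: o_def)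
  moreover have "transpose (\<sigma> ^ q *\<^sub>R (Y \<sigma> ** transpose (Y \<sigma>))) = \<sigma> ^ q *\<^sub>R (Y \<sigma> ** transpose (Y \<sigma>))" for \<sigma>
    by (simp only: linear_scale[OF bounded_linear.linear[OF bounded_linear_transpose]] matrix_transpose_mul transpose_transpose)
  ultimately have "((\<lambda>\<sigma>. \<sigma> ^ q *\<^sub>R (Y \<sigma> ** transpose (Y \<sigma>))) has_integral transpose (gram q Y s)) {0..s}"
    by (simp only:)
  then show ?thesis
    by (rule has_integral_unique[OF _ gram_has_integral[OF assms]])
qed

lemma norm_gram_le:
  fixes Y :: "real \<Rightarrow> real^'r^'n"
  assumes Y: "continuous_on {0..} Y" and C: "\<And>\<sigma>. \<sigma> \<in> {0..1} \<Longrightarrow> norm (Y \<sigma>) \<le> C" and s: "s \<in> {0..1}"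
  shows "norm (gram q Y s) \<le> C^2 * s ^ (q + 1)"
proof -
  have C0: "C \<ge> 0" using order_trans[OF norm_ge_zero C[of 0]] by simp
  have "norm (gram q Y s) \<le> (s ^ q * C^2) * measure lborel (cbox 0 s)"
  proof (rule has_integral_bound)
    show "((\<lambda>\<sigma>. \<sigma> ^ q *\<^sub>R (Y \<sigma> ** transpose (Y \<sigma>))) has_integral gram q Y s) (cbox 0 s)"
      using gram_has_integral[OF Y] by simp
    fix \<sigma> assume \<sigma>: "\<sigma> \<in> cbox 0 s"
    have "norm (Y \<sigma> ** transpose (Y \<sigma>)) \<le> norm (Y \<sigma>) * norm (Y \<sigma>)"
      using norm_matrix_mult_le[of "Y \<sigma>" "transpose (Y \<sigma>)"] by (simp add: norm_transpose_matrix)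
    also have "\<dots> \<le> C * C" using C[of \<sigma>] \<sigma> s C0 by (intro mult_mono) auto
    finally show "norm (\<sigma> ^ q *\<^sub>R (Y \<sigma> ** transpose (Y \<sigma>))) \<le> s ^ q * C^2"
      unfolding norm_scaleR power2_eq_square using \<sigma> s by (intro mult_mono) (auto intro!: power_mono simp: power_abs[symmetric])
  qed (use s C0 in auto)
  then show ?thesis using s by (simp add: mult_ac)
qed

section \<open>Uniform lower bound for the Gramian\<close>

lemma power_has_integral:
  fixes s :: real
  assumes "s \<ge> 0"
  shows "((\<lambda>\<sigma>. \<sigma> ^ m) has_integral s ^ (m + 1) / real (m + 1)) {0..s}"
proof -
  have "((\<lambda>\<sigma>. \<sigma> ^ m) has_integral s ^ (m + 1) / real (m + 1) - 0 ^ (m + 1) / real (m + 1)) {0..s}"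
  proof (rule fundamental_theorem_of_calculus[OF assms])
    show "((\<lambda>\<sigma>. \<sigma> ^ (m + 1) / real (m + 1)) has_vector_derivative \<sigma> ^ m) (at \<sigma> within {0..s})" for \<sigma>
      unfolding has_real_derivative_iff_has_vector_derivative[symmetric]
      by (rule DERIV_cdivide[THEN DERIV_cong], rule DERIV_pow) (simp del: of_nat_Suc)
  qed
  then show ?thesis by simp
qed

lemma norm_polynomial_has_integral:
  fixes a :: "nat \<Rightarrow> 'a::real_inner"
  assumes "s \<ge> 0"
  shows "((\<lambda>\<sigma>. \<sigma> ^ q * (norm (\<Sum>k<n. \<sigma> ^ k *\<^sub>R a k))^2) has_integral
    (\<Sum>k<n. \<Sum>l<n. (a k \<bullet> a l) * (s ^ (q + k + l + 1) / real (q + k + l + 1)))) {0..s}"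
proof -
  have "\<sigma> ^ q * (norm (\<Sum>k<n. \<sigma> ^ k *\<^sub>R a k))^2 = (\<Sum>k<n. \<Sum>l<n. (a k \<bullet> a l) * \<sigma> ^ (q + k + l))" for \<sigma>
  proof -
    have "(norm (\<Sum>k<n. \<sigma> ^ k *\<^sub>R a k))^2 = (\<Sum>k<n. \<Sum>l<n. \<sigma> ^ k * (\<sigma> ^ l * (a k \<bullet> a l)))"
      unfolding power2_norm_eq_inner inner_sum_left inner_sum_right
      by (intro sum.cong refl) (simp add: inner_commute)
    then show ?thesis by (simp add: sum_distrib_left power_add mult_ac)
  qed
  then show ?thesis
    by (simp only:) (intro has_integral_sum has_integral_mult_right power_has_integral assms finite_lessThan)
qed

lemma polynomial_eq_0_on_interval:
  fixes b :: "nat \<Rightarrow> real^'r"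
  assumes z: "\<And>\<sigma>. 0 < \<sigma> \<Longrightarrow> \<sigma> \<le> 1 \<Longrightarrow> (\<Sum>k<n. \<sigma> ^ k *\<^sub>R b k) = 0" and k: "k < n"
  shows "b k = 0"
proof -
  have "b k $ j = 0" for j
  proof (rule ccontr)
    assume nz: "b k $ j \<noteq> 0"
    define c where "c i = (if i < n then b i $ j else 0)" for i
    have "finite {x. (\<Sum>i\<le>n. c i * x ^ i) = 0}"
      using polyfun_finite_roots[of c n] nz k by (auto simp: c_def intro!: exI[of _ k])
    moreover have "{0<..1} \<subseteq> {x. (\<Sum>i\<le>n. c i * x ^ i) = 0}"
    proof safe
      fix x :: real assume "x \<in> {0<..1}"
      then have "(\<Sum>k<n. x ^ k *\<^sub>R b k) $ j = 0" using z by simp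
      then have "(\<Sum>i<n. c i * x ^ i) = 0" by (simp add: c_def sum_component mult.commute)
      moreover have "(\<Sum>i\<le>n. c i * x ^ i) = (\<Sum>i<n. c i * x ^ i)"
        by (simp add: lessThan_Suc_atMost[symmetric] c_def)
      ultimately show "(\<Sum>i\<le>n. c i * x ^ i) = 0" by simp
    qed
    ultimately have "finite {0<..1::real}" by (rule finite_subset[rotated])
    then show False using infinite_Ioc[of 0 "1::real"] by simp
  qed
  then show ?thesis by (simp add: vec_eq_iff)
qed

text \<open>The minimum over the compact unit sphere is positive, and homogeneity of degree 2
  carries it to all vectors.\<close>

lemma homogeneous_lower_bound:
  fixes E :: "'a::euclidean_space \<Rightarrow> real"
  assumes cont: "continuous_on (sphere 0 1) E" and pos: "\<And>v. v \<noteq> 0 \<Longrightarrow> E v > 0"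
    and scale: "\<And>r v. E (r *\<^sub>R v) = r^2 * E v"
  shows "\<exists>\<kappa>>0. \<forall>v. \<kappa> * (norm v)^2 \<le> E v"
proof -
  have "sphere 0 1 \<noteq> ({} :: 'a set)" by simp
  with cont obtain v0 where v0: "v0 \<in> sphere 0 1" "\<And>v. v \<in> sphere 0 1 \<Longrightarrow> E v0 \<le> E v"
    using continuous_attains_inf[of "sphere 0 1" E] by auto
  have "E v0 * (norm v)^2 \<le> E v" for v
  proof (cases "v = 0")
    case False
    have "E v0 \<le> E (v /\<^sub>R norm v)" using False by (intro v0(2)) simp
    also have "\<dots> = E v / (norm v)^2" unfolding scale by (simp add: field_simps)
    finally show ?thesis using False by (simp add: field_simps)
  qed (use scale[of 0 0] in simp)
  moreover have "E v0 > 0" using v0(1) by (intro pos) auto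
  ultimately show ?thesis by blast
qed

text \<open>The matrix 1 / (q + k + l + 1) is of Hilbert type, namely the Gram matrix of the
  monomials \<sigma>^k in L^2 of [0, 1] with weight \<sigma>^q. It is positive definite because a
  nonzero polynomial has finitely many zeros, and vector-valued coefficients are handled by
  components.\<close>

lemma hilbert_form_positive:
  "\<exists>\<kappa>>0. \<forall>b :: nat \<Rightarrow> real^'r.
     \<kappa> * (\<Sum>k<CARD('n::finite). (norm (b k))^2) \<le>
       (\<Sum>k<CARD('n). \<Sum>l<CARD('n). (b k \<bullet> b l) / real (q + k + l + 1))"
proof -
  let ?n = "CARD('n)" and ?e = "to_nat_on (UNIV :: 'n set)"
  have e: "bij_betw ?e UNIV {..<?n}" by (rule to_nat_on_finite) simp
  \<comment> \<open>The n coefficients are packed into one element of \<open>(real^'r)^'n\<close> by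
    enumerating the index type, which makes compactness of the unit sphere available.\<close>
  define H where "H c = (\<Sum>i\<in>UNIV. \<Sum>j\<in>UNIV. ((c :: (real^'r)^'n) $ i \<bullet> c $ j) / real (q + ?e i + ?e j + 1))" for c
  have re: "(\<Sum>i\<in>UNIV. g (?e i)) = (\<Sum>k<?n. g k)" for g :: "nat \<Rightarrow> real"
    by (rule sum.reindex_bij_betw[OF e])
  have H: "H (\<chi> i. b (?e i)) = (\<Sum>k<?n. \<Sum>l<?n. (b k \<bullet> b l) / real (q + k + l + 1))" for b
  proof -
    have "H (\<chi> i. b (?e i)) = (\<Sum>i\<in>UNIV. \<Sum>l<?n. (b (?e i) \<bullet> b l) / real (q + ?e i + l + 1))"
      unfolding H_def vec_lambda_beta by (intro sum.cong refl re)
    also have "\<dots> = (\<Sum>k<?n. \<Sum>l<?n. (b k \<bullet> b l) / real (q + k + l + 1))"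
      by (rule re)
    finally show ?thesis .
  qed
  have N: "(norm (\<chi> i. b (?e i)))^2 = (\<Sum>k<?n. (norm (b k))^2)" for b :: "nat \<Rightarrow> real^'r"
    by (simp only: power2_norm_eq_inner inner_vec_def[of "\<chi> i. b (?e i)"] vec_lambda_beta
        re[of "\<lambda>k. b k \<bullet> b k"])
  have rep: "\<exists>b. c = (\<chi> i. b (?e i))" for c :: "(real^'r)^'n"
    by (intro exI[of _ "\<lambda>k. c $ from_nat_into UNIV k"])
       (simp add: vec_eq_iff)
  have pos: "H c > 0" if c: "c \<noteq> 0" for c
  proof -
    obtain b where b: "c = (\<chi> i. b (?e i))" using rep by blast
    let ?f = "\<lambda>\<sigma>. \<sigma> ^ q * (norm (\<Sum>k<?n. \<sigma> ^ k *\<^sub>R b k))^2"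
    have int: "(?f has_integral H c) {0..1}"
      using norm_polynomial_has_integral[where s = 1 and q = q and n = ?n and a = b] by (simp add: b H)
    then have "H c \<ge> 0" by (rule has_integral_nonneg) auto
    moreover have "H c \<noteq> 0"
    proof
      assume "H c = 0"
      then have i0: "integral {0..1} ?f = 0" using integral_unique[OF int] by simp
      have "continuous_on {0..1} ?f" by (intro continuous_intros)
      from integral_eq_0_iff[OF this] i0 have z: "\<forall>\<sigma>\<in>{0..1}. ?f \<sigma> = 0" by simp
      have "b k = 0" if "k < ?n" for k
      proof (rule polynomial_eq_0_on_interval[OF _ that])
        fix \<sigma> :: real assume "0 < \<sigma>" "\<sigma> \<le> 1"
        then show "(\<Sum>k<?n. \<sigma> ^ k *\<^sub>R b k) = 0" using z[rule_format, of \<sigma>] by simp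
      qed
      then have "c = 0"
        using bij_betwE[OF e] by (auto simp: b vec_eq_iff)
      then show False using c by simp
    qed
    ultimately show ?thesis by simp
  qed
  have scale: "H (r *\<^sub>R c) = r^2 * H c" for r c
    by (simp add: H_def sum_distrib_left power2_eq_square mult_ac)
  have "continuous_on (sphere 0 1) H"
    unfolding H_def by (intro continuous_intros) auto
  from homogeneous_lower_bound[OF this pos scale] obtain \<kappa> where \<kappa>: "\<kappa> > 0" "\<And>c. \<kappa> * (norm c)^2 \<le> H c"
    by blast
  have "\<kappa> * (\<Sum>k<?n. (norm (b k))^2) \<le> (\<Sum>k<?n. \<Sum>l<?n. (b k \<bullet> b l) / real (q + k + l + 1))" for b :: "nat \<Rightarrow> real^'r"
    using \<kappa>(2)[of "\<chi> i. b (?e i)"] unfolding H N .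
  with \<kappa>(1) show ?thesis by blast
qed

text \<open>On a short interval [0, r] the polynomial part p of Y^T v dominates. Scaling \<sigma> by
  r turns the integral of \<sigma>^q |p|^2 into r^(q+1) times the Hilbert-type form at the vectors
  r^k a_k, whose worst scale is r^(n-1); this yields the exponent q + 1 + 2(n - 1). The Taylor error
  enters with r^(q+2n+1), two powers higher. Beyond the short interval the quadratic form of the
  Gramian can only grow.\<close>

lemma gram_lower_bound:
  fixes C \<kappa>0 :: real
  assumes C: "C \<ge> 0" and \<kappa>0: "\<kappa>0 > 0"
  shows "\<exists>\<kappa>>0. \<forall>(Y :: real \<Rightarrow> real^'r^'n) y. continuous_on {0..} Y \<longrightarrow>
    (\<forall>\<sigma>\<in>{0..1}. norm (Y \<sigma> - (\<Sum>k<CARD('n). \<sigma> ^ k *\<^sub>R y k)) \<le> C * \<sigma> ^ CARD('n)) \<longrightarrow>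
    (\<forall>v. \<kappa>0 * (norm v)^2 \<le> (\<Sum>k<CARD('n). (norm (transpose (y k) *v v))^2)) \<longrightarrow>
    (\<forall>s\<in>{0..1}. \<forall>v. \<kappa> * s ^ (q + 1 + 2 * (CARD('n) - 1)) * (norm v)^2 \<le> v \<bullet> (gram q Y s *v v))"
proof -
  let ?n = "CARD('n)"
  let ?m = "q + 1 + 2 * (?n - 1)"
  obtain \<kappa>1 where \<kappa>1: "\<kappa>1 > 0" "\<And>b :: nat \<Rightarrow> real^'r.
     \<kappa>1 * (\<Sum>k<?n. (norm (b k))^2) \<le> (\<Sum>k<?n. \<Sum>l<?n. (b k \<bullet> b l) / real (q + k + l + 1))"
    using hilbert_form_positive[where 'n = 'n and 'r = 'r, of q] by blast
  \<comment> \<open>Makes C^2 s0^2 \<le> \<kappa>1 \<kappa>0 / 4. Half of the main term is lost to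
    the square of a sum and half of the rest to the Taylor error, which leaves the quarter in
    \<kappa>2.\<close>
  define s0 where "s0 = min 1 (sqrt (\<kappa>1 * \<kappa>0 / (4 * (C^2 + 1))))"
  define \<kappa>2 where "\<kappa>2 = \<kappa>1 * \<kappa>0 / 4"
  have \<kappa>2: "\<kappa>2 > 0" using \<kappa>1(1) \<kappa>0 by (simp add: \<kappa>2_def)
  have C1: "C^2 + 1 > 0" by (simp add: add_nonneg_pos)
  have s0: "0 < s0" "s0 \<le> 1" "C^2 * s0^2 \<le> \<kappa>2"
  proof -
    have p: "\<kappa>1 * \<kappa>0 / (4 * (C^2 + 1)) > 0" using \<kappa>1(1) \<kappa>0 C1 by simp
    then show "0 < s0" "s0 \<le> 1" by (auto simp: s0_def)
    then have "s0^2 \<le> (sqrt (\<kappa>1 * \<kappa>0 / (4 * (C^2 + 1))))^2"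
      by (intro power_mono) (auto simp: s0_def)
    also have "\<dots> = \<kappa>2 / (C^2 + 1)" using p C1 by (simp add: \<kappa>2_def)
    finally have "C^2 * s0^2 \<le> C^2 * (\<kappa>2 / (C^2 + 1))" by (intro mult_left_mono) auto
    also have "\<dots> \<le> \<kappa>2" using C1 \<kappa>2 by (simp add: field_simps)
    finally show "C^2 * s0^2 \<le> \<kappa>2" .
  qed
  show ?thesis
  proof (intro exI[of _ "\<kappa>2 * s0 ^ ?m"] conjI allI impI ballI)
    show "\<kappa>2 * s0 ^ ?m > 0" using \<kappa>2 s0 by simp
    fix Y :: "real \<Rightarrow> real^'r^'n" and y and s :: real and v :: "real^'n"
    assume Y: "continuous_on {0..} Y"
      and approx: "\<forall>\<sigma>\<in>{0..1}. norm (Y \<sigma> - (\<Sum>k<?n. \<sigma> ^ k *\<^sub>R y k)) \<le> C * \<sigma> ^ ?n"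
      and obs: "\<forall>v. \<kappa>0 * (norm v)^2 \<le> (\<Sum>k<?n. (norm (transpose (y k) *v v))^2)"
      and s: "s \<in> {0..1}"
    define I where "I s = v \<bullet> (gram q Y s *v v)" for s
    have int: "((\<lambda>\<sigma>. \<sigma> ^ q * (norm (transpose (Y \<sigma>) *v v))^2) has_integral I s) {0..s}" for s
      unfolding I_def by (rule gram_quadratic_form[OF Y])
    have mono: "I r \<le> I s" if "0 \<le> r" "r \<le> s" for r s
      by (rule has_integral_subset_le[OF _ int int]) (use that in auto)
    define a where "a k = transpose (y k) *v v" for k
    have small: "\<kappa>2 * r ^ ?m * (norm v)^2 \<le> I r" if r: "0 \<le> r" "r \<le> s0" for r
    proof -
      have r1: "r \<le> 1" using r s0 by simp
      let ?J = "\<Sum>k<?n. \<Sum>l<?n. (a k \<bullet> a l) * (r ^ (q + k + l + 1) / real (q + k + l + 1))"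
      \<comment> \<open>This is |p|^2 \<le> 2 |g|^2 + 2 |p - g|^2 with g = Y^T v, integrated against
        \<sigma>^q.\<close>
      have L1: "?J / 2 - C^2 * (norm v)^2 * (r ^ (q + 2 * ?n + 1) / real (q + 2 * ?n + 1)) \<le> I r"
      proof (rule has_integral_le[OF _ int])
        show "((\<lambda>\<sigma>. (\<sigma> ^ q * (norm (\<Sum>k<?n. \<sigma> ^ k *\<^sub>R a k))^2) / 2 - C^2 * (norm v)^2 * \<sigma> ^ (q + 2 * ?n)) has_integral
            ?J / 2 - C^2 * (norm v)^2 * (r ^ (q + 2 * ?n + 1) / real (q + 2 * ?n + 1))) {0..r}"
          by (intro has_integral_diff has_integral_divide has_integral_mult_right
              norm_polynomial_has_integral power_has_integral r(1))
        fix \<sigma> assume \<sigma>: "\<sigma> \<in> {0..r}"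
        then have \<sigma>1: "\<sigma> \<in> {0..1}" using r1 by auto
        let ?g = "transpose (Y \<sigma>) *v v" and ?p = "\<Sum>k<?n. \<sigma> ^ k *\<^sub>R a k"
        have "?p = transpose (\<Sum>k<?n. \<sigma> ^ k *\<^sub>R y k) *v v"
          unfolding a_def
          by (simp only: linear_sum[OF bounded_linear.linear[OF bounded_linear_transpose]]
              linear_scale[OF bounded_linear.linear[OF bounded_linear_transpose]]
              bounded_bilinear.sum_left[OF bounded_bilinear_matrix_vector] scaleR_matrix_vector_assoc)
        then have "?p - ?g = - (transpose (Y \<sigma> - (\<Sum>k<?n. \<sigma> ^ k *\<^sub>R y k)) *v v)"
          by (simp add: linear_diff[OF bounded_linear.linear[OF bounded_linear_transpose]]
              bounded_bilinear.diff_left[OF bounded_bilinear_matrix_vector])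
        then have "norm (?p - ?g) \<le> norm (Y \<sigma> - (\<Sum>k<?n. \<sigma> ^ k *\<^sub>R y k)) * norm v"
          using norm_matrix_vector_mult_le[of "transpose (Y \<sigma> - (\<Sum>k<?n. \<sigma> ^ k *\<^sub>R y k))" v]
          by (simp add: norm_transpose_matrix)
        also have "\<dots> \<le> C * \<sigma> ^ ?n * norm v"
          using approx \<sigma>1 by (intro mult_right_mono) auto
        finally have d: "norm (?p - ?g) \<le> C * \<sigma> ^ ?n * norm v" .
        have "norm ?p \<le> norm ?g + norm (?p - ?g)"
          using norm_triangle_ineq[of ?g "?p - ?g"] by simp
        also have "\<dots> \<le> norm ?g + C * \<sigma> ^ ?n * norm v" using d by simp
        finally have "(norm ?p)^2 \<le> (norm ?g + C * \<sigma> ^ ?n * norm v)^2"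
          by (rule power_mono) simp
        also have "\<dots> \<le> 2 * (norm ?g)^2 + 2 * (C * \<sigma> ^ ?n * norm v)^2"
          using sum_squares_bound[of "norm ?g" "C * \<sigma> ^ ?n * norm v"] by (simp add: power2_sum)
        finally have "(norm ?p)^2 / 2 - (C * \<sigma> ^ ?n * norm v)^2 \<le> (norm ?g)^2" by simp
        then have "\<sigma> ^ q * ((norm ?p)^2 / 2 - (C * \<sigma> ^ ?n * norm v)^2) \<le> \<sigma> ^ q * (norm ?g)^2"
          using \<sigma> by (intro mult_left_mono) auto
        moreover have sq: "(C * \<sigma> ^ ?n * norm v)^2 = C^2 * (norm v)^2 * \<sigma> ^ (2 * ?n)"
          by (simp add: power_mult_distrib power_even_eq)
        have "\<sigma> ^ q * ((norm ?p)^2 / 2 - (C * \<sigma> ^ ?n * norm v)^2) =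
            (\<sigma> ^ q * (norm ?p)^2) / 2 - C^2 * (norm v)^2 * \<sigma> ^ (q + 2 * ?n)"
          unfolding sq power_add by (simp only: right_diff_distrib times_divide_eq_right mult_ac)
        ultimately show "(\<sigma> ^ q * (norm ?p)^2) / 2 - C^2 * (norm v)^2 * \<sigma> ^ (q + 2 * ?n) \<le> \<sigma> ^ q * (norm ?g)^2"
          by linarith
      qed
      have L2: "\<kappa>1 * \<kappa>0 * r ^ ?m * (norm v)^2 \<le> ?J"
      proof -
        have "r ^ (q + 1) * (\<kappa>1 * (\<Sum>k<?n. (norm (r ^ k *\<^sub>R a k))^2)) \<le>
            r ^ (q + 1) * (\<Sum>k<?n. \<Sum>l<?n. (r ^ k *\<^sub>R a k) \<bullet> (r ^ l *\<^sub>R a l) / real (q + k + l + 1))"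
          using \<kappa>1(2)[of "\<lambda>k. r ^ k *\<^sub>R a k"] r by (intro mult_left_mono) auto
        also have "\<dots> = ?J"
          by (simp add: sum_distrib_left power_add mult_ac)
        finally have 1: "r ^ (q + 1) * (\<kappa>1 * (\<Sum>k<?n. (norm (r ^ k *\<^sub>R a k))^2)) \<le> ?J" .
        have "r ^ (2 * (?n - 1)) * (\<kappa>0 * (norm v)^2) \<le> r ^ (2 * (?n - 1)) * (\<Sum>k<?n. (norm (a k))^2)"
          using obs r unfolding a_def by (intro mult_left_mono) auto
        also have "\<dots> \<le> (\<Sum>k<?n. (norm (r ^ k *\<^sub>R a k))^2)"
          unfolding sum_distrib_left
        proof (rule sum_mono)
          fix k assume "k \<in> {..<?n}"
          then have "r ^ (2 * (?n - 1)) \<le> r ^ (2 * k)"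
            using r r1 by (intro power_decreasing) auto
          then have "r ^ (2 * (?n - 1)) * (norm (a k))^2 \<le> r ^ (2 * k) * (norm (a k))^2"
            by (rule mult_right_mono) simp
          also have "\<dots> = (norm (r ^ k *\<^sub>R a k))^2"
            using r(1) unfolding norm_scaleR power_mult_distrib by (simp add: power_even_eq)
          finally show "r ^ (2 * (?n - 1)) * (norm (a k))^2 \<le> (norm (r ^ k *\<^sub>R a k))^2" .
        qed
        finally have "r ^ (q + 1) * (\<kappa>1 * (r ^ (2 * (?n - 1)) * (\<kappa>0 * (norm v)^2))) \<le>
            r ^ (q + 1) * (\<kappa>1 * (\<Sum>k<?n. (norm (r ^ k *\<^sub>R a k))^2))"
          using \<kappa>1(1) r by (intro mult_left_mono) auto
        with 1 show ?thesis by (simp add: power_add mult_ac)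
      qed
      have L3: "C^2 * (norm v)^2 * (r ^ (q + 2 * ?n + 1) / real (q + 2 * ?n + 1)) \<le> \<kappa>2 * r ^ ?m * (norm v)^2"
      proof -
        have e: "q + 2 * ?n + 1 = ?m + 2" using one_le_card_finite[where 'a = 'n] by linarith
        have "r ^ (q + 2 * ?n + 1) / real (q + 2 * ?n + 1) \<le> r ^ (q + 2 * ?n + 1)"
          using r divide_left_mono[of 1 "real (q + 2 * ?n + 1)" "r ^ (q + 2 * ?n + 1)"] by simp
        then have "C^2 * (norm v)^2 * (r ^ (q + 2 * ?n + 1) / real (q + 2 * ?n + 1)) \<le> C^2 * (norm v)^2 * r ^ (q + 2 * ?n + 1)"
          by (intro mult_left_mono) auto
        also have "\<dots> = (C^2 * r^2) * (r ^ ?m * (norm v)^2)"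
          unfolding e by (simp add: power_add mult_ac power2_eq_square)
        also have "\<dots> \<le> \<kappa>2 * (r ^ ?m * (norm v)^2)"
        proof (rule mult_right_mono)
          have "C^2 * r^2 \<le> C^2 * s0^2" using r by (intro mult_left_mono power_mono) auto
          then show "C^2 * r^2 \<le> \<kappa>2" using s0(3) by linarith
        qed (use r in auto)
        finally show ?thesis by (simp add: mult_ac)
      qed
      have L4: "\<kappa>2 * r ^ ?m * (norm v)^2 = \<kappa>1 * \<kappa>0 * r ^ ?m * (norm v)^2 / 4" by (simp add: \<kappa>2_def)
      have "X / 4 \<le> z" if "J / 2 - Z \<le> z" "X \<le> J" "Z \<le> X / 4" for J X Z z :: real
        using that by linarith
      from this[OF L1 L2 L3[unfolded L4]] show ?thesis unfolding L4 .
    qed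
    \<comment> \<open>For s > s0 the value at s0 is a lower bound by monotonicity; this is the
      origin of the factor \<open>s0 ^ ?m\<close> in the constant.\<close>
    show "\<kappa>2 * s0 ^ ?m * s ^ ?m * (norm v)^2 \<le> v \<bullet> (gram q Y s *v v)"
    proof (cases "s \<le> s0")
      case True
      have "\<kappa>2 * (s0 ^ ?m * s ^ ?m) * (norm v)^2 \<le> \<kappa>2 * (1 * s ^ ?m) * (norm v)^2"
        using s s0 \<kappa>2 by (intro mult_right_mono mult_left_mono power_le_one) auto
      then show ?thesis using small[of s] True s unfolding I_def by (simp add: mult_ac)
    next
      case False
      have "\<kappa>2 * (s0 ^ ?m * s ^ ?m) * (norm v)^2 \<le> \<kappa>2 * (s0 ^ ?m * 1) * (norm v)^2"
        using s s0 \<kappa>2 by (intro mult_right_mono mult_left_mono power_le_one) auto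
      also have "\<dots> \<le> I s0" using small[of s0] s0 by simp
      also have "\<dots> \<le> I s" using False s0 by (intro mono) auto
      finally show ?thesis unfolding I_def by (simp add: mult_ac)
    qed
  qed
qed

text \<open>Taylor coefficients of Y = U Q0 at s = 0, by the Cauchy product. For constant P0 = A and
  Q0 = B they are A^k B / k!.\<close>

definition obs_coef :: "(nat \<Rightarrow> real^'n^'n) \<Rightarrow> (nat \<Rightarrow> real^'r^'n) \<Rightarrow> nat \<Rightarrow> real^'r^'n" where
  "obs_coef Pc Qc k = (\<Sum>a\<le>k. frame_coef Pc (k - a) ** Qc a)"

lemma continuous_on_frame:
  assumes "ode_frame P U V"
  shows "continuous_on {0..} U" "continuous_on {0..} V"
  using assms unfolding ode_frame_def
  by (auto intro!: continuous_on_vector_derivative)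

text \<open>The point is the order of quantifiers: \<kappa> and C depend on b, \<kappa>0, q and the
  dimensions only, so they serve for all small xb although the frame and the Gramian change with
  xb.\<close>

lemma linear_control:
  fixes b \<kappa>0 :: real
  assumes b: "b \<ge> 0" and \<kappa>0: "\<kappa>0 > 0"
  shows "\<exists>\<kappa>>0. \<exists>C\<ge>0. \<forall>(Pc :: nat \<Rightarrow> real^'n^'n) (Qc :: nat \<Rightarrow> real^'r^'n).
    (\<forall>i. norm (Pc i) \<le> b) \<longrightarrow> (\<forall>i. norm (Qc i) \<le> b) \<longrightarrow>
    (\<forall>v. \<kappa>0 * (norm v)^2 \<le> (\<Sum>k<CARD('n). (norm (transpose (obs_coef Pc Qc k) *v v))^2)) \<longrightarrow>
    (\<exists>U V. ode_frame (matrix_poly Pc CARD('n)) U V \<and>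
      (\<forall>s\<in>{0..1}. norm (U s) \<le> C \<and> norm (V s) \<le> C \<and> norm (U s ** matrix_poly Qc (2 * CARD('n)) s) \<le> C \<and>
        (\<forall>v. \<kappa> * s ^ (q + 1 + 2 * (CARD('n) - 1)) * (norm v)^2 \<le>
          v \<bullet> (gram q (\<lambda>s. U s ** matrix_poly Qc (2 * CARD('n)) s) s *v v))))"
proof -
  let ?n = "CARD('n)"
  let ?m = "q + 1 + 2 * (?n - 1)"
  from frame_expansion[where 'n = 'n, OF b order_refl[of ?n]] obtain D where
    D: "D \<ge> 0" "\<And>(Pc :: nat \<Rightarrow> real^'n^'n) U V s. (\<forall>i. norm (Pc i) \<le> b) \<Longrightarrow> ode_frame (matrix_poly Pc ?n) U V \<Longrightarrow>
    s \<in> {0..1} \<Longrightarrow> norm (U s - (\<Sum>k<?n. s ^ k *\<^sub>R frame_coef Pc k)) \<le> D * s ^ ?n"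
    by blast
  from frame_coef_bound[where 'n = 'n, of b ?n] obtain c where c: "c \<ge> 0"
    "\<And>(Pc :: nat \<Rightarrow> real^'n^'n) k. (\<forall>i. norm (Pc i) \<le> b) \<Longrightarrow> k \<le> ?n \<Longrightarrow> norm (frame_coef Pc k) \<le> c" by blast
  \<comment> \<open>The constant of \<open>truncated_product_bound\<close> for 2n coefficients of Q
    and order n. As n \<le> 2n, no coefficient of Q that matters below s^n is cut off.\<close>
  define D' where "D' = D * (real (2 * ?n) * b) + real (2 * ?n * ?n) * (c * b)"
  have "D' \<ge> 0" using D(1) c(1) b by (simp add: D'_def)
  from gram_lower_bound[where 'n = 'n and 'r = 'r, OF this \<kappa>0, of q] obtain \<kappa> where \<kappa>: "\<kappa> > 0"
    "\<And>(Y :: real \<Rightarrow> real^'r^'n) y s v. continuous_on {0..} Y \<Longrightarrow>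
    (\<forall>\<sigma>\<in>{0..1}. norm (Y \<sigma> - (\<Sum>k<?n. \<sigma> ^ k *\<^sub>R y k)) \<le> D' * \<sigma> ^ ?n) \<Longrightarrow>
    (\<forall>v. \<kappa>0 * (norm v)^2 \<le> (\<Sum>k<?n. (norm (transpose (y k) *v v))^2)) \<Longrightarrow>
    s\<in>{0..1} \<Longrightarrow> \<kappa> * s ^ ?m * (norm v)^2 \<le> v \<bullet> (gram q Y s *v v)"
    by blast
  define C where "C = norm (mat 1 :: real^'n^'n) * exp (real ?n * b)"
  have C: "C \<ge> 0" by (simp add: C_def)
  define C' where "C' = max C (C * (real (2 * ?n) * b))"
  show ?thesis
  proof (rule exI[of _ \<kappa>], rule conjI[OF \<kappa>(1)], rule exI[of _ C'], intro conjI allI impI)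
    show "C' \<ge> 0" using C by (simp add: C'_def)
    fix Pc :: "nat \<Rightarrow> real^'n^'n" and Qc :: "nat \<Rightarrow> real^'r^'n"
    assume P: "\<forall>i. norm (Pc i) \<le> b" and Q: "\<forall>i. norm (Qc i) \<le> b"
      and obs: "\<forall>v. \<kappa>0 * (norm v)^2 \<le> (\<Sum>k<?n. (norm (transpose (obs_coef Pc Qc k) *v v))^2)"
    obtain U V where fr: "ode_frame (matrix_poly Pc ?n) U V"
      using ode_frame_exists[OF continuous_on_matrix_poly] by blast
    have Pb: "norm (matrix_poly Pc ?n s) \<le> real ?n * b" if "s \<in> {0..1}" for s
      using P that by (intro norm_matrix_poly_le) auto
    have UV: "norm (U s) \<le> C" "norm (V s) \<le> C" if "s \<in> {0..1}" for s
      unfolding C_def using ode_frame_bound[OF fr Pb that] b by auto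
    let ?Y = "\<lambda>s. U s ** matrix_poly Qc (2 * ?n) s"
    have Yb: "norm (?Y s) \<le> C * (real (2 * ?n) * b)" if s: "s \<in> {0..1}" for s
    proof -
      have "norm (matrix_poly Qc (2 * ?n) s) \<le> real (2 * ?n) * b"
        using Q s by (intro norm_matrix_poly_le) auto
      then have "norm (U s) * norm (matrix_poly Qc (2 * ?n) s) \<le> C * (real (2 * ?n) * b)"
        using UV[OF s] C by (intro mult_mono) auto
      then show ?thesis using norm_matrix_mult_le order_trans by blast
    qed
    have Yc: "continuous_on {0..} ?Y"
      by (intro matrix_mult_continuous_on continuous_on_frame[OF fr] continuous_on_matrix_poly)
    have "norm (?Y s - (\<Sum>k<?n. s ^ k *\<^sub>R obs_coef Pc Qc k)) \<le> D' * s ^ ?n" if s: "s \<in> {0..1}" for s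
      unfolding obs_coef_def D'_def
      by (rule truncated_product_bound[OF D(2)[OF P fr s]]) (use c P Q s in auto)
    with Yc obs have "\<kappa> * s ^ ?m * (norm v)^2 \<le> v \<bullet> (gram q ?Y s *v v)" if "s \<in> {0..1}" for s v
      using that by (intro \<kappa>(2)) auto
    moreover have "norm (U s) \<le> C'" "norm (V s) \<le> C'" "norm (?Y s) \<le> C'" if "s \<in> {0..1}" for s
      using UV[OF that] Yb[OF that] unfolding C'_def by linarith+
    ultimately show "\<exists>U V. ode_frame (matrix_poly Pc ?n) U V \<and>
      (\<forall>s\<in>{0..1}. norm (U s) \<le> C' \<and> norm (V s) \<le> C' \<and> norm (U s ** matrix_poly Qc (2 * ?n) s) \<le> C' \<and>
        (\<forall>v. \<kappa> * s ^ ?m * (norm v)^2 \<le> v \<bullet> (gram q (\<lambda>s. U s ** matrix_poly Qc (2 * ?n) s) s *v v)))"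
      using fr by (intro exI[of _ U] exI[of _ V]) simp
  qed
qed

section \<open>Controllability, and observability of nearby systems\<close>

lemma frame_coef_const:
  fixes A :: "real^'n^'n"
  assumes "Pc = (\<lambda>i. if i = 0 then A else 0)"
  shows "frame_coef Pc k ** B = (1 / fact k) *\<^sub>R (((**) A ^^ k) B)"
proof -
  \<comment> \<open>For constant P the solution U is exp(s A); only the term a = 0 of the recursion
    survives.\<close>
  have step: "frame_coef Pc (Suc k) = (1 / real (Suc k)) *\<^sub>R (frame_coef Pc k ** A)" for k
  proof -
    have "(\<Sum>a\<le>k. frame_coef Pc (k - a) ** Pc a) = (\<Sum>a\<in>{0}. frame_coef Pc (k - a) ** Pc a)"
      by (rule sum.mono_neutral_right)
         (auto simp: assms bounded_bilinear.zero_right[OF bounded_bilinear_matrix_mult])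
    then show ?thesis by (simp add: assms)
  qed
  show ?thesis
  proof (induction k arbitrary: B)
    case (Suc k)
    have "frame_coef Pc (Suc k) ** B = (1 / real (Suc k)) *\<^sub>R (frame_coef Pc k ** (A ** B))"
      unfolding step by (simp only: bounded_bilinear.scaleR_left[OF bounded_bilinear_matrix_mult] matrix_mul_assoc)
    also have "\<dots> = (1 / fact (Suc k)) *\<^sub>R (((**) A ^^ k) (A ** B))"
      unfolding Suc.IH by (simp add: field_simps)
    also have "((**) A ^^ k) (A ** B) = ((**) A ^^ Suc k) B"
      by (simp only: funpow_swap1 funpow.simps o_apply)
    finally show ?case .
  qed simp
qed

text \<open>Kalman's duality: the conditions make v orthogonal to every column of the
  controllability matrix, and the transpose of that matrix is injective by full rank.\<close>

lemma controllable_imp_observable: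
  fixes A :: "real^'n^'n" and B :: "real^'r^'n"
  assumes rk: "rank (controllability_matrix A B) = CARD('n)"
    and z: "\<And>k. k < CARD('n) \<Longrightarrow> transpose (((**) A ^^ k) B) *v v = 0"
  shows "v = 0"
proof -
  let ?C = "controllability_matrix A B"
  have "inj ((*v) (transpose ?C))"
    using rk unfolding full_rank_injective[symmetric] rank_transpose .
  moreover have "transpose ?C *v v = 0"
  proof -
    have "(transpose ?C *v v) $ p = 0" for p
    proof -
      have "to_nat_on (UNIV :: 'n set) (fst p) < CARD('n)"
        using to_nat_on_finite[of "UNIV :: 'n set"] by (auto simp: bij_betw_def)
      from z[OF this] have "(transpose (((**) A ^^ to_nat_on (UNIV :: 'n set) (fst p)) B) *v v) $ snd p = 0"
        by simp
      then show ?thesis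
        by (simp add: controllability_matrix_def transpose_def matrix_vector_mult_def)
    qed
    then show ?thesis by (simp add: vec_eq_iff)
  qed
  ultimately show ?thesis
    by (metis injD matrix_vector_mult_0_right)
qed

lemma tendsto_matrix_mult:
  "(f \<longlongrightarrow> a) F \<Longrightarrow> (g \<longlongrightarrow> b) F \<Longrightarrow> ((\<lambda>x. (f x :: real^'n^'m) ** (g x :: real^'k^'n)) \<longlongrightarrow> a ** b) F"
  by (rule bounded_bilinear.tendsto[OF bounded_bilinear_matrix_mult])

lemma tendsto_frame_coef:
  assumes "\<And>i. i < m \<Longrightarrow> ((\<lambda>x. Pc x i) \<longlongrightarrow> Pc0 i) F" "k \<le> m"
  shows "((\<lambda>x. frame_coef (Pc x) k) \<longlongrightarrow> frame_coef Pc0 k) F"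
  using assms(2)
proof (induction k rule: less_induct)
  case (less k)
  show ?case
  proof (cases k)
    case (Suc j)
    have "((\<lambda>x. frame_coef (Pc x) (j - a) ** Pc x a) \<longlongrightarrow> frame_coef Pc0 (j - a) ** Pc0 a) F" if "a \<le> j" for a
      using less Suc that by (intro tendsto_matrix_mult assms(1) less.IH) auto
    then show ?thesis
      unfolding Suc frame_coef.simps by (intro tendsto_scaleR tendsto_const tendsto_sum) auto
  qed simp
qed

text \<open>At the limit the form is \<Sum> |y_k^T v|^2 with y_k = A^k B / k!, which is positive
  definite by controllability and hence bounded below on the unit sphere. The y_k depend
  continuously on finitely many coefficients, so a fixed fraction of that bound survives
  nearby.\<close>

lemma observability_eventually:
  fixes A :: "real^'n^'n" and B :: "real^'r^'n"
  assumes rk: "rank (controllability_matrix A B) = CARD('n)"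
    and P: "\<And>i. i < CARD('n) \<Longrightarrow> ((\<lambda>x. Pc x i) \<longlongrightarrow> (if i = 0 then A else 0)) F"
    and Q: "\<And>i. i < CARD('n) \<Longrightarrow> ((\<lambda>x. Qc x i) \<longlongrightarrow> (if i = 0 then B else 0)) F"
  shows "\<exists>\<kappa>>0. \<forall>\<^sub>F x in F. \<forall>v. \<kappa> * (norm v)^2 \<le> (\<Sum>k<CARD('n). (norm (transpose (obs_coef (Pc x) (Qc x) k) *v v))^2)"
proof -
  let ?n = "CARD('n)"
  define P0 where "P0 = (\<lambda>i::nat. if i = 0 then A else 0)"
  define Q0 where "Q0 = (\<lambda>i::nat. if i = 0 then B else 0)"
  have y0: "obs_coef P0 Q0 k = (1 / fact k) *\<^sub>R (((**) A ^^ k) B)" for k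
  proof -
    have "obs_coef P0 Q0 k = (\<Sum>a\<in>{0}. frame_coef P0 (k - a) ** Q0 a)"
      unfolding obs_coef_def
      by (rule sum.mono_neutral_right)
         (auto simp: Q0_def bounded_bilinear.zero_right[OF bounded_bilinear_matrix_mult])
    then show ?thesis by (simp add: Q0_def frame_coef_const[OF P0_def])
  qed
  define E where "E v = (\<Sum>k<?n. (norm (transpose (obs_coef P0 Q0 k) *v v))^2)" for v
  have pos: "E v > 0" if "v \<noteq> 0" for v
  proof (rule ccontr)
    assume "\<not> E v > 0"
    moreover have "E v \<ge> 0" unfolding E_def by (intro sum_nonneg) auto
    ultimately have "E v = 0" by simp
    then have "\<forall>k\<in>{..<?n}. (norm (transpose (obs_coef P0 Q0 k) *v v))^2 = 0"
      unfolding E_def by (subst (asm) sum_nonneg_eq_0_iff) auto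
    then have "transpose (((**) A ^^ k) B) *v v = 0" if "k < ?n" for k
      using that by (simp add: y0 linear_scale[OF bounded_linear.linear[OF bounded_linear_transpose]]
        scaleR_matrix_vector_assoc[symmetric] del: transpose_matrix_vector)
    then show False using controllable_imp_observable[OF rk] \<open>v \<noteq> 0\<close> by blast
  qed
  have "continuous_on (sphere 0 1) E"
    unfolding E_def by (intro continuous_intros matrix_vector_continuous_on)
  moreover have "E (r *\<^sub>R v) = r^2 * E v" for r v
    unfolding E_def by (simp add: matrix_vector_mult_scaleR power_mult_distrib sum_distrib_left del: transpose_matrix_vector)
  ultimately obtain \<kappa> where \<kappa>: "\<kappa> > 0" and low: "\<And>v. \<kappa> * (norm v)^2 \<le> E v"
    using homogeneous_lower_bound[of E] pos by blast
  let ?y = "\<lambda>x k. obs_coef (Pc x) (Qc x) k"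
  have lim: "((\<lambda>x. ?y x k) \<longlongrightarrow> obs_coef P0 Q0 k) F" if k: "k < ?n" for k
    unfolding obs_coef_def
  proof (intro tendsto_sum tendsto_matrix_mult tendsto_frame_coef[where m = ?n])
    show "((\<lambda>x. Pc x i) \<longlongrightarrow> P0 i) F" if "i < ?n" for i
      using P[OF that] by (simp add: P0_def)
    show "((\<lambda>x. Qc x a) \<longlongrightarrow> Q0 a) F" if "a \<in> {..k}" for a
      using Q[of a] that k by (simp add: Q0_def)
    show "k - a \<le> ?n" for a using k by simp
  qed
  have "((\<lambda>x. 2 * (\<Sum>k<?n. (norm (?y x k - obs_coef P0 Q0 k))^2)) \<longlongrightarrow> 2 * (\<Sum>k<?n. (norm (obs_coef P0 Q0 k - obs_coef P0 Q0 k))^2)) F"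
    by (intro tendsto_intros lim) auto
  then have "\<forall>\<^sub>F x in F. 2 * (\<Sum>k<?n. (norm (?y x k - obs_coef P0 Q0 k))^2) < \<kappa> / 2"
    by (rule order_tendstoD(2)) (use \<kappa> in simp)
  \<comment> \<open>The perturbation costs at most \<kappa> / 2 out of \<kappa>, and the square of a
    sum a factor 2; a quarter of \<kappa> remains.\<close>
  then have "\<forall>\<^sub>F x in F. \<forall>v. (\<kappa> / 4) * (norm v)^2 \<le> (\<Sum>k<?n. (norm (transpose (?y x k) *v v))^2)"
  proof eventually_elim
    case (elim x)
    show ?case
    proof
      fix v
      have "E v \<le> (\<Sum>k<?n. 2 * (norm (transpose (?y x k) *v v))^2 + 2 * (norm (?y x k - obs_coef P0 Q0 k))^2 * (norm v)^2)"
        unfolding E_def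
      proof (rule sum_mono)
        fix k
        let ?a = "transpose (?y x k) *v v" and ?d = "transpose (?y x k - obs_coef P0 Q0 k) *v v"
        have "transpose (obs_coef P0 Q0 k) *v v = ?a - ?d"
          by (simp add: linear_diff[OF bounded_linear.linear[OF bounded_linear_transpose]]
              bounded_bilinear.diff_left[OF bounded_bilinear_matrix_vector] del: transpose_matrix_vector)
        then have "norm (transpose (obs_coef P0 Q0 k) *v v) \<le> norm ?a + norm ?d"
          using norm_triangle_ineq4[of ?a ?d] by simp
        also have "norm ?d \<le> norm (?y x k - obs_coef P0 Q0 k) * norm v"
          using norm_matrix_vector_mult_le[of "transpose (?y x k - obs_coef P0 Q0 k)" v]
          by (simp only: norm_transpose_matrix)
        finally have "(norm (transpose (obs_coef P0 Q0 k) *v v))^2 \<le> (norm ?a + norm (?y x k - obs_coef P0 Q0 k) * norm v)^2"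
          by (intro power_mono) auto
        also have "\<dots> \<le> 2 * (norm ?a)^2 + 2 * (norm (?y x k - obs_coef P0 Q0 k) * norm v)^2"
          using sum_squares_bound[of "norm ?a" "norm (?y x k - obs_coef P0 Q0 k) * norm v"] by (simp add: power2_sum)
        finally show "(norm (transpose (obs_coef P0 Q0 k) *v v))^2 \<le>
            2 * (norm ?a)^2 + 2 * (norm (?y x k - obs_coef P0 Q0 k))^2 * (norm v)^2"
          by (simp add: power_mult_distrib mult.assoc)
      qed
      also have "\<dots> = 2 * (\<Sum>k<?n. (norm (transpose (?y x k) *v v))^2)
          + (2 * (\<Sum>k<?n. (norm (?y x k - obs_coef P0 Q0 k))^2)) * (norm v)^2"
        by (simp only: sum.distrib sum_distrib_left sum_distrib_right)
      also have "\<dots> \<le> 2 * (\<Sum>k<?n. (norm (transpose (?y x k) *v v))^2) + \<kappa> / 2 * (norm v)^2"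
        using elim by (intro add_left_mono mult_right_mono) auto
      finally show "(\<kappa> / 4) * (norm v)^2 \<le> (\<Sum>k<?n. (norm (transpose (?y x k) *v v))^2)"
        using low[of v] by (simp add: algebra_simps)
    qed
  qed
  then show ?thesis using \<kappa> by (intro exI[of _ "\<kappa> / 4"]) simp
qed

section \<open>Stabilization by the Gramian feedback\<close>

lemma continuous_on_nonneg_if_Icc:
  assumes "\<And>T::real. T \<ge> 0 \<Longrightarrow> continuous_on {0..T} f"
  shows "continuous_on {0..} f"
  unfolding continuous_on_eq_continuous_within
proof
  fix t :: real assume "t \<in> {0..}"
  then have "continuous (at t within {0..t + 1}) f"
    using assms[of "t + 1"] by (simp add: continuous_on_eq_continuous_within)
  moreover have "at t within {0..} = at t within {0..t + 1}"
    by (rule at_within_nhd[of _ "{..<t + 1}"]) (use \<open>t \<in> {0..}\<close> in auto)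
  ultimately show "continuous (at t within {0..}) f" by simp
qed

lemma has_vector_derivative_exp_substitution:
  assumes "(F has_vector_derivative D) (at (exp (- \<tau>)) within {0..})"
  shows "((\<lambda>\<tau>. F (exp (- \<tau>))) has_vector_derivative (- exp (- \<tau>)) *\<^sub>R D) (at \<tau> within S)"
proof -
  have e: "((\<lambda>\<tau>. exp (- \<tau>)) has_vector_derivative - exp (- \<tau>)) (at \<tau> within S)"
    unfolding has_real_derivative_iff_has_vector_derivative[symmetric]
    by (auto intro!: derivative_eq_intros)
  have "(F has_vector_derivative D) (at (exp (- \<tau>)) within (\<lambda>\<tau>. exp (- \<tau>)) ` S)"
    by (rule has_vector_derivative_within_subset[OF assms]) auto
  from vector_diff_chain_within[OF e this] show ?thesis by (simp add: o_def)
qed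

text \<open>Each column is the image of a unit vector, and the Frobenius norm is at most the sum of
  the norms of the columns.\<close>

lemma norm_matrix_le_if_bounded:
  fixes A :: "real^'n^'m"
  assumes "\<And>v. norm (A *v v) \<le> B * norm v"
  shows "norm A \<le> real CARD('n) * B"
proof -
  have "norm A = norm (transpose A)" by (simp add: norm_transpose_matrix)
  also have "\<dots> \<le> (\<Sum>j\<in>UNIV. norm (transpose A $ j))"
    unfolding norm_vec_def[of "transpose A"] by (rule L2_set_le_sum) simp
  also have "\<dots> \<le> (\<Sum>j\<in>(UNIV :: 'n set). B)"
  proof (rule sum_mono)
    fix j
    have "transpose A $ j = A *v axis j 1"
      by (simp add: matrix_vector_mult_basis column_def transpose_def)
    then show "norm (transpose A $ j) \<le> B"
      using assms[of "axis j 1"] by simp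
  qed
  finally show ?thesis by simp
qed

text \<open>Positivity at the vector N v - G v with N = |G| gives 0 \<le> N^2 v.Gv - 2 N |Gv|^2 +
  Gv.G(Gv), where the last term is at most N |Gv|^2. This stands in for the square root of G: |Gv|
  is bounded by the energy and |G|, without passing through |v|.\<close>

lemma psd_norm_mult_le:
  fixes G :: "real^'n^'n"
  assumes sym: "transpose G = G" and psd: "\<And>v. 0 \<le> v \<bullet> (G *v v)"
  shows "(norm (G *v v))^2 \<le> norm G * (v \<bullet> (G *v v))"
proof (cases "G *v v = 0")
  case False
  define w where "w = G *v v"
  define a where "a = w \<bullet> (G *v w)"
  define b where "b = v \<bullet> (G *v v)"
  define N where "N = norm G"
  have wv: "w \<bullet> w = w \<bullet> (G *v v)" "v \<bullet> (G *v w) = w \<bullet> w"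
    unfolding w_def by (simp, metis inner_matrix_vector_transpose sym inner_commute)
  have N: "N > 0"
  proof (rule ccontr)
    assume "\<not> N > 0"
    then have "norm G = 0" unfolding N_def using norm_ge_zero[of G] by linarith
    then show False using False by simp
  qed
  have "a \<le> norm w * norm (G *v w)" unfolding a_def by (rule norm_cauchy_schwarz)
  also have "\<dots> \<le> norm w * (N * norm w)" unfolding N_def
    by (intro mult_left_mono norm_matrix_vector_mult_le) auto
  finally have aN: "a \<le> N * (w \<bullet> w)"
    by (simp add: power2_norm_eq_inner[symmetric] power2_eq_square mult_ac)
  have "0 \<le> (N *\<^sub>R v - w) \<bullet> (G *v (N *\<^sub>R v - w))" by (rule psd)
  also have "\<dots> = N^2 * b - 2 * N * (w \<bullet> w) + a"
    unfolding matrix_vector_mult_diff_distrib matrix_vector_mult_scaleR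
    by (simp only: inner_diff_left inner_diff_right inner_scaleR_left inner_scaleR_right
        wv(2) wv(1)[symmetric] a_def b_def power2_eq_square) (simp add: algebra_simps)
  finally have "N * (w \<bullet> w) \<le> N * (N * b)" using aN by (simp add: power2_eq_square algebra_simps)
  then show ?thesis using N unfolding w_def b_def N_def power2_norm_eq_inner by simp
qed simp

text \<open>The unknown is v instead of c = \<open>Lc\<close> v: in the coordinates v the linear
  part of the closed loop disappears, and only the remainder drives the motion.\<close>

lemma feedback_ode_exists:
  fixes H :: "real \<Rightarrow> real^'n^'n" and Lc :: "real \<Rightarrow> real^'n^'n" and Ld :: "real \<Rightarrow> real^'n^'r"
    and R :: "real \<Rightarrow> real^'n \<Rightarrow> real^'r \<Rightarrow> real^'n"
  assumes H: "continuous_on {0..} H" and Lc: "continuous_on {0..} Lc" and Ld: "continuous_on {0..} Ld"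
    and R: "continuous_on ({0..} \<times> UNIV) (\<lambda>(\<tau>, p). R \<tau> (fst p) (snd p))"
    and lip: "\<And>\<tau> c d c' d'. \<tau> \<ge> 0 \<Longrightarrow> norm (R \<tau> c d - R \<tau> c' d') \<le> L * (norm (c - c') + norm (d - d'))"
  shows "\<exists>v. v 0 = v0 \<and> (\<forall>\<tau>\<ge>0. (v has_vector_derivative
    H \<tau> *v R \<tau> (Lc \<tau> *v v \<tau>) (Ld \<tau> *v v \<tau>)) (at \<tau> within {0..}))"
proof (rule picard_global)
  have fst': "continuous_on ({0..} \<times> UNIV) (\<lambda>p. A (fst p))" if "continuous_on {0..} A"
    for A :: "real \<Rightarrow> 'z::topological_space"
    by (rule continuous_on_compose2[OF that]) (auto intro!: continuous_intros)
  have "continuous_on ({0..} \<times> UNIV) (\<lambda>p. (\<lambda>(\<tau>, p). R \<tau> (fst p) (snd p)) (fst p, (Lc (fst p) *v snd p, Ld (fst p) *v snd p)))"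
    by (rule continuous_on_compose2[OF R])
       (auto intro!: continuous_intros matrix_vector_continuous_on fst' Lc Ld)
  then show "continuous_on ({0..} \<times> UNIV) (\<lambda>(\<tau>, v). H \<tau> *v R \<tau> (Lc \<tau> *v v) (Ld \<tau> *v v))"
    unfolding case_prod_beta by (intro matrix_vector_continuous_on fst' H) simp
  fix T :: real assume "T \<ge> 0"
  obtain BH where BH: "BH \<ge> 0" "\<forall>t\<in>{0..T}. norm (H t) \<le> BH" using continuous_on_nonneg_bounded[OF H] by blast
  obtain Bc where Bc: "Bc \<ge> 0" "\<forall>t\<in>{0..T}. norm (Lc t) \<le> Bc" using continuous_on_nonneg_bounded[OF Lc] by blast
  obtain Bd where Bd: "Bd \<ge> 0" "\<forall>t\<in>{0..T}. norm (Ld t) \<le> Bd" using continuous_on_nonneg_bounded[OF Ld] by blast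
  have L0: "max L 0 \<ge> 0" by simp
  have "norm (H t *v R t (Lc t *v v) (Ld t *v v) - H t *v R t (Lc t *v w) (Ld t *v w)) \<le>
      BH * (max L 0 * (Bc + Bd)) * norm (v - w)" if t: "t \<in> {0..T}" for t v w
  proof -
    let ?D = "R t (Lc t *v v) (Ld t *v v) - R t (Lc t *v w) (Ld t *v w)"
    have "norm (Lc t *v v - Lc t *v w) \<le> Bc * norm (v - w)"
      using order_trans[OF norm_matrix_vector_mult_le[of "Lc t" "v - w"] mult_right_mono[OF Bc(2)[rule_format, OF t]]]
      by (simp add: matrix_vector_mult_diff_distrib)
    moreover have "norm (Ld t *v v - Ld t *v w) \<le> Bd * norm (v - w)"
      using order_trans[OF norm_matrix_vector_mult_le[of "Ld t" "v - w"] mult_right_mono[OF Bd(2)[rule_format, OF t]]]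
      by (simp add: matrix_vector_mult_diff_distrib)
    ultimately have s: "norm (Lc t *v v - Lc t *v w) + norm (Ld t *v v - Ld t *v w) \<le> (Bc + Bd) * norm (v - w)"
      by (simp add: distrib_right)
    have "norm ?D \<le> L * (norm (Lc t *v v - Lc t *v w) + norm (Ld t *v v - Ld t *v w))"
      using t by (intro lip) auto
    also have "\<dots> \<le> max L 0 * (norm (Lc t *v v - Lc t *v w) + norm (Ld t *v v - Ld t *v w))"
      by (intro mult_right_mono) auto
    also have "\<dots> \<le> max L 0 * ((Bc + Bd) * norm (v - w))"
      using s by (intro mult_left_mono) auto
    finally have D: "norm ?D \<le> max L 0 * ((Bc + Bd) * norm (v - w))" .
    have "norm (H t *v ?D) \<le> norm (H t) * norm ?D" by (rule norm_matrix_vector_mult_le)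
    also have "\<dots> \<le> BH * (max L 0 * ((Bc + Bd) * norm (v - w)))"
      using BH t D by (intro mult_mono) auto
    finally show ?thesis by (simp add: matrix_vector_mult_diff_distrib mult.assoc)
  qed
  then show "\<exists>L'. \<forall>t\<in>{0..T}. \<forall>v w. norm (H t *v R t (Lc t *v v) (Ld t *v v) - H t *v R t (Lc t *v w) (Ld t *v w)) \<le> L' * norm (v - w)"
    by blast
qed

text \<open>The exponents \<open>q\<close> and \<open>m\<close> stay free, as stabilization works
  for any of them; their values matter only in the nonlinear estimate. The bounds are asked for on
  [0, 1], the range of s = exp (- \<tau>).\<close>

locale gram_feedback =
  fixes P :: "real \<Rightarrow> real^'n^'n" and Q :: "real \<Rightarrow> real^'r^'n" and U V :: "real \<Rightarrow> real^'n^'n"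
    and C \<kappa> :: real and q m :: nat
  assumes fr: "ode_frame P U V"
    and contP: "continuous_on {0..} P" and contQ: "continuous_on {0..} Q"
    and U_le: "s \<in> {0..1} \<Longrightarrow> norm (U s) \<le> C" and V_le: "s \<in> {0..1} \<Longrightarrow> norm (V s) \<le> C"
    and Y_le: "s \<in> {0..1} \<Longrightarrow> norm (U s ** Q s) \<le> C"
    and kappa: "\<kappa> > 0"
    and lower: "s \<in> {0..1} \<Longrightarrow> \<kappa> * s ^ m * (norm v)^2 \<le> v \<bullet> (gram q (\<lambda>s. U s ** Q s) s *v v)"
begin

definition Y :: "real \<Rightarrow> real^'r^'n" where "Y s = U s ** Q s"
definition G :: "real \<Rightarrow> real^'n^'n" where "G = gram q Y"

text \<open>With y = U c the linear system becomes dy/ds = - Y d. Taking d = - s^q Y^T v with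
  constant v gives dy/ds = G'(s) v, so y = G v is a solution, and it vanishes at s = 0. Eliminating
  v = G^(-1) U c yields the feedback.\<close>

definition feedback :: "real \<Rightarrow> real^'n^'r" where
  "feedback \<tau> = - (exp (- \<tau>) ^ q *\<^sub>R (transpose (Y (exp (- \<tau>))) ** matrix_inv (G (exp (- \<tau>))) ** U (exp (- \<tau>))))"

lemma G_lower: "s \<in> {0..1} \<Longrightarrow> \<kappa> * s ^ m * (norm v)^2 \<le> v \<bullet> (G s *v v)"
  using lower[of s v] unfolding G_def Y_def [abs_def] .

lemma continuous_on_Y: "continuous_on {0..} Y"
  unfolding Y_def [abs_def] by (intro matrix_mult_continuous_on continuous_on_frame[OF fr] contQ)

lemma C_nonneg: "C \<ge> 0"
  using order_trans[OF norm_ge_zero U_le[of 0]] by simp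

lemma norm_Y_le: "s \<in> {0..1} \<Longrightarrow> norm (Y s) \<le> C"
  using Y_le by (simp add: Y_def)

lemma norm_G_le: "s \<in> {0..1} \<Longrightarrow> norm (G s) \<le> C^2 * s ^ (q + 1)"
  unfolding G_def by (rule norm_gram_le[OF continuous_on_Y norm_Y_le])

lemma transpose_G: "transpose (G s) = G s"
  unfolding G_def by (rule transpose_gram[OF continuous_on_Y])

lemma G_derivative: "s \<ge> 0 \<Longrightarrow> (G has_vector_derivative s ^ q *\<^sub>R (Y s ** transpose (Y s))) (at s within {0..})"
  unfolding G_def by (rule gram_has_vector_derivative[OF continuous_on_Y])

lemma continuous_on_G: "continuous_on {0..} G"
  using G_derivative by (intro continuous_on_vector_derivative) auto

lemma norm_G_mult_ge:
  assumes "s \<in> {0..1}"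
  shows "\<kappa> * s ^ m * norm v \<le> norm (G s *v v)"
proof (cases "v = 0")
  case False
  have "\<kappa> * s ^ m * (norm v)^2 \<le> v \<bullet> (G s *v v)" by (rule G_lower[OF assms])
  also have "\<dots> \<le> norm v * norm (G s *v v)" by (rule norm_cauchy_schwarz)
  finally have "norm v * (\<kappa> * s ^ m * norm v) \<le> norm v * norm (G s *v v)"
    by (simp add: power2_eq_square mult_ac)
  then show ?thesis using False by simp
qed simp

text \<open>The lower bound makes the kernel trivial, but only for s > 0, as the Gramian vanishes at
  s = 0. The points exp (- \<tau>) never reach 0.\<close>

lemma G_inverse:
  assumes s: "s \<in> {0<..1}"
  shows "G s ** matrix_inv (G s) = mat 1" "matrix_inv (G s) ** G s = mat 1"
proof -
  have "v = 0" if "G s *v v = 0" for v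
  proof -
    have "\<kappa> * s ^ m * norm v \<le> 0" using norm_G_mult_ge[of s v] s that by simp
    moreover have "\<kappa> * s ^ m > 0" using kappa s by simp
    ultimately have "\<not> norm v > 0" using mult_pos_pos[of "\<kappa> * s ^ m" "norm v"] by linarith
    then show ?thesis by simp
  qed
  then have "\<exists>B. B ** G s = mat 1" using matrix_left_invertible_ker[of "G s"] by blast
  then have "invertible (G s)" by (simp add: invertible_left_inverse)
  then have "G s ** matrix_inv (G s) = mat 1 \<and> matrix_inv (G s) ** G s = mat 1"
    unfolding invertible_def matrix_inv_def by (rule someI_ex)
  then show "G s ** matrix_inv (G s) = mat 1" "matrix_inv (G s) ** G s = mat 1" by auto
qed

lemma norm_G_inverse_mult_le:
  assumes s: "s \<in> {0<..1}"
  shows "norm (matrix_inv (G s) *v w) \<le> (1 / (\<kappa> * s ^ m)) * norm w"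
proof -
  have "\<kappa> * s ^ m * norm (matrix_inv (G s) *v w) \<le> norm (G s *v (matrix_inv (G s) *v w))"
    using s by (intro norm_G_mult_ge) auto
  also have "G s *v (matrix_inv (G s) *v w) = w"
    by (simp add: matrix_vector_mul_assoc G_inverse[OF s])
  finally show ?thesis using kappa s by (simp add: field_simps)
qed

lemma exp_in_unit: "\<tau> \<ge> 0 \<Longrightarrow> exp (- \<tau>) \<in> {0<..1::real}" by simp

lemma continuous_on_exp_compose: "continuous_on {0..} F \<Longrightarrow> continuous_on {0..} (\<lambda>\<tau>::real. F (exp (- \<tau>)))"
  by (rule continuous_on_compose2[of "{0..}" F]) (auto intro!: continuous_intros)

text \<open>On [0, T] the inverses are bounded because exp (- \<tau>) \<ge> exp (- T); continuity
  then follows from A^(-1) - B^(-1) = - A^(-1) (A - B) B^(-1). The bound degenerates as T grows,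
  hence the passage through compact intervals.\<close>

lemma continuous_on_G_inverse: "continuous_on {0..} (\<lambda>\<tau>. matrix_inv (G (exp (- \<tau>))))"
proof (rule continuous_on_nonneg_if_Icc)
  fix T :: real assume T: "T \<ge> 0"
  define K where "K = real CARD('n) * (1 / (\<kappa> * exp (- T) ^ m))"
  have K: "K \<ge> 0" using kappa by (simp add: K_def)
  have b: "norm (matrix_inv (G (exp (- t)))) \<le> K" if t: "t \<in> {0..T}" for t
    unfolding K_def
  proof (rule norm_matrix_le_if_bounded)
    fix v :: "real^'n"
    have "exp (- T) ^ m \<le> exp (- t) ^ m" using t by (intro power_mono) auto
    then have "1 / (\<kappa> * exp (- t) ^ m) \<le> 1 / (\<kappa> * exp (- T) ^ m)"
      using kappa by (intro divide_left_mono mult_left_mono mult_pos_pos) auto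
    then have "(1 / (\<kappa> * exp (- t) ^ m)) * norm v \<le> (1 / (\<kappa> * exp (- T) ^ m)) * norm v"
      by (rule mult_right_mono) simp
    then show "norm (matrix_inv (G (exp (- t))) *v v) \<le> (1 / (\<kappa> * exp (- T) ^ m)) * norm v"
      using norm_G_inverse_mult_le[OF exp_in_unit, of t v] t by simp
  qed
  show "continuous_on {0..T} (\<lambda>\<tau>. matrix_inv (G (exp (- \<tau>))))"
    unfolding continuous_on_def
  proof
    fix t assume t: "t \<in> {0..T}"
    let ?Gi = "\<lambda>\<tau>. matrix_inv (G (exp (- \<tau>)))" and ?g = "\<lambda>\<tau>. G (exp (- \<tau>))"
    have "continuous_on {0..T} ?g"
      by (rule continuous_on_subset[OF continuous_on_exp_compose[OF continuous_on_G]]) auto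
    then have "(?g \<longlongrightarrow> ?g t) (at t within {0..T})"
      using t by (simp add: continuous_on_def)
    then have "((\<lambda>r. K * norm (?g r - ?g t) * K) \<longlongrightarrow> K * norm (?g t - ?g t) * K) (at t within {0..T})"
      by (intro tendsto_intros)
    then have z: "((\<lambda>r. K * norm (?g r - ?g t) * K) \<longlongrightarrow> 0) (at t within {0..T})" by simp
    have "((\<lambda>r. ?Gi r - ?Gi t) \<longlongrightarrow> 0) (at t within {0..T})"
    proof (rule Lim_null_comparison[OF _ z])
      have "norm (?Gi r - ?Gi t) \<le> K * norm (?g r - ?g t) * K" if r: "r \<in> {0..T}" for r
      proof -
        have ir: "?Gi r ** ?g r = mat 1" and it: "?g t ** ?Gi t = mat 1"
          using G_inverse[OF exp_in_unit, of r] G_inverse[OF exp_in_unit, of t] r t by auto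
        have "?Gi r ** (?g r - ?g t) ** ?Gi t = (?Gi r ** ?g r) ** ?Gi t - ?Gi r ** (?g t ** ?Gi t)"
          by (simp only: bounded_bilinear.diff_right[OF bounded_bilinear_matrix_mult]
              bounded_bilinear.diff_left[OF bounded_bilinear_matrix_mult] matrix_mul_assoc)
        then have "?Gi r - ?Gi t = - (?Gi r ** (?g r - ?g t) ** ?Gi t)"
          by (simp add: ir it)
        then have "norm (?Gi r - ?Gi t) \<le> norm (?Gi r ** (?g r - ?g t)) * norm (?Gi t)"
          using norm_matrix_mult_le[of "?Gi r ** (?g r - ?g t)" "?Gi t"] by simp
        also have "\<dots> \<le> (norm (?Gi r) * norm (?g r - ?g t)) * norm (?Gi t)"
          by (intro mult_right_mono norm_matrix_mult_le) auto
        also have "\<dots> \<le> K * norm (?g r - ?g t) * K"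
          using b[OF r] b[OF t] K by (intro mult_mono) auto
        finally show ?thesis .
      qed
      then show "\<forall>\<^sub>F r in at t within {0..T}. norm (?Gi r - ?Gi t) \<le> K * norm (?g r - ?g t) * K"
        by (auto simp: eventually_at_filter)
    qed
    then show "(?Gi \<longlongrightarrow> ?Gi t) (at t within {0..T})" by (rule Lim_null[THEN iffD2])
  qed
qed

lemma continuous_on_feedback: "continuous_on {0..} feedback"
  unfolding feedback_def [abs_def]
  by (intro continuous_on_minus continuous_on_scaleR continuous_on_power matrix_mult_continuous_on
      bounded_linear.continuous_on[OF bounded_linear_transpose] continuous_on_G_inverse
      continuous_on_exp_compose continuous_on_Y continuous_on_frame[OF fr] continuous_intros)

lemma frame_inverse: "s \<ge> 0 \<Longrightarrow> U s ** V s = mat 1" "s \<ge> 0 \<Longrightarrow> V s ** U s = mat 1"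
  using fr by (auto simp: ode_frame_def)

lemma Q_eq: "s \<ge> 0 \<Longrightarrow> V s ** Y s = Q s"
  unfolding Y_def by (simp add: matrix_mul_assoc frame_inverse)

lemma VG_derivative:
  assumes "s \<ge> 0"
  shows "((\<lambda>s. V s ** G s) has_vector_derivative
    s ^ q *\<^sub>R (Q s ** transpose (Y s)) - P s ** (V s ** G s)) (at s within {0..})"
proof -
  have "((\<lambda>s. V s ** G s) has_vector_derivative
      V s ** (s ^ q *\<^sub>R (Y s ** transpose (Y s))) + (- (P s ** V s)) ** G s) (at s within {0..})"
    using fr assms by (intro matrix_mult_has_vector_derivative G_derivative) (auto simp: ode_frame_def)
  moreover have "V s ** (s ^ q *\<^sub>R (Y s ** transpose (Y s))) = s ^ q *\<^sub>R (Q s ** transpose (Y s))"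
    by (simp only: bounded_bilinear.scaleR_right[OF bounded_bilinear_matrix_mult] matrix_mul_assoc Q_eq[OF assms])
  moreover have "(- (P s ** V s)) ** G s = - (P s ** (V s ** G s))"
    by (simp only: bounded_bilinear.minus_left[OF bounded_bilinear_matrix_mult] matrix_mul_assoc)
  ultimately show ?thesis by simp
qed

text \<open>On vectors c = V G v the inverse Gramian cancels. This is why d can be estimated
  although the gain may be unbounded.\<close>

lemma feedback_VG:
  assumes "\<tau> \<ge> 0"
  shows "feedback \<tau> ** (V (exp (- \<tau>)) ** G (exp (- \<tau>))) = - (exp (- \<tau>) ^ q *\<^sub>R transpose (Y (exp (- \<tau>))))"
proof -
  let ?s = "exp (- \<tau>)"
  have "transpose (Y ?s) ** matrix_inv (G ?s) ** U ?s ** (V ?s ** G ?s) =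
      transpose (Y ?s) ** (matrix_inv (G ?s) ** ((U ?s ** V ?s) ** G ?s))"
    by (simp only: matrix_mul_assoc)
  also have "\<dots> = transpose (Y ?s)"
    using G_inverse[OF exp_in_unit[OF assms]] by (simp add: frame_inverse)
  finally show ?thesis
    unfolding feedback_def
    by (simp only: bounded_bilinear.minus_left[OF bounded_bilinear_matrix_mult]
        bounded_bilinear.scaleR_left[OF bounded_bilinear_matrix_mult])
qed

lemma VG_derivative_tau:
  assumes "\<tau> \<ge> 0"
  shows "((\<lambda>\<tau>. V (exp (- \<tau>)) ** G (exp (- \<tau>))) has_vector_derivative
    (exp (- \<tau>) *\<^sub>R P (exp (- \<tau>)) + (exp (- \<tau>) *\<^sub>R Q (exp (- \<tau>))) ** feedback \<tau>) ** (V (exp (- \<tau>)) ** G (exp (- \<tau>))))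
    (at \<tau> within {0..})"
proof -
  let ?s = "exp (- \<tau>)"
  have "(exp (- \<tau>) *\<^sub>R P ?s + (?s *\<^sub>R Q ?s) ** feedback \<tau>) ** (V ?s ** G ?s) =
      ?s *\<^sub>R (P ?s ** (V ?s ** G ?s)) + ?s *\<^sub>R (Q ?s ** (feedback \<tau> ** (V ?s ** G ?s)))"
    by (simp only: bounded_bilinear.add_left[OF bounded_bilinear_matrix_mult]
        bounded_bilinear.scaleR_left[OF bounded_bilinear_matrix_mult] matrix_mul_assoc)
  also have "\<dots> = (- ?s) *\<^sub>R (?s ^ q *\<^sub>R (Q ?s ** transpose (Y ?s)) - P ?s ** (V ?s ** G ?s))"
    unfolding feedback_VG[OF assms]
    by (simp add: bounded_bilinear.minus_right[OF bounded_bilinear_matrix_mult]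
        bounded_bilinear.scaleR_right[OF bounded_bilinear_matrix_mult] algebra_simps)
  finally show ?thesis
    using has_vector_derivative_exp_substitution[OF VG_derivative, of \<tau> "{0..}"] by simp
qed

lemma stabilizing:
  "stabilizing_feedback (\<lambda>\<tau>. exp (- \<tau>) *\<^sub>R P (exp (- \<tau>))) (\<lambda>\<tau>. exp (- \<tau>) *\<^sub>R Q (exp (- \<tau>))) feedback"
  unfolding stabilizing_feedback_def
proof (intro conjI continuous_on_feedback)
  let ?D = "matrix_inv (G 1) ** U 1"
  \<comment> \<open>V G consists of solutions of the closed loop, and the constant factor normalises
    it at \<tau> = 0, that is, at s = 1. The decay comes from |G| = O(s^(q+1)), which is at most
    O(s).\<close>
  let ?\<Psi> = "\<lambda>\<tau>. (V (exp (- \<tau>)) ** G (exp (- \<tau>))) ** ?D"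
  have "?\<Psi> 0 = V 1 ** (G 1 ** matrix_inv (G 1)) ** U 1" by (simp add: matrix_mul_assoc)
  also have "\<dots> = mat 1" using G_inverse[of 1] by (simp add: frame_inverse)
  finally have 0: "?\<Psi> 0 = mat 1" .
  have der: "(?\<Psi> has_vector_derivative (exp (- \<tau>) *\<^sub>R P (exp (- \<tau>)) + (exp (- \<tau>) *\<^sub>R Q (exp (- \<tau>))) ** feedback \<tau>) ** ?\<Psi> \<tau>)
      (at \<tau> within {0..})" if "\<tau> \<ge> 0" for \<tau>
    using matrix_mult_has_vector_derivative[OF VG_derivative_tau[OF that] has_vector_derivative_const[of ?D]]
    by (simp add: bounded_bilinear.zero_right[OF bounded_bilinear_matrix_mult] matrix_mul_assoc)
  define K where "K = C * C^2 * norm ?D + 1"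
  have K: "K > 0" using C_nonneg by (simp add: K_def add_nonneg_pos)
  have "norm (?\<Psi> \<tau>) \<le> K * exp (- 1 * \<tau>)" if "\<tau> \<ge> 0" for \<tau>
  proof -
    let ?s = "exp (- \<tau>)"
    have s: "?s \<in> {0..1}" using that by simp
    have "norm (V ?s ** G ?s) \<le> norm (V ?s) * norm (G ?s)" by (rule norm_matrix_mult_le)
    also have "\<dots> \<le> C * (C^2 * ?s ^ (q + 1))"
      using V_le[OF s] norm_G_le[OF s] C_nonneg by (intro mult_mono) auto
    also have "\<dots> \<le> C * (C^2 * ?s)"
      using C_nonneg s power_decreasing[of 1 "q + 1" ?s] by (intro mult_left_mono) auto
    finally have "norm (V ?s ** G ?s) * norm ?D \<le> C * (C^2 * ?s) * norm ?D"
      by (rule mult_right_mono) simp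
    also have "\<dots> \<le> K * ?s" by (simp add: K_def algebra_simps)
    finally show ?thesis
      using norm_matrix_mult_le[of "V ?s ** G ?s" ?D] by simp
  qed
  with 0 der K show "\<exists>\<Psi>. \<Psi> 0 = mat 1 \<and> (\<forall>\<tau>\<ge>0. (\<Psi> has_vector_derivative
      (exp (- \<tau>) *\<^sub>R P (exp (- \<tau>)) + (exp (- \<tau>) *\<^sub>R Q (exp (- \<tau>))) ** feedback \<tau>) ** \<Psi> \<tau>) (at \<tau> within {0..})) \<and>
      (\<exists>K>0. \<exists>\<mu>>0. \<forall>\<tau>\<ge>0. norm (\<Psi> \<tau>) \<le> K * exp (- \<mu> * \<tau>))"
    by (intro exI[of _ ?\<Psi>] conjI allI impI exI[of _ K] exI[of _ 1]) auto
qed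

end

section \<open>Energy estimate for the nonlinear closed loop\<close>

context gram_feedback
begin

text \<open>The lower bound on the Gramian controls |v|, the upper one controls |G v| through
  \<open>psd_norm_mult_le\<close>, and d is estimated through |v|. With q = 6n - 3 one has m = 2 (4n
  - 2) and q + 1 = 2 (3n - 1), so the square roots are integral powers of s.\<close>

lemma state_bounds:
  assumes s: "s \<in> {0..1}" and q: "q = 6 * CARD('n) - 3" and m: "m = q + 1 + 2 * (CARD('n) - 1)"
    and W: "W = v \<bullet> (G s *v v)"
  shows "W \<ge> 0"
    and "s ^ (4 * CARD('n) - 2) * norm v \<le> (1 / sqrt \<kappa>) * sqrt W"
    and "norm ((V s ** G s) *v v) \<le> C^2 * s ^ (3 * CARD('n) - 1) * sqrt W"
    and "norm ((s ^ q *\<^sub>R transpose (Y s)) *v v) \<le> (C / sqrt \<kappa>) * s ^ (2 * CARD('n) - 1) * sqrt W"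
proof -
  let ?n = "CARD('n)"
  have n: "?n \<ge> 1" using one_le_card_finite[where 'a = 'n] by simp
  have psd: "0 \<le> v \<bullet> (G s *v v)" for v
  proof -
    have "0 \<le> \<kappa> * s ^ m * (norm v)^2" using kappa s by simp
    then show ?thesis using G_lower[OF s, of v] by linarith
  qed
  then show W0: "W \<ge> 0" using W by simp
  have m2: "m = 2 * (4 * ?n - 2)" using m q n by linarith
  have "(sqrt \<kappa> * (s ^ (4 * ?n - 2) * norm v))^2 = \<kappa> * s ^ m * (norm v)^2"
    unfolding m2 using kappa by (simp add: power_mult_distrib power_even_eq)
  also have "\<dots> \<le> W" unfolding W by (rule G_lower[OF s])
  finally have "sqrt \<kappa> * (s ^ (4 * ?n - 2) * norm v) \<le> sqrt W" by (rule real_le_rsqrt)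
  then show x: "s ^ (4 * ?n - 2) * norm v \<le> (1 / sqrt \<kappa>) * sqrt W"
    using kappa by (simp add: field_simps)
  have "(norm (G s *v v))^2 \<le> norm (G s) * W"
    unfolding W by (rule psd_norm_mult_le[OF transpose_G psd])
  also have "\<dots> \<le> (C^2 * s ^ (q + 1)) * W"
    using norm_G_le[OF s] W0 by (rule mult_right_mono)
  also have "\<dots> = (C * s ^ (3 * ?n - 1) * sqrt W)^2"
  proof -
    have "q + 1 = 2 * (3 * ?n - 1)" using q n by linarith
    then show ?thesis using W0 by (simp add: power_mult_distrib power_even_eq)
  qed
  finally have Gv: "norm (G s *v v) \<le> C * s ^ (3 * ?n - 1) * sqrt W"
    by (rule power2_le_imp_le) (use C_nonneg s W0 in simp)
  have "norm ((V s ** G s) *v v) \<le> norm (V s) * norm (G s *v v)"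
    unfolding matrix_vector_mul_assoc[symmetric] by (rule norm_matrix_vector_mult_le)
  also have "\<dots> \<le> C * (C * s ^ (3 * ?n - 1) * sqrt W)"
    using V_le[OF s] Gv C_nonneg by (intro mult_mono) auto
  finally show "norm ((V s ** G s) *v v) \<le> C^2 * s ^ (3 * ?n - 1) * sqrt W"
    by (simp add: power2_eq_square mult_ac)
  have "norm ((s ^ q *\<^sub>R transpose (Y s)) *v v) = s ^ q * norm (transpose (Y s) *v v)"
    unfolding scaleR_matrix_vector_assoc[symmetric] norm_scaleR using s by simp
  also have "\<dots> \<le> s ^ q * (C * norm v)"
  proof -
    have "norm (transpose (Y s) *v v) \<le> norm (Y s) * norm v"
      using norm_matrix_vector_mult_le[of "transpose (Y s)" v] by (simp only: norm_transpose_matrix)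
    also have "\<dots> \<le> C * norm v" using norm_Y_le[OF s] by (rule mult_right_mono) simp
    finally show ?thesis using s by (intro mult_left_mono) auto
  qed
  also have "\<dots> = C * s ^ (2 * ?n - 1) * (s ^ (4 * ?n - 2) * norm v)"
  proof -
    have "q = (2 * ?n - 1) + (4 * ?n - 2)" using q n by linarith
    then show ?thesis by (simp only: power_add mult_ac)
  qed
  also have "\<dots> \<le> C * s ^ (2 * ?n - 1) * ((1 / sqrt \<kappa>) * sqrt W)"
    using x C_nonneg s by (intro mult_left_mono) auto
  finally show "norm ((s ^ q *\<^sub>R transpose (Y s)) *v v) \<le> (C / sqrt \<kappa>) * s ^ (2 * ?n - 1) * sqrt W"
    by (simp add: mult_ac)
qed

text \<open>Once s^(4n-2) is moved from the remainder to v, which thereby becomes O(sqrt W), the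
  first three terms keep a factor s^2 and the quadratic one a factor s. The condition W \<le> 1
  serves the quadratic term alone, which is cubic in sqrt W; the product e sqrt W is absorbed by W +
  e^2.\<close>

lemma dissipation_bound:
  assumes s: "s \<in> {0..1}" and q: "q = 6 * CARD('n) - 3" and m: "m = q + 1 + 2 * (CARD('n) - 1)"
    and W: "W = v \<bullet> (G s *v v)" "W \<le> 1" and D: "D \<ge> 0" and e: "e \<ge> 0"
    and c: "c = (V s ** G s) *v v" and d: "norm d = norm ((s ^ q *\<^sub>R transpose (Y s)) *v v)"
    and r: "norm r \<le> D * (s ^ (4 * CARD('n)) * e + s ^ (CARD('n) + 1) * norm c
       + s ^ (2 * CARD('n) + 1) * norm d + s * (norm c + norm d)^2)"
    and a: "a1 = C^2" "a2 = C / sqrt \<kappa>" "a3 = 1 / sqrt \<kappa>"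
  shows "2 * (v \<bullet> (U s *v r)) \<le> 2 * C * D * a3 * (1 + a1 + a2 + (a1 + a2)^2) * s * (W + e^2)"
proof -
  let ?n = "CARD('n)"
  have n: "?n \<ge> 1" using one_le_card_finite[where 'a = 'n] by simp
  note sb = state_bounds[OF s q m W(1)]
  define w where "w = sqrt W"
  define x where "x = s ^ (4 * ?n - 2) * norm v"
  have a0: "a1 \<ge> 0" "a2 \<ge> 0" "a3 \<ge> 0" using a C_nonneg kappa by auto
  have s0: "0 \<le> s" "s \<le> 1" using s by auto
  have w: "w \<ge> 0" "w \<le> 1" "w^2 = W" using sb(1) W(2) by (auto simp: w_def)
  have x: "0 \<le> x" "x \<le> a3 * w" using sb(2) s0 by (auto simp: x_def w_def a)
  have cb: "norm c \<le> a1 * s ^ (3 * ?n - 1) * w" using sb(3) by (simp add: c w_def a)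
  have db: "norm d \<le> a2 * s ^ (2 * ?n - 1) * w" using sb(4) by (simp add: d w_def a)
  have ss: "s * s \<le> s" using s0 by (simp add: mult_left_le_one_le)
  have we: "w * e \<le> W + e^2"
    using sum_squares_bound[of w e] mult_nonneg_nonneg[OF w(1) e] unfolding w(3) by linarith
  have We: "W \<le> W + e^2" "0 \<le> W + e^2" using sb(1) by auto
  have T1: "norm v * (s ^ (4 * ?n) * e) \<le> a3 * (s * (W + e^2))"
  proof -
    have p: "s ^ (4 * ?n) = s * s * s ^ (4 * ?n - 2)"
    proof -
      have "4 * ?n = Suc (Suc (4 * ?n - 2))" using n by linarith
      then have "s ^ (4 * ?n) = s ^ Suc (Suc (4 * ?n - 2))" by simp
      then show ?thesis by (simp only: power_Suc mult.assoc)
    qed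
    have "norm v * (s ^ (4 * ?n) * e) = (s * s) * (x * e)" unfolding p x_def by (simp add: mult_ac)
    also have "\<dots> \<le> s * ((a3 * w) * e)"
      using ss x s0 e by (intro mult_mono mult_right_mono) auto
    also have "\<dots> = a3 * (s * (w * e))" by (simp add: mult_ac)
    also have "\<dots> \<le> a3 * (s * (W + e^2))" using we a0 s0 by (intro mult_left_mono) auto
    finally show ?thesis .
  qed
  have X: "x * w \<le> a3 * (W + e^2)"
  proof -
    have "x * w \<le> (a3 * w) * w" using x w by (intro mult_right_mono) auto
    also have "\<dots> = a3 * W" using w(3) by (simp add: power2_eq_square)
    also have "\<dots> \<le> a3 * (W + e^2)" using We a0 by (intro mult_left_mono) auto
    finally show ?thesis .
  qed
  have mono4: "norm v * (s ^ (4 * ?n)) = (s * s) * x"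
  proof -
    have "4 * ?n = Suc (Suc (4 * ?n - 2))" using n by linarith
    then have "s ^ (4 * ?n) = s ^ Suc (Suc (4 * ?n - 2))" by simp
    then show ?thesis by (simp add: x_def mult_ac)
  qed
  have T2: "norm v * (s ^ (?n + 1) * norm c) \<le> a1 * a3 * (s * (W + e^2))"
  proof -
    have "norm v * (s ^ (?n + 1) * norm c) \<le> norm v * (s ^ (?n + 1) * (a1 * s ^ (3 * ?n - 1) * w))"
      using cb s0 by (intro mult_left_mono) auto
    also have "\<dots> = a1 * ((norm v * (s ^ (?n + 1) * s ^ (3 * ?n - 1))) * w)" by (simp add: mult_ac)
    also have "s ^ (?n + 1) * s ^ (3 * ?n - 1) = s ^ (4 * ?n)"
      unfolding power_add[symmetric] using n by (intro arg_cong[where f = "power s"]) linarith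
    also have "a1 * ((norm v * s ^ (4 * ?n)) * w) = a1 * ((s * s) * (x * w))" unfolding mono4 by (simp add: mult_ac)
    also have "\<dots> \<le> a1 * (s * (a3 * (W + e^2)))"
      by (rule mult_left_mono[OF mult_mono[OF ss X]]) (use x w s0 a0 in auto)
    finally show ?thesis by (simp add: mult_ac)
  qed
  have T3: "norm v * (s ^ (2 * ?n + 1) * norm d) \<le> a2 * a3 * (s * (W + e^2))"
  proof -
    have "norm v * (s ^ (2 * ?n + 1) * norm d) \<le> norm v * (s ^ (2 * ?n + 1) * (a2 * s ^ (2 * ?n - 1) * w))"
      using db s0 by (intro mult_left_mono) auto
    also have "\<dots> = a2 * ((norm v * (s ^ (2 * ?n + 1) * s ^ (2 * ?n - 1))) * w)" by (simp add: mult_ac)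
    also have "s ^ (2 * ?n + 1) * s ^ (2 * ?n - 1) = s ^ (4 * ?n)"
      unfolding power_add[symmetric] using n by (intro arg_cong[where f = "power s"]) linarith
    also have "a2 * ((norm v * s ^ (4 * ?n)) * w) = a2 * ((s * s) * (x * w))" unfolding mono4 by (simp add: mult_ac)
    also have "\<dots> \<le> a2 * (s * (a3 * (W + e^2)))"
      by (rule mult_left_mono[OF mult_mono[OF ss X]]) (use x w s0 a0 in auto)
    finally show ?thesis by (simp add: mult_ac)
  qed
  have T4: "norm v * (s * (norm c + norm d)^2) \<le> (a1 + a2)^2 * a3 * (s * (W + e^2))"
  proof -
    have "s ^ (3 * ?n - 1) \<le> s ^ (2 * ?n - 1)" using s0 by (intro power_decreasing) auto
    then have "a1 * s ^ (3 * ?n - 1) * w \<le> a1 * s ^ (2 * ?n - 1) * w"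
      using a0 w by (intro mult_right_mono mult_left_mono) auto
    then have "norm c + norm d \<le> (a1 + a2) * s ^ (2 * ?n - 1) * w"
      using cb db by (simp add: distrib_right)
    then have "(norm c + norm d)^2 \<le> ((a1 + a2) * s ^ (2 * ?n - 1) * w)^2" by (intro power_mono) auto
    also have "\<dots> = (a1 + a2)^2 * s ^ (4 * ?n - 2) * (w * w)"
    proof -
      have "4 * ?n - 2 = 2 * (2 * ?n - 1)" by simp
      then have "s ^ (4 * ?n - 2) = (s ^ (2 * ?n - 1))^2" by (simp only: power_even_eq)
      then show ?thesis by (simp only: power2_eq_square mult_ac)
    qed
    finally have "norm v * (s * (norm c + norm d)^2) \<le> norm v * (s * ((a1 + a2)^2 * s ^ (4 * ?n - 2) * (w * w)))"
      using s0 by (intro mult_left_mono) auto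
    also have "\<dots> = (a1 + a2)^2 * (s * ((x * w) * w))" by (simp add: x_def mult_ac)
    also have "\<dots> \<le> (a1 + a2)^2 * (s * ((a3 * (W + e^2)) * 1))"
      by (rule mult_left_mono[OF mult_left_mono[OF mult_mono[OF X w(2)]]]) (use x w s0 a0 We in auto)
    finally show ?thesis by (simp add: mult_ac)
  qed
  have "v \<bullet> (U s *v r) \<le> norm v * norm (U s *v r)" by (rule norm_cauchy_schwarz)
  also have "\<dots> \<le> norm v * (C * norm r)"
  proof (rule mult_left_mono)
    have "norm (U s *v r) \<le> norm (U s) * norm r" by (rule norm_matrix_vector_mult_le)
    also have "\<dots> \<le> C * norm r" using U_le[OF s] by (rule mult_right_mono) simp
    finally show "norm (U s *v r) \<le> C * norm r" .
  qed simp
  also have "\<dots> \<le> norm v * (C * (D * (s ^ (4 * ?n) * e + s ^ (?n + 1) * norm c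
       + s ^ (2 * ?n + 1) * norm d + s * (norm c + norm d)^2)))"
    using r C_nonneg by (intro mult_left_mono) auto
  also have "\<dots> = C * D * (norm v * (s ^ (4 * ?n) * e) + norm v * (s ^ (?n + 1) * norm c)
       + norm v * (s ^ (2 * ?n + 1) * norm d) + norm v * (s * (norm c + norm d)^2))"
    by (simp add: algebra_simps)
  also have "\<dots> \<le> C * D * (a3 * (s * (W + e^2)) + a1 * a3 * (s * (W + e^2))
       + a2 * a3 * (s * (W + e^2)) + (a1 + a2)^2 * a3 * (s * (W + e^2)))"
    using T1 T2 T3 T4 C_nonneg D by (intro mult_left_mono add_mono) auto
  also have "2 * \<dots> = 2 * C * D * a3 * (1 + a1 + a2 + (a1 + a2)^2) * s * (W + e^2)"
    by (simp add: algebra_simps)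
  finally show ?thesis by simp
qed

text \<open>A bootstrap: the remainder is controlled while |c| and |d| are at most \<rho>, which
  holds while W \<le> 1, and this in turn follows from the growth estimate when e is small. In
  \<Lambda> the first factor bounds W(0) + e^2 in units of e^2, and exp \<Gamma> is the total
  growth, since \<Gamma> exp (- \<tau>) has integral \<Gamma>. The global Lipschitz condition on
  \<open>R\<close> gives a solution for all times beforehand.\<close>

lemma closed_loop_solution:
  fixes R :: "real \<Rightarrow> real^'n \<Rightarrow> real^'r \<Rightarrow> real^'n" and D e \<rho> C0 L :: real
  assumes q: "q = 6 * CARD('n) - 3" and m: "m = q + 1 + 2 * (CARD('n) - 1)"
    and Rc: "continuous_on ({0..} \<times> UNIV) (\<lambda>(\<tau>, p). R \<tau> (fst p) (snd p))"
    and lip: "\<And>\<tau> c d c' d'. \<tau> \<ge> 0 \<Longrightarrow> norm (R \<tau> c d - R \<tau> c' d') \<le> L * (norm (c - c') + norm (d - d'))"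
    and D: "D \<ge> 0" and e: "e \<ge> 0" and \<rho>: "C^2 \<le> \<rho>" "C / sqrt \<kappa> \<le> \<rho>"
    and R: "\<And>\<tau> c d. \<tau> \<ge> 0 \<Longrightarrow> norm c \<le> \<rho> \<Longrightarrow> norm d \<le> \<rho> \<Longrightarrow>
      norm (R \<tau> c d) \<le> D * (exp (- \<tau>) ^ (4 * CARD('n)) * e + exp (- \<tau>) ^ (CARD('n) + 1) * norm c
       + exp (- \<tau>) ^ (2 * CARD('n) + 1) * norm d + exp (- \<tau>) * (norm c + norm d)^2)"
    and a: "a1 = C^2" "a2 = C / sqrt \<kappa>" "a3 = 1 / sqrt \<kappa>"
    and \<Gamma>: "\<Gamma> = 2 * C * D * a3 * (1 + a1 + a2 + (a1 + a2)^2)"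
    and \<Lambda>: "\<Lambda> = (C^2 * C0^2 / \<kappa> + 1) * exp \<Gamma>"
    and c0: "norm c0 \<le> C0 * e" and small: "\<Lambda> * e^2 < 1"
  shows "\<exists>c. c 0 = c0 \<and> (\<forall>\<tau>\<ge>0.
    (c has_vector_derivative (exp (- \<tau>) *\<^sub>R P (exp (- \<tau>))) *v c \<tau> + (exp (- \<tau>) *\<^sub>R Q (exp (- \<tau>))) *v (feedback \<tau> *v c \<tau>)
       + R \<tau> (c \<tau>) (feedback \<tau> *v c \<tau>)) (at \<tau> within {0..}) \<and>
    norm (c \<tau>) \<le> a1 * sqrt \<Lambda> * e * exp (- \<tau>) \<and> norm (feedback \<tau> *v c \<tau>) \<le> a2 * sqrt \<Lambda> * e * exp (- \<tau>))"
proof -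
  let ?n = "CARD('n)"
  have n: "1 \<le> 3 * ?n - 1" "1 \<le> 2 * ?n - 1"
    using one_le_card_finite[where 'a = 'n] by linarith+
  define Lc where "Lc \<tau> = V (exp (- \<tau>)) ** G (exp (- \<tau>))" for \<tau>
  define Ld where "Ld \<tau> = - (exp (- \<tau>) ^ q *\<^sub>R transpose (Y (exp (- \<tau>))))" for \<tau>
  define H where "H \<tau> = matrix_inv (G (exp (- \<tau>))) ** U (exp (- \<tau>))" for \<tau>
  have Hc: "continuous_on {0..} H" and Lcc: "continuous_on {0..} Lc" and Ldc: "continuous_on {0..} Ld"
    unfolding H_def [abs_def] Lc_def [abs_def] Ld_def [abs_def]
    by (intro continuous_on_minus continuous_on_scaleR continuous_on_power matrix_mult_continuous_on
      bounded_linear.continuous_on[OF bounded_linear_transpose] continuous_on_G_inverse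
      continuous_on_exp_compose continuous_on_Y continuous_on_G continuous_on_frame[OF fr] continuous_intros)+
  define v0 where "v0 = H 0 *v c0"
  obtain v where v: "v 0 = v0" "\<And>\<tau>. \<tau> \<ge> 0 \<Longrightarrow> (v has_vector_derivative
      H \<tau> *v R \<tau> (Lc \<tau> *v v \<tau>) (Ld \<tau> *v v \<tau>)) (at \<tau> within {0..})"
    using feedback_ode_exists[OF Hc Lcc Ldc Rc lip, of v0] by blast
  define r where "r \<tau> = R \<tau> (Lc \<tau> *v v \<tau>) (Ld \<tau> *v v \<tau>)" for \<tau>
  define W where "W \<tau> = v \<tau> \<bullet> (G (exp (- \<tau>)) *v v \<tau>)" for \<tau>
  \<comment> \<open>The derivative of G contributes the negative square, because s decreases as
    \<tau> grows; the estimate below drops it.\<close>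
  define W' where "W' \<tau> = 2 * (v \<tau> \<bullet> (U (exp (- \<tau>)) *v r \<tau>)) -
    exp (- \<tau>) * exp (- \<tau>) ^ q * (norm (transpose (Y (exp (- \<tau>))) *v v \<tau>))^2" for \<tau>
  have s: "exp (- \<tau>) \<in> {0..1}" if "\<tau> \<ge> 0" for \<tau> :: real using that by simp
  have GH: "G (exp (- \<tau>)) *v (H \<tau> *v y) = U (exp (- \<tau>)) *v y" if "\<tau> \<ge> 0" for \<tau> y
    unfolding H_def using G_inverse(1)[OF exp_in_unit[OF that]]
    by (simp add: matrix_vector_mul_assoc matrix_mul_assoc)
  have dW: "(W has_real_derivative W' \<tau>) (at \<tau> within {0..})" if t: "\<tau> \<ge> 0" for \<tau>
  proof -
    let ?s = "exp (- \<tau>)"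
    let ?dG = "(- ?s) *\<^sub>R (?s ^ q *\<^sub>R (Y ?s ** transpose (Y ?s)))"
    have "((\<lambda>\<tau>. G (exp (- \<tau>))) has_vector_derivative ?dG) (at \<tau> within {0..})"
      by (rule has_vector_derivative_exp_substitution[OF G_derivative]) simp
    from bounded_bilinear.has_vector_derivative[OF bounded_bilinear_inner v(2)[OF t]
        matrix_vector_has_vector_derivative[OF this v(2)[OF t]]]
    have "(W has_vector_derivative v \<tau> \<bullet> (G ?s *v (H \<tau> *v r \<tau>) + ?dG *v v \<tau>) + (H \<tau> *v r \<tau>) \<bullet> (G ?s *v v \<tau>))
        (at \<tau> within {0..})"
      unfolding W_def [abs_def] r_def .
    \<comment> \<open>By symmetry of G both occurrences of v' contribute the same term, and G H = U
      removes the inverse Gramian.\<close>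
    moreover have "(H \<tau> *v r \<tau>) \<bullet> (G ?s *v v \<tau>) = v \<tau> \<bullet> (U ?s *v r \<tau>)"
    proof -
      have "(H \<tau> *v r \<tau>) \<bullet> (G ?s *v v \<tau>) = (transpose (G ?s) *v (H \<tau> *v r \<tau>)) \<bullet> v \<tau>"
        by (rule inner_matrix_vector_transpose)
      also have "\<dots> = v \<tau> \<bullet> (U ?s *v r \<tau>)" by (simp only: transpose_G GH[OF t] inner_commute)
      finally show ?thesis .
    qed
    moreover have "v \<tau> \<bullet> (?dG *v v \<tau>) = - (?s * ?s ^ q * (norm (transpose (Y ?s) *v v \<tau>))^2)"
    proof -
      have "v \<tau> \<bullet> ((Y ?s ** transpose (Y ?s)) *v v \<tau>) = (norm (transpose (Y ?s) *v v \<tau>))^2"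
        by (simp only: matrix_vector_mul_assoc[symmetric] inner_matrix_vector_transpose power2_norm_eq_inner)
      then show ?thesis
        by (simp only: scaleR_matrix_vector_assoc[symmetric] inner_scaleR_right)
    qed
    ultimately show ?thesis
      unfolding has_real_derivative_iff_has_vector_derivative W'_def
      by (simp only: inner_add_right GH[OF t]) (simp add: algebra_simps)
  qed
  have feedback: "feedback \<tau> *v (Lc \<tau> *v y) = Ld \<tau> *v y" if "\<tau> \<ge> 0" for \<tau> y
    unfolding matrix_vector_mul_assoc Lc_def Ld_def feedback_VG[OF that] ..
  have Ld_norm: "norm (Ld \<tau> *v y) = norm ((exp (- \<tau>) ^ q *\<^sub>R transpose (Y (exp (- \<tau>)))) *v y)" for \<tau> y
    unfolding Ld_def by (simp only: bounded_bilinear.minus_left[OF bounded_bilinear_matrix_vector] norm_minus_cancel)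
  have W0: "W \<tau> \<ge> 0" if "\<tau> \<ge> 0" for \<tau>
    using state_bounds(1)[OF s[OF that] q m W_def[of \<tau>]] .
  have cb: "norm (Lc \<tau> *v v \<tau>) \<le> a1 * exp (- \<tau>) * sqrt (W \<tau>)" if t: "\<tau> \<ge> 0" for \<tau>
  proof -
    have "norm (Lc \<tau> *v v \<tau>) \<le> a1 * exp (- \<tau>) ^ (3 * ?n - 1) * sqrt (W \<tau>)"
      unfolding Lc_def a by (rule state_bounds(3)[OF s[OF t] q m W_def])
    also have "\<dots> \<le> a1 * exp (- \<tau>) ^ 1 * sqrt (W \<tau>)"
      using t W0[OF t] a by (intro mult_right_mono mult_left_mono power_decreasing n) auto
    finally show ?thesis by simp
  qed
  have db: "norm (Ld \<tau> *v v \<tau>) \<le> a2 * exp (- \<tau>) * sqrt (W \<tau>)" if t: "\<tau> \<ge> 0" for \<tau>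
  proof -
    have "norm (Ld \<tau> *v v \<tau>) \<le> a2 * exp (- \<tau>) ^ (2 * ?n - 1) * sqrt (W \<tau>)"
      unfolding Ld_norm a by (rule state_bounds(4)[OF s[OF t] q m W_def])
    also have "\<dots> \<le> a2 * exp (- \<tau>) ^ 1 * sqrt (W \<tau>)"
      using t W0[OF t] a C_nonneg kappa by (intro mult_right_mono mult_left_mono power_decreasing n) auto
    finally show ?thesis by simp
  qed
  have decay: "W' \<tau> \<le> (\<Gamma> * exp (- \<tau>)) * (W \<tau> + e^2)" if t: "\<tau> \<ge> 0" and W1: "W \<tau> \<le> 1" for \<tau>
  proof -
    have u: "exp (- \<tau>) * sqrt (W \<tau>) \<le> 1"
      using t W1 W0[OF t] by (intro mult_le_one) auto
    have "norm (Lc \<tau> *v v \<tau>) \<le> \<rho>"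
    proof -
      have "a1 * (exp (- \<tau>) * sqrt (W \<tau>)) \<le> a1 * 1" using u a by (intro mult_left_mono) auto
      then show ?thesis using cb[OF t] \<rho> a by (simp add: mult.assoc)
    qed
    moreover have "norm (Ld \<tau> *v v \<tau>) \<le> \<rho>"
    proof -
      have "a2 * (exp (- \<tau>) * sqrt (W \<tau>)) \<le> a2 * 1"
        using u a C_nonneg kappa by (intro mult_left_mono) auto
      then show ?thesis using db[OF t] \<rho> a by (simp add: mult.assoc)
    qed
    ultimately have "norm (r \<tau>) \<le> D * (exp (- \<tau>) ^ (4 * ?n) * e + exp (- \<tau>) ^ (?n + 1) * norm (Lc \<tau> *v v \<tau>)
       + exp (- \<tau>) ^ (2 * ?n + 1) * norm (Ld \<tau> *v v \<tau>) + exp (- \<tau>) * (norm (Lc \<tau> *v v \<tau>) + norm (Ld \<tau> *v v \<tau>))^2)"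
      unfolding r_def by (intro R t)
    from dissipation_bound[OF s[OF t] q m W_def W1 D e refl Ld_norm this[unfolded Lc_def] a]
    have "2 * (v \<tau> \<bullet> (U (exp (- \<tau>)) *v r \<tau>)) \<le> \<Gamma> * exp (- \<tau>) * (W \<tau> + e^2)"
      unfolding \<Gamma> .
    moreover have "0 \<le> exp (- \<tau>) * exp (- \<tau>) ^ q * (norm (transpose (Y (exp (- \<tau>))) *v v \<tau>))^2" by simp
    ultimately show ?thesis unfolding W'_def by linarith
  qed
  have U0: "norm (U 1 *v c0) \<le> C * (C0 * e)"
  proof -
    have "norm (U 1 *v c0) \<le> norm (U 1) * norm c0" by (rule norm_matrix_vector_mult_le)
    also have "\<dots> \<le> C * (C0 * e)" using U_le[of 1] c0 C_nonneg by (intro mult_mono) auto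
    finally show ?thesis .
  qed
  \<comment> \<open>At \<tau> = 0 the inverse Gramian is taken at s = 1, where it is bounded by 1 /
    \<kappa>; so W(0) = v0 . U(1) c0 is quadratic in e.\<close>
  have Wi: "W 0 \<le> C^2 * C0^2 / \<kappa> * e^2"
  proof -
    have "W 0 = v0 \<bullet> (U 1 *v c0)"
      unfolding W_def v(1) using GH[of 0 c0] by (simp add: v0_def)
    also have "\<dots> \<le> norm v0 * norm (U 1 *v c0)" by (rule norm_cauchy_schwarz)
    also have "norm v0 \<le> (1 / (\<kappa> * 1 ^ m)) * norm (U 1 *v c0)"
      unfolding v0_def H_def using norm_G_inverse_mult_le[of 1 "U 1 *v c0"] by (simp add: matrix_vector_mul_assoc)
    also have "(1 / (\<kappa> * 1 ^ m)) * norm (U 1 *v c0) * norm (U 1 *v c0) \<le> (1 / \<kappa>) * (C * (C0 * e))^2"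
      using kappa power_mono[OF U0, of 2] by (simp add: power2_eq_square divide_right_mono)
    finally show ?thesis by (simp add: power_mult_distrib mult_right_mono)
  qed
  have bound: "W t + e^2 \<le> (W 0 + e^2) * exp \<Gamma>" if T: "T \<ge> 0" and W1: "\<And>\<tau>. \<tau> \<in> {0<..<T} \<Longrightarrow> W \<tau> \<le> 1"
    and t: "t \<in> {0..T}" for T t
  proof -
    \<comment> \<open>The rate \<Gamma> exp (- \<tau>) has the primitive - \<Gamma> exp (- \<tau>),
      whose increase never exceeds \<Gamma>.\<close>
    have "W t + e^2 \<le> (W 0 + e^2) * exp (- (\<Gamma> * exp (- t)) - - (\<Gamma> * exp (- 0)))"
    proof (rule gronwall_interior[where T = T and W' = W' and k = "\<lambda>\<tau>. \<Gamma> * exp (- \<tau>)"])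
      show "((\<lambda>t. W t + e^2) has_real_derivative W' \<tau>) (at \<tau> within {0..})" if "\<tau> \<in> {0..T}" for \<tau>
        using dW[of \<tau>] that by (auto intro!: derivative_eq_intros)
      show "((\<lambda>\<tau>. - (\<Gamma> * exp (- \<tau>))) has_real_derivative \<Gamma> * exp (- \<tau>)) (at \<tau> within {0..})" for \<tau>
        by (auto intro!: derivative_eq_intros)
      show "W' \<tau> \<le> \<Gamma> * exp (- \<tau>) * (W \<tau> + e^2)" if "\<tau> \<in> {0<..<T}" for \<tau>
        using decay[of \<tau>] W1[OF that] that by simp
    qed (rule t)
    also have "\<dots> \<le> (W 0 + e^2) * exp \<Gamma>"
    proof -
      have "\<Gamma> \<ge> 0" unfolding \<Gamma> a using C_nonneg D kappa by simp
      then show ?thesis using W0[of 0] by (intro mult_left_mono) auto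
    qed
    finally show ?thesis .
  qed
  have le\<Lambda>: "(W 0 + e^2) * exp \<Gamma> \<le> \<Lambda> * e^2"
  proof -
    have "W 0 + e^2 \<le> (C^2 * C0^2 / \<kappa> + 1) * e^2" using Wi by (simp add: distrib_right)
    then have "(W 0 + e^2) * exp \<Gamma> \<le> (C^2 * C0^2 / \<kappa> + 1) * e^2 * exp \<Gamma>" by (rule mult_right_mono) simp
    then show ?thesis unfolding \<Lambda> by (simp add: mult_ac)
  qed
  have Wc: "continuous_on {0..} W"
    using dW by (intro DERIV_continuous_on) auto
  have W1: "W t < 1" if t: "t \<ge> 0" for t
  proof (rule ccontr)
    assume "\<not> W t < 1"
    \<comment> \<open>The least element of \<open>S\<close> is the first time T with W \<ge> 1. The
      growth estimate applies up to T and gives W(T) + e^2 \<le> \<Lambda> e^2 < 1, a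
      contradiction.\<close>
    define S where "S = {0..t} \<inter> W -` {1..}"
    have "closed S" unfolding S_def
      by (intro continuous_closed_preimage continuous_on_subset[OF Wc]) auto
    moreover have "bounded S" unfolding S_def by (rule bounded_subset[of "{0..t}"]) auto
    ultimately have "compact S" by (simp add: compact_eq_bounded_closed)
    moreover have "S \<noteq> {}" using \<open>\<not> W t < 1\<close> t by (auto simp: S_def)
    ultimately obtain T where T: "T \<in> S" "\<And>x. x \<in> S \<Longrightarrow> T \<le> x"
      using compact_attains_inf[of S] by blast
    have "W \<tau> \<le> 1" if "\<tau> \<in> {0<..<T}" for \<tau>
    proof (rule ccontr)
      assume "\<not> W \<tau> \<le> 1"
      then have "\<tau> \<in> S" using T(1) that by (auto simp: S_def)
      from T(2)[OF this] that show False by simp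
    qed
    from bound[OF _ this, of T] have "W T + e^2 \<le> (W 0 + e^2) * exp \<Gamma>"
      using T(1) by (simp add: S_def)
    moreover have "W T \<ge> 1" using T(1) by (simp add: S_def)
    ultimately show False using le\<Lambda> small zero_le_power2[of e] by linarith
  qed
  have W_le: "sqrt (W t) \<le> sqrt \<Lambda> * e" if t: "t \<ge> 0" for t
  proof -
    have "W t + e^2 \<le> (W 0 + e^2) * exp \<Gamma>"
      by (rule bound[OF t]) (use W1 t in \<open>auto intro: less_imp_le\<close>)
    then have "W t \<le> \<Lambda> * e^2" using le\<Lambda> zero_le_power2[of e] by linarith
    then have "sqrt (W t) \<le> sqrt (\<Lambda> * e^2)" by simp
    then show ?thesis using e by (simp add: real_sqrt_mult)
  qed
  define c where "c \<tau> = Lc \<tau> *v v \<tau>" for \<tau>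
  show ?thesis
  proof (intro exI[of _ c] conjI allI impI)
    have "Lc 0 *v (H 0 *v c0) = (V 1 ** (G 1 ** matrix_inv (G 1)) ** U 1) *v c0"
      by (simp add: Lc_def H_def matrix_vector_mul_assoc matrix_mul_assoc)
    then show "c 0 = c0"
      using G_inverse(1)[of 1] by (simp add: c_def v(1) v0_def frame_inverse)
    fix \<tau> :: real assume t: "\<tau> \<ge> 0"
    let ?s = "exp (- \<tau>)"
    have dc: "feedback \<tau> *v c \<tau> = Ld \<tau> *v v \<tau>" unfolding c_def by (rule feedback[OF t])
    have LcH: "Lc \<tau> *v (H \<tau> *v y) = y" for y
      unfolding Lc_def matrix_vector_mul_assoc[symmetric] GH[OF t]
      by (simp add: matrix_vector_mul_assoc frame_inverse)
    have "(c has_vector_derivative Lc \<tau> *v (H \<tau> *v r \<tau>) +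
        ((?s *\<^sub>R P ?s + (?s *\<^sub>R Q ?s) ** feedback \<tau>) ** Lc \<tau>) *v v \<tau>) (at \<tau> within {0..})"
      unfolding c_def [abs_def] r_def
      by (rule matrix_vector_has_vector_derivative[OF VG_derivative_tau[OF t, folded Lc_def] v(2)[OF t]])
    moreover have "Lc \<tau> *v (H \<tau> *v r \<tau>) + ((?s *\<^sub>R P ?s + (?s *\<^sub>R Q ?s) ** feedback \<tau>) ** Lc \<tau>) *v v \<tau> =
        (?s *\<^sub>R P ?s) *v c \<tau> + (?s *\<^sub>R Q ?s) *v (feedback \<tau> *v c \<tau>) + R \<tau> (c \<tau>) (feedback \<tau> *v c \<tau>)"
      unfolding LcH dc r_def
      by (simp only: c_def matrix_vector_mul_assoc[symmetric] matrix_vector_mult_add_rdistrib feedback[OF t] add_ac)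
    ultimately show "(c has_vector_derivative (?s *\<^sub>R P ?s) *v c \<tau> + (?s *\<^sub>R Q ?s) *v (feedback \<tau> *v c \<tau>)
       + R \<tau> (c \<tau>) (feedback \<tau> *v c \<tau>)) (at \<tau> within {0..})" by simp
    have "a1 * ?s * sqrt (W \<tau>) \<le> a1 * ?s * (sqrt \<Lambda> * e)"
      using W_le[OF t] a by (intro mult_left_mono) auto
    then show "norm (c \<tau>) \<le> a1 * sqrt \<Lambda> * e * ?s"
      unfolding c_def using cb[OF t] by (simp add: mult_ac)
    have "a2 * ?s * sqrt (W \<tau>) \<le> a2 * ?s * (sqrt \<Lambda> * e)"
      using W_le[OF t] a C_nonneg kappa by (intro mult_left_mono) auto
    then show "norm (feedback \<tau> *v c \<tau>) \<le> a2 * sqrt \<Lambda> * e * ?s"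
      unfolding dc using db[OF t] by (simp add: mult_ac)
  qed
qed

end

section \<open>Return to the original variables\<close>

text \<open>The problem is posed in arbitrary norms while the estimates are Euclidean. The upper
  bound transfers the constraint on u, the lower one the smallness of xb.\<close>

lemma is_norm_bounds:
  fixes p :: "'a::euclidean_space \<Rightarrow> real"
  assumes "is_norm p"
  shows "\<exists>C>0. \<forall>v. p v \<le> C * norm v" "\<exists>c>0. \<forall>v. c * norm v \<le> p v"
proof -
  have p: "\<And>v. p v = 0 \<longleftrightarrow> v = 0" "\<And>a v. p (a *\<^sub>R v) = \<bar>a\<bar> * p v" "\<And>v w. p (v + w) \<le> p v + p w"
    using assms unfolding is_norm_def by auto
  have p0: "p 0 = 0" using p(1)[of 0] by blast
  have neg: "p (- v) = p v" for v using p(2)[of "-1" v] by simp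
  have nonneg: "p v \<ge> 0" for v using p(3)[of v "- v"] p(1)[of 0] neg[of v] by simp
  have psum: "p (\<Sum>b\<in>B. g b) \<le> (\<Sum>b\<in>B. p (g b))" for B and g :: "'a \<Rightarrow> 'a"
  proof (induction B rule: infinite_finite_induct)
    case (insert b B)
    then show ?case using p(3)[of "g b" "\<Sum>b\<in>B. g b"] by simp
  qed (simp_all add: p0)
  define C where "C = (\<Sum>b\<in>Basis. p b) + 1"
  have C: "C > 0" unfolding C_def by (intro add_nonneg_pos sum_nonneg nonneg) auto
  have up: "p v \<le> C * norm v" for v
  proof -
    have "p v = p (\<Sum>b\<in>Basis. (v \<bullet> b) *\<^sub>R b)" by (simp add: euclidean_representation)
    also have "\<dots> \<le> (\<Sum>b\<in>Basis. p ((v \<bullet> b) *\<^sub>R b))" by (rule psum)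
    also have "\<dots> \<le> (\<Sum>b\<in>Basis. norm v * p b)"
      unfolding p(2) by (intro sum_mono mult_right_mono nonneg Basis_le_norm)
    also have "\<dots> \<le> C * norm v" by (simp add: C_def sum_distrib_left[symmetric] algebra_simps)
    finally show ?thesis .
  qed
  then show "\<exists>C>0. \<forall>v. p v \<le> C * norm v" using C by blast
  have lip: "\<bar>p v - p w\<bar> \<le> C * norm (v - w)" for v w
    using p(3)[of "v - w" w] p(3)[of "w - v" v] up[of "v - w"] up[of "w - v"] norm_minus_commute[of v w]
    by (simp add: abs_le_iff)
  have "continuous_on (sphere 0 1) p"
    unfolding continuous_on_iff
  proof (intro ballI allI impI)
    fix v e :: 'a and \<epsilon> :: real assume "\<epsilon> > 0"
    show "\<exists>d>0. \<forall>w\<in>sphere 0 1. dist w v < d \<longrightarrow> dist (p w) (p v) < \<epsilon>"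
    proof (intro exI[of _ "\<epsilon> / C"] conjI ballI impI)
      show "\<epsilon> / C > 0" using \<open>\<epsilon> > 0\<close> C by simp
      fix w assume "dist w v < \<epsilon> / C"
      then have "C * norm (w - v) < \<epsilon>" using C by (simp add: dist_norm field_simps)
      then show "dist (p w) (p v) < \<epsilon>" using lip[of w v] by (simp add: dist_norm)
    qed
  qed
  moreover have "sphere 0 1 \<noteq> ({} :: 'a set)" by simp
  ultimately obtain v0 where v0: "v0 \<in> sphere 0 1" "\<And>v. v \<in> sphere 0 1 \<Longrightarrow> p v0 \<le> p v"
    using continuous_attains_inf[of "sphere 0 1" p] by auto
  have "p v0 \<noteq> 0" using v0(1) by (auto simp: p(1))
  then have pos: "p v0 > 0" using nonneg[of v0] by simp
  have "p v0 * norm v \<le> p v" for v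
  proof (cases "v = 0")
    case False
    have "p v0 \<le> p (v /\<^sub>R norm v)" using False by (intro v0(2)) simp
    then show ?thesis using False by (simp add: p(2) field_simps)
  qed (simp add: p0)
  then show "\<exists>c>0. \<forall>v. c * norm v \<le> p v" using pos by blast
qed

lemma C1_lipschitz_on_cball:
  fixes f :: "'a::euclidean_space \<Rightarrow> 'b::real_normed_vector"
  assumes f: "C_upto 1 f"
  shows "\<exists>L\<ge>0. \<forall>x\<in>cball 0 \<rho>. \<forall>y\<in>cball 0 \<rho>. norm (f x - f y) \<le> L * norm (x - y)"
proof -
  obtain L where L: "L \<ge> 0" "\<And>vs z. length vs = 1 \<Longrightarrow> norm z \<le> \<rho> \<Longrightarrow>
      norm (iter_deriv f vs z) \<le> L * prod_list (map norm vs)"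
    using iter_deriv_bound[OF f order_refl, of \<rho>] by blast
  have "norm (f x - f y) \<le> L * norm (x - y)" if "x \<in> cball 0 \<rho>" "y \<in> cball 0 \<rho>" for x y
  proof (rule differentiable_bound[OF convex_cball _ _ that])
    fix z :: 'a assume z: "z \<in> cball 0 \<rho>"
    show "(f has_derivative (\<lambda>v. iter_deriv f [v] z)) (at z within cball 0 \<rho>)"
      using has_derivative_at_withinI[OF iter_deriv_has_derivative[OF f, of "[]" z]] by simp
    show "onorm (\<lambda>v. iter_deriv f [v] z) \<le> L"
    proof (rule onorm_le)
      show "norm (iter_deriv f [v] z) \<le> L * norm v" for v
        using L(2)[of "[v]" z] z by simp
    qed
  qed
  then show ?thesis using L(1) by blast
qed

text \<open>Since exp (- \<tau>) = 1 - t, the exponential rate becomes a bound K (1 - t), which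
  gives continuity at t = 1.\<close>

lemma continuous_on_time_change:
  fixes h :: "real \<Rightarrow> 'a::real_normed_vector"
  assumes h: "continuous_on {0..} h" and K: "\<And>\<tau>. \<tau> \<ge> 0 \<Longrightarrow> norm (h \<tau> - l) \<le> K * exp (- \<tau>)"
  shows "continuous_on {0..1} (\<lambda>t. if t < 1 then h (- ln (1 - t)) else l)"
    and "((\<lambda>t. h (- ln (1 - t))) \<longlongrightarrow> l) (at_left 1)"
proof -
  let ?g = "\<lambda>t. if t < 1 then h (- ln (1 - t)) else l"
  have Kt: "norm (h (- ln (1 - t)) - l) \<le> K * (1 - t)" if "0 \<le> t" "t < 1" for t :: real
    using K[of "- ln (1 - t)"] that by simp
  have z: "((\<lambda>t. K * (1 - t)) \<longlongrightarrow> 0) (at 1 within S)" for S :: "real set"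
  proof -
    have "((\<lambda>t. K * (1 - t)) \<longlongrightarrow> K * (1 - 1)) (at 1 within S)" by (intro tendsto_intros)
    then show ?thesis by simp
  qed
  have "((\<lambda>t. h (- ln (1 - t)) - l) \<longlongrightarrow> 0) (at_left 1)"
  proof (rule Lim_null_comparison[OF _ z])
    have "eventually (\<lambda>t::real. t \<in> {0<..<1}) (at_left 1)"
      by (rule eventually_at_leftI[of 0]) auto
    then show "\<forall>\<^sub>F t in at_left 1. norm (h (- ln (1 - t)) - l) \<le> K * (1 - t)"
      by eventually_elim (use Kt in auto)
  qed
  then show "((\<lambda>t. h (- ln (1 - t))) \<longlongrightarrow> l) (at_left 1)" by (rule Lim_null[THEN iffD2])
  have c1: "continuous_on {0..<1} (\<lambda>t. h (- ln (1 - t)))"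
    by (rule continuous_on_compose2[OF h]) (auto intro!: continuous_intros)
  have c2: "continuous_on {0..<1} ?g"
    by (rule continuous_on_eq[OF c1]) auto
  show "continuous_on {0..1} ?g"
    unfolding continuous_on_def
  proof
    fix t :: real assume t: "t \<in> {0..1}"
    show "(?g \<longlongrightarrow> ?g t) (at t within {0..1})"
    proof (cases "t < 1")
      case True
      have "at t within {0..1} = at t within {0..<1}"
        by (rule at_within_nhd[of _ "{..<1}"]) (use True in auto)
      then show ?thesis using c2 t True unfolding continuous_on_def by simp
    next
      case False
      then have t1: "t = 1" using t by simp
      have "((\<lambda>t. ?g t - l) \<longlongrightarrow> 0) (at 1 within {0..1})"
      proof (rule Lim_null_comparison[OF _ z])
        have b: "norm (?g t - l) \<le> K * (1 - t)" if "t \<in> {0..1}" for t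
          using Kt[of t] that by auto
        show "\<forall>\<^sub>F t in at 1 within {0..1}. norm (?g t - l) \<le> K * (1 - t)"
          unfolding eventually_at_filter by (intro always_eventually allI impI b)
      qed
      then show ?thesis unfolding t1 by (simp add: Lim_null[of ?g l])
    qed
  qed
qed

text \<open>The change of time yields the equation only inside the interval, as t = 1 corresponds to
  \<tau> = \<infinity>. Because F is continuous up to the end points, x is its integral and has the
  one-sided derivatives there.\<close>

lemma has_vector_derivative_if_interior:
  fixes x F :: "real \<Rightarrow> 'a::euclidean_space"
  assumes x: "continuous_on {a..b} x" and F: "continuous_on {a..b} F"
    and der: "\<And>t. t \<in> {a<..<b} \<Longrightarrow> (x has_vector_derivative F t) (at t)" and t: "t \<in> {a..b}"
  shows "(x has_vector_derivative F t) (at t within {a..b})"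
proof -
  have eq: "x r = x a + integral {a..r} F" if r: "r \<in> {a..b}" for r
  proof -
    have "(F has_integral x r - x a) {a..r}"
      by (rule fundamental_theorem_of_calculus_interior)
         (use r der in \<open>auto intro: continuous_on_subset[OF x]\<close>)
    then show ?thesis by (simp add: integral_unique)
  qed
  have "((\<lambda>r. x a + integral {a..r} F) has_vector_derivative 0 + F t) (at t within {a..b})"
    by (intro has_vector_derivative_add has_vector_derivative_const integral_has_vector_derivative F t)
  then have "((\<lambda>r. x a + integral {a..r} F) has_vector_derivative F t) (at t within {a..b})" by simp
  then show ?thesis
    by (rule has_vector_derivative_transform[OF t _, rotated]) (rule eq)
qed

text \<open>P, Q and R add up to the full right-hand side: the splitting matters for estimates, not
  for the meaning of the initial value problem.\<close>

lemma auxiliary_ivp_solution_iff: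
  fixes f :: "(real^'n) \<times> (real^'r) \<Rightarrow> real^'n"
  shows "auxiliary_ivp_solution f \<alpha> \<phi> xb M c \<longleftrightarrow>
    c 0 = - xb - (\<Sum>k=1..4 * CARD('n) - 1. \<phi> k xb) \<and>
    (\<forall>\<tau>\<ge>0. (c has_vector_derivative shifted_rhs f \<alpha> \<phi> xb (4 * CARD('n) - 1) \<tau> (c \<tau>) (M \<tau> *v c \<tau>)) (at \<tau> within {0..}))"
  unfolding auxiliary_ivp_solution_def R_term_def by simp

text \<open>Needed because recovery is claimed from every solution of the auxiliary system. f is
  only locally Lipschitz, but two given solutions stay in a common ball on [0, \<tau>], where f has
  a Lipschitz constant.\<close>

lemma auxiliary_ivp_unique:
  fixes f :: "(real^'n) \<times> (real^'r) \<Rightarrow> real^'n"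
  assumes f: "C_upto 1 f" and M: "continuous_on {0..} M"
    and c: "auxiliary_ivp_solution f 1 \<phi> xb M c" and c': "auxiliary_ivp_solution f 1 \<phi> xb M c'"
    and \<tau>: "\<tau> \<ge> 0"
  shows "c \<tau> = c' \<tau>"
proof -
  let ?K = "4 * CARD('n) - 1"
  have cc: "continuous_on {0..} c" "continuous_on {0..} c'"
    using c c' unfolding auxiliary_ivp_solution_iff by (auto intro!: continuous_on_vector_derivative)
  define z where "z t = xb + (\<Sum>k=1..?K. exp (- t) ^ k *\<^sub>R \<phi> k xb)" for t
  have zc: "continuous_on {0..} z" unfolding z_def [abs_def] by (intro continuous_intros)
  have "continuous_on {0..} (\<lambda>t. (z t + c t, M t *v c t))" "continuous_on {0..} (\<lambda>t. (z t + c' t, M t *v c' t))"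
    by (intro continuous_intros zc cc matrix_vector_continuous_on M)+
  from continuous_on_nonneg_bounded[OF this(1), of \<tau>] continuous_on_nonneg_bounded[OF this(2), of \<tau>] obtain B1 B2 where
    B: "\<forall>t\<in>{0..\<tau>}. norm (z t + c t, M t *v c t) \<le> B1" "\<forall>t\<in>{0..\<tau>}. norm (z t + c' t, M t *v c' t) \<le> B2"
    by blast
  obtain BM where BM: "BM \<ge> 0" "\<forall>t\<in>{0..\<tau>}. norm (M t) \<le> BM" using continuous_on_nonneg_bounded[OF M] by blast
  obtain L where L: "L \<ge> 0" "\<forall>x\<in>cball 0 (max B1 B2). \<forall>y\<in>cball 0 (max B1 B2). norm (f x - f y) \<le> L * norm (x - y)"
    using C1_lipschitz_on_cball[OF f] by blast
  show ?thesis
  proof (rule ode_unique[where T = \<tau> and L = "L * (1 + BM)" and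
      x' = "\<lambda>t. shifted_rhs f 1 \<phi> xb ?K t (c t) (M t *v c t)" and
      y' = "\<lambda>t. shifted_rhs f 1 \<phi> xb ?K t (c' t) (M t *v c' t)"])
    show "c 0 = c' 0" using c c' unfolding auxiliary_ivp_solution_iff by simp
    show "\<tau> \<in> {0..\<tau>}" using \<tau> by simp
    fix t assume t: "t \<in> {0..\<tau>}"
    show "(c has_vector_derivative shifted_rhs f 1 \<phi> xb ?K t (c t) (M t *v c t)) (at t within {0..})"
      "(c' has_vector_derivative shifted_rhs f 1 \<phi> xb ?K t (c' t) (M t *v c' t)) (at t within {0..})"
      using c c' t unfolding auxiliary_ivp_solution_iff by auto
    let ?p = "(z t + c t, M t *v c t)" and ?p' = "(z t + c' t, M t *v c' t)"
    have e: "shifted_rhs f 1 \<phi> xb ?K t (c t) (M t *v c t) - shifted_rhs f 1 \<phi> xb ?K t (c' t) (M t *v c' t) =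
        exp (- t) *\<^sub>R (f ?p - f ?p')"
      unfolding shifted_rhs_power z_def by (simp add: algebra_simps)
    have "norm (f ?p - f ?p') \<le> L * norm (?p - ?p')"
      using B t by (intro L(2)[rule_format]) (auto simp: le_max_iff_disj)
    also have "\<dots> \<le> L * ((1 + BM) * norm (c t - c' t))"
    proof (rule mult_left_mono[OF _ L(1)])
      have "norm (?p - ?p') \<le> norm (c t - c' t) + norm (M t *v (c t - c' t))"
        using norm_Pair_le[of "c t - c' t" "M t *v (c t - c' t)"] by (simp add: matrix_vector_mult_diff_distrib)
      also have "norm (M t *v (c t - c' t)) \<le> norm (M t) * norm (c t - c' t)" by (rule norm_matrix_vector_mult_le)
      also have "\<dots> \<le> BM * norm (c t - c' t)" using BM t by (intro mult_right_mono) auto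
      finally show "norm (?p - ?p') \<le> (1 + BM) * norm (c t - c' t)" by (simp add: distrib_right)
    qed
    finally have "norm (f ?p - f ?p') \<le> L * (1 + BM) * norm (c t - c' t)" by simp
    moreover have "norm (exp (- t) *\<^sub>R (f ?p - f ?p')) \<le> 1 * norm (f ?p - f ?p')"
      unfolding norm_scaleR using t by (intro mult_right_mono) auto
    ultimately show "norm (shifted_rhs f 1 \<phi> xb ?K t (c t) (M t *v c t) - shifted_rhs f 1 \<phi> xb ?K t (c' t) (M t *v c' t))
        \<le> L * (1 + BM) * norm (c t - c' t)"
      unfolding e by linarith
  qed
qed

text \<open>Undoes the shifts and the change of time. The exponential bounds on c and d give limits
  at t = 1, namely xb for x and 0 for u; the constraint on u follows from |u| \<le> K'.\<close>

lemma recover_bvp_solution: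
  fixes f :: "(real^'n) \<times> (real^'r) \<Rightarrow> real^'n" and xb :: "real^'n"
  assumes f: "C_upto 1 f" and M: "continuous_on {0..} M"
    and c: "auxiliary_ivp_solution f 1 \<phi> xb M c"
    and cb: "\<And>\<tau>. \<tau> \<ge> 0 \<Longrightarrow> norm (c \<tau>) \<le> K * exp (- \<tau>)"
    and db: "\<And>\<tau>. \<tau> \<ge> 0 \<Longrightarrow> norm (M \<tau> *v c \<tau>) \<le> K' * exp (- \<tau>)"
    and N: "\<And>u. norm u \<le> K' \<Longrightarrow> norm_u u < N" and K': "K' \<ge> 0"
  shows "\<exists>x u. bvp_solution f norm_u N xb x u \<and>
    (\<forall>c. auxiliary_ivp_solution f 1 \<phi> xb M c \<longrightarrow> recovered_from 1 \<phi> xb M c x u)"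
proof -
  let ?K = "4 * CARD('n) - 1"
  have cc: "continuous_on {0..} c"
    using c unfolding auxiliary_ivp_solution_iff by (auto intro!: continuous_on_vector_derivative)
  define X where "X \<tau> = xb + c \<tau> + (\<Sum>k=1..?K. exp (- \<tau>) ^ k *\<^sub>R \<phi> k xb)" for \<tau>
  define D where "D \<tau> = M \<tau> *v c \<tau>" for \<tau>
  have Xc: "continuous_on {0..} X" unfolding X_def [abs_def] by (intro continuous_intros cc)
  have Dc: "continuous_on {0..} D" unfolding D_def [abs_def] by (intro matrix_vector_continuous_on M cc)
  define B where "B = (\<Sum>k=1..?K. norm (\<phi> k xb))"
  have Xb: "norm (X \<tau> - xb) \<le> (K + B) * exp (- \<tau>)" if "\<tau> \<ge> 0" for \<tau>
  proof -
    have "norm (\<Sum>k=1..?K. exp (- \<tau>) ^ k *\<^sub>R \<phi> k xb) \<le> (\<Sum>k=1..?K. norm (\<phi> k xb) * exp (- \<tau>))"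
    proof (rule sum_norm_le)
      fix k assume "k \<in> {1..?K}"
      then have "exp (- \<tau>) ^ k \<le> exp (- \<tau>) ^ 1" using that by (intro power_decreasing) auto
      then have "exp (- \<tau>) ^ k * norm (\<phi> k xb) \<le> exp (- \<tau>) * norm (\<phi> k xb)" by (intro mult_right_mono) auto
      then show "norm (exp (- \<tau>) ^ k *\<^sub>R \<phi> k xb) \<le> norm (\<phi> k xb) * exp (- \<tau>)" by (simp add: mult.commute)
    qed
    also have "\<dots> = B * exp (- \<tau>)" by (simp add: B_def sum_distrib_right)
    finally show ?thesis
      using cb[OF that] norm_triangle_ineq[of "c \<tau>" "\<Sum>k=1..?K. exp (- \<tau>) ^ k *\<^sub>R \<phi> k xb"]
      by (simp add: X_def algebra_simps)
  qed
  have Db: "norm (D \<tau> - 0) \<le> K' * exp (- \<tau>)" if "\<tau> \<ge> 0" for \<tau>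
    using db[OF that] by (simp add: D_def)
  define x where "x t = (if t < 1 then X (- ln (1 - t)) else xb)" for t
  define u where "u t = (if t < 1 then D (- ln (1 - t)) else 0)" for t
  have xc: "continuous_on {0..1} x" and xl: "((\<lambda>t. X (- ln (1 - t))) \<longlongrightarrow> xb) (at_left 1)"
    unfolding x_def [abs_def] using continuous_on_time_change[OF Xc Xb] by auto
  have uc: "continuous_on {0..1} u" and ul: "((\<lambda>t. D (- ln (1 - t))) \<longlongrightarrow> 0) (at_left 1)"
    unfolding u_def [abs_def] using continuous_on_time_change[OF Dc Db] by auto
  have rx: "recovered_x 1 \<phi> xb c t = X (- ln (1 - t))" for t
    unfolding recovered_x_def X_def Let_def using exp_minus_power[of _ "- ln (1 - t)"] by simp
  have ru: "recovered_u 1 M c t = D (- ln (1 - t))" for t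
    unfolding recovered_u_def D_def Let_def by simp
  have dX: "(X has_vector_derivative exp (- \<tau>) *\<^sub>R f (X \<tau>, D \<tau>)) (at \<tau>)" if t: "\<tau> > 0" for \<tau>
  proof -
    have "(c has_vector_derivative shifted_rhs f 1 \<phi> xb ?K \<tau> (c \<tau>) (D \<tau>)) (at \<tau> within {0..})"
      using c t unfolding auxiliary_ivp_solution_iff D_def by simp
    then have dc: "(c has_vector_derivative shifted_rhs f 1 \<phi> xb ?K \<tau> (c \<tau>) (D \<tau>)) (at \<tau>)"
      using t by (simp add: at_within_nonneg)
    have ds: "((\<lambda>\<tau>. \<Sum>k=1..?K. exp (- \<tau>) ^ k *\<^sub>R \<phi> k xb) has_vector_derivative
        (\<Sum>k=1..?K. (- (real k * exp (- \<tau>) ^ k)) *\<^sub>R \<phi> k xb)) (at \<tau>)"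
    proof (rule has_vector_derivative_sum)
      fix k
      have "((\<lambda>\<tau>. exp (- real k * \<tau>)) has_real_derivative - (real k * exp (- real k * \<tau>))) (at \<tau>)"
        by (auto intro!: derivative_eq_intros)
      then have "((\<lambda>\<tau>. exp (- \<tau>) ^ k) has_real_derivative - (real k * exp (- \<tau>) ^ k)) (at \<tau>)"
        unfolding exp_minus_power .
      from has_vector_derivative_scaleR[OF this has_vector_derivative_const[of "\<phi> k xb"]]
      show "((\<lambda>\<tau>. exp (- \<tau>) ^ k *\<^sub>R \<phi> k xb) has_vector_derivative (- (real k * exp (- \<tau>) ^ k)) *\<^sub>R \<phi> k xb) (at \<tau>)"
        by simp
    qed
    from has_vector_derivative_add[OF has_vector_derivative_add[OF has_vector_derivative_const[of xb] dc] ds]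
    have "(X has_vector_derivative 0 + shifted_rhs f 1 \<phi> xb ?K \<tau> (c \<tau>) (D \<tau>) +
        (\<Sum>k=1..?K. (- (real k * exp (- \<tau>) ^ k)) *\<^sub>R \<phi> k xb)) (at \<tau>)"
      unfolding X_def [abs_def] .
    \<comment> \<open>The derivatives of the shift terms cancel the inhomogeneity that the shifts
      had introduced.\<close>
    moreover have "0 + shifted_rhs f 1 \<phi> xb ?K \<tau> (c \<tau>) (D \<tau>) +
        (\<Sum>k=1..?K. (- (real k * exp (- \<tau>) ^ k)) *\<^sub>R \<phi> k xb) = exp (- \<tau>) *\<^sub>R f (X \<tau>, D \<tau>)"
      unfolding shifted_rhs_power X_def by (simp add: sum_negf)
    ultimately show ?thesis by simp
  qed
  have dx: "(x has_vector_derivative f (x t, u t)) (at t)" if t: "t \<in> {0<..<1}" for t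
  proof -
    \<comment> \<open>The factor d\<tau>/dt = 1 / (1 - t) will cancel exp (- \<tau>) = 1 -
      t.\<close>
    have "((\<lambda>t. - ln (1 - t)) has_vector_derivative 1 / (1 - t)) (at t)"
      unfolding has_real_derivative_iff_has_vector_derivative[symmetric]
      using t by (auto intro!: derivative_eq_intros simp: field_simps)
    moreover have "- ln (1 - t) > 0" using t by simp
    ultimately have "((X \<circ> (\<lambda>t. - ln (1 - t))) has_vector_derivative
        (1 / (1 - t)) *\<^sub>R exp (- (- ln (1 - t))) *\<^sub>R f (X (- ln (1 - t)), D (- ln (1 - t)))) (at t)"
      by (intro vector_diff_chain_at dX)
    then have "((\<lambda>t. X (- ln (1 - t))) has_vector_derivative f (x t, u t)) (at t)"
      using t by (simp add: o_def x_def u_def)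
    then show ?thesis
      by (rule has_vector_derivative_transform_within_open[of _ _ _ "{0<..<1}"]) (use t in \<open>auto simp: x_def\<close>)
  qed
  have Fc: "continuous_on {0..1} (\<lambda>t. f (x t, u t))"
    by (rule continuous_on_compose2[OF C_upto_continuous[OF f]]) (auto intro!: continuous_intros xc uc)
  have "bvp_solution f norm_u N xb x u"
    unfolding bvp_solution_def
  proof (intro conjI ballI xc uc)
    show "(x has_vector_derivative f (x t, u t)) (at t within {0..1})" if "t \<in> {0..1}" for t
      by (rule has_vector_derivative_if_interior[OF xc Fc dx that])
    show "norm_u (u t) < N" if t: "t \<in> {0..1}" for t
    proof (rule N)
      show "norm (u t) \<le> K'"
      proof (cases "t < 1")
        case True
        have "K' * (1 - t) \<le> K' * 1" using K' t by (intro mult_left_mono) auto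
        then show ?thesis using Db[of "- ln (1 - t)"] t True by (simp add: u_def)
      qed (use K' in \<open>simp add: u_def\<close>)
    qed
    show "x 0 = 0" using c unfolding auxiliary_ivp_solution_iff by (simp add: x_def X_def)
    show "x 1 = xb" by (simp add: x_def)
  qed
  moreover have "recovered_from 1 \<phi> xb M c' x u" if c': "auxiliary_ivp_solution f 1 \<phi> xb M c'" for c'
  proof -
    have eq: "c' \<tau> = c \<tau>" if "\<tau> \<ge> 0" for \<tau>
      by (rule auxiliary_ivp_unique[OF f M c' c that])
    have r: "recovered_x 1 \<phi> xb c' t = X (- ln (1 - t))" "recovered_u 1 M c' t = D (- ln (1 - t))"
      if "t \<in> {0..<1}" for t
      unfolding rx[symmetric] ru[symmetric] recovered_x_def recovered_u_def Let_def
      using eq[of "- ln (1 - t) / 1"] that by simp_all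
    have ev: "eventually (\<lambda>t::real. t \<in> {0..<1}) (at_left 1)"
      by (rule eventually_at_leftI[of 0]) auto
    have "(recovered_x 1 \<phi> xb c' \<longlongrightarrow> xb) (at_left 1)"
      by (rule Lim_transform_eventually[OF xl]) (use ev in eventually_elim, simp add: r)
    moreover have "(recovered_u 1 M c' \<longlongrightarrow> 0) (at_left 1)"
      by (rule Lim_transform_eventually[OF ul]) (use ev in eventually_elim, simp add: r)
    ultimately show ?thesis
      unfolding recovered_from_def using r by (simp add: x_def u_def)
  qed
  ultimately show ?thesis by blast
qed

section \<open>The boundary value problem\<close>

lemma eventually_norm_bounded_by_limit:
  assumes "\<And>i. i < m \<Longrightarrow> ((\<lambda>x. A x i) \<longlongrightarrow> (if i = 0 then A0 else 0)) F"
  shows "\<forall>\<^sub>F x in F. \<forall>i<m. norm (A x (i::nat)) \<le> norm (A0 :: 'a::real_normed_vector) + 1"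
proof -
  have "\<forall>\<^sub>F x in F. norm (A x i) \<le> norm A0 + 1" if "i < m" for i
  proof -
    have "norm (if i = 0 then A0 else 0) < norm A0 + 1" by (simp add: add_nonneg_pos)
    from order_tendstoD(2)[OF tendsto_norm[OF assms[OF that]] this]
    show ?thesis by eventually_elim simp
  qed
  then have "\<forall>\<^sub>F x in F. \<forall>i\<in>{..<m}. norm (A x i) \<le> norm A0 + 1"
    by (intro eventually_ball_finite) auto
  then show ?thesis by eventually_elim auto
qed

text \<open>For one xb, with all constants given in advance. The work lies in bringing f, which is
  only locally Lipschitz, into the form that \<open>closed_loop_solution\<close> asks for, and in
  checking afterwards that nothing was changed along the solution.\<close>

lemma closed_loop_for_boundary_value:
  fixes f :: "(real^'n) \<times> (real^'r) \<Rightarrow> real^'n" and xb :: "real^'n"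
  assumes f: "C_upto (4 * CARD('n)) f"
    and loop: "gram_feedback (matrix_poly Pc CARD('n)) (matrix_poly Qc (2 * CARD('n))) U V C \<kappa> q m"
    and P: "P_mat f 1 \<phi> xb = (\<lambda>\<tau>. exp (- \<tau>) *\<^sub>R matrix_poly Pc CARD('n) (exp (- \<tau>)))"
    and Q: "Q_mat f 1 \<phi> xb = (\<lambda>\<tau>. exp (- \<tau>) *\<^sub>R matrix_poly Qc (2 * CARD('n)) (exp (- \<tau>)))"
    and Pb: "\<And>i. norm (Pc i) \<le> b" and Qb: "\<And>i. norm (Qc i) \<le> b"
    and q: "q = 6 * CARD('n) - 3" and m: "m = q + 1 + 2 * (CARD('n) - 1)"
    and D: "D \<ge> 0" and \<rho>: "\<rho> = max (C^2) (C / sqrt \<kappa>)"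
    and R: "\<And>\<tau> c d. \<tau> \<ge> 0 \<Longrightarrow> norm c \<le> \<rho> \<Longrightarrow> norm d \<le> \<rho> \<Longrightarrow>
      norm (R_term f 1 \<phi> xb \<tau> c d) \<le> D * (exp (- \<tau>) ^ (4 * CARD('n)) * norm xb + exp (- \<tau>) ^ (CARD('n) + 1) * norm c
       + exp (- \<tau>) ^ (2 * CARD('n) + 1) * norm d + exp (- \<tau>) * (norm c + norm d)^2)"
    and a: "a1 = C^2" "a2 = C / sqrt \<kappa>" "a3 = 1 / sqrt \<kappa>"
    and \<Gamma>: "\<Gamma> = 2 * C * D * a3 * (1 + a1 + a2 + (a1 + a2)^2)"
    and \<Lambda>: "\<Lambda> = (C^2 * C0^2 / \<kappa> + 1) * exp \<Gamma>"
    and c0: "norm (- xb - (\<Sum>k=1..4 * CARD('n) - 1. \<phi> k xb)) \<le> C0 * norm xb"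
    and small: "\<Lambda> * (norm xb)^2 < 1"
    and N: "\<And>u. norm u \<le> a2 * sqrt \<Lambda> * norm xb \<Longrightarrow> norm_u u < N"
  shows "\<exists>x u. bvp_solution f norm_u N xb x u \<and>
        (\<exists>M. stabilizing_feedback (P_mat f 1 \<phi> xb) (Q_mat f 1 \<phi> xb) M \<and>
             (\<exists>c. auxiliary_ivp_solution f 1 \<phi> xb M c) \<and>
             (\<forall>c. auxiliary_ivp_solution f 1 \<phi> xb M c \<longrightarrow> recovered_from 1 \<phi> xb M c x u))"
proof -
  interpret gram_feedback "matrix_poly Pc CARD('n)" "matrix_poly Qc (2 * CARD('n))" U V C \<kappa> q m
    by (rule loop)
  let ?n = "CARD('n)" and ?K = "4 * CARD('n) - 1"
  have n: "1 \<le> 4 * ?n" using one_le_card_finite[where 'a = 'n] by linarith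
  have f1: "C_upto 1 f" by (rule C_upto_mono[OF f n])
  define Bz where "Bz = norm xb + (\<Sum>k=1..?K. norm (\<phi> k xb))"
  \<comment> \<open>The arguments of f are (z + c, d) with |z| \<le> \<open>Bz\<close>, |c| \<le>
    \<rho> and |d| \<le> \<rho>; they lie in the ball of this radius.\<close>
  define \<rho>' where "\<rho>' = Bz + 2 * \<rho>"
  have \<rho>0: "\<rho> \<ge> 0" unfolding \<rho> by (simp add: le_max_iff_disj)
  have Bz: "Bz \<ge> 0" unfolding Bz_def by (intro add_nonneg_nonneg sum_nonneg) auto
  define z where "z \<tau> = xb + (\<Sum>k=1..?K. exp (- \<tau>) ^ k *\<^sub>R \<phi> k xb)" for \<tau>
  define S where "S \<tau> = (\<Sum>k=1..?K. (real k * exp (- \<tau>) ^ k) *\<^sub>R \<phi> k xb)" for \<tau>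
  have zb: "norm (z \<tau>) \<le> Bz" if "\<tau> \<ge> 0" for \<tau>
  proof -
    have "norm (\<Sum>k=1..?K. exp (- \<tau>) ^ k *\<^sub>R \<phi> k xb) \<le> (\<Sum>k=1..?K. norm (\<phi> k xb))"
    proof (rule sum_norm_le)
      fix k
      have "exp (- \<tau>) ^ k * norm (\<phi> k xb) \<le> 1 * norm (\<phi> k xb)"
        using that by (intro mult_right_mono power_le_one) auto
      then show "norm (exp (- \<tau>) ^ k *\<^sub>R \<phi> k xb) \<le> norm (\<phi> k xb)" by simp
    qed
    then show ?thesis
      unfolding z_def Bz_def using norm_triangle_ineq[of xb "\<Sum>k=1..?K. exp (- \<tau>) ^ k *\<^sub>R \<phi> k xb"] by linarith
  qed
  text \<open>Composing \<open>f\<close> with the projection onto a large ball makes the closed loop globally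
    Lipschitz without changing it where the a priori bounds hold.\<close>
  let ?pr = "closest_point (cball (0 :: (real^'n) \<times> (real^'r)) \<rho>')"
  define g where "g p = f (?pr p)" for p
  have ne: "cball (0 :: (real^'n) \<times> (real^'r)) \<rho>' \<noteq> {}" using Bz \<rho>0 by (simp add: \<rho>'_def)
  obtain Lf where Lf: "Lf \<ge> 0" "\<forall>x\<in>cball 0 \<rho>'. \<forall>y\<in>cball 0 \<rho>'. norm (f x - f y) \<le> Lf * norm (x - y)"
    using C1_lipschitz_on_cball[OF f1] by blast
  have g_lip: "norm (g x - g y) \<le> Lf * norm (x - y)" for x y
  proof -
    have "norm (g x - g y) \<le> Lf * norm (?pr x - ?pr y)"
      unfolding g_def by (intro Lf(2)[rule_format] closest_point_in_set ne) auto
    also have "\<dots> \<le> Lf * norm (x - y)"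
      using closest_point_lipschitz[OF convex_cball closed_cball ne, of x y] Lf(1)
      by (intro mult_left_mono) (auto simp: dist_norm)
    finally show ?thesis .
  qed
  have g_cont: "continuous_on UNIV g"
    unfolding g_def [abs_def]
    by (intro continuous_on_compose2[OF C_upto_continuous[OF f1] continuous_on_closest_point] convex_cball closed_cball ne) auto
  define R' where "R' \<tau> c d = exp (- \<tau>) *\<^sub>R g (z \<tau> + c, d) + S \<tau> - P_mat f 1 \<phi> xb \<tau> *v c - Q_mat f 1 \<phi> xb \<tau> *v d" for \<tau> c d
  have R'_eq: "R' \<tau> c d = R_term f 1 \<phi> xb \<tau> c d" if "\<tau> \<ge> 0" "norm c \<le> \<rho>" "norm d \<le> \<rho>" for \<tau> c d
  proof -
    have "norm (z \<tau> + c, d) \<le> norm (z \<tau> + c) + norm d" by (rule norm_Pair_le)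
    also have "\<dots> \<le> \<rho>'"
      using zb[OF that(1)] that norm_triangle_ineq[of "z \<tau>" c] unfolding \<rho>'_def by linarith
    finally have "?pr (z \<tau> + c, d) = (z \<tau> + c, d)"
      by (intro closest_point_self) simp
    then have "g (z \<tau> + c, d) = f (z \<tau> + c, d)" by (simp add: g_def)
    then show ?thesis
      unfolding R'_def R_term_def shifted_rhs_power z_def S_def by (simp add: add_ac)
  qed
  have Rc: "continuous_on ({0..} \<times> UNIV) (\<lambda>(\<tau>, p). R' \<tau> (fst p) (snd p))"
    unfolding R'_def P Q z_def S_def case_prod_beta
    by (intro continuous_on_diff continuous_on_add continuous_on_scaleR matrix_vector_continuous_on
        continuous_on_compose2[OF continuous_on_matrix_poly[of UNIV]]
        continuous_on_compose2[OF g_cont] continuous_on_Pair continuous_intros subset_UNIV)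
  have Pn: "norm (P_mat f 1 \<phi> xb \<tau>) \<le> real ?n * b" and Qn: "norm (Q_mat f 1 \<phi> xb \<tau>) \<le> real (2 * ?n) * b"
    if "\<tau> \<ge> 0" for \<tau>
  proof -
    have "norm (P_mat f 1 \<phi> xb \<tau>) \<le> 1 * (real ?n * b)" "norm (Q_mat f 1 \<phi> xb \<tau>) \<le> 1 * (real (2 * ?n) * b)"
      unfolding P Q norm_scaleR using that by (intro mult_mono norm_matrix_poly_le Pb Qb; simp)+
    then show "norm (P_mat f 1 \<phi> xb \<tau>) \<le> real ?n * b" "norm (Q_mat f 1 \<phi> xb \<tau>) \<le> real (2 * ?n) * b" by simp_all
  qed
  have b0: "b \<ge> 0" using order_trans[OF norm_ge_zero Pb] .
  have lip: "norm (R' \<tau> c d - R' \<tau> c' d') \<le> (Lf + real ?n * b + real (2 * ?n) * b) * (norm (c - c') + norm (d - d'))"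
    if t: "\<tau> \<ge> 0" for \<tau> c d c' d'
  proof -
    let ?e = "norm (c - c') + norm (d - d')"
    have e: "norm (c - c') \<le> ?e" "norm (d - d') \<le> ?e" by auto
    have "R' \<tau> c d - R' \<tau> c' d' = exp (- \<tau>) *\<^sub>R (g (z \<tau> + c, d) - g (z \<tau> + c', d'))
        - P_mat f 1 \<phi> xb \<tau> *v (c - c') - Q_mat f 1 \<phi> xb \<tau> *v (d - d')"
      unfolding R'_def by (simp add: algebra_simps)
    then have "norm (R' \<tau> c d - R' \<tau> c' d') \<le> norm (exp (- \<tau>) *\<^sub>R (g (z \<tau> + c, d) - g (z \<tau> + c', d')))
        + norm (P_mat f 1 \<phi> xb \<tau> *v (c - c')) + norm (Q_mat f 1 \<phi> xb \<tau> *v (d - d'))"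
      by (simp only:) (intro order_trans[OF norm_triangle_ineq4] add_right_mono norm_triangle_ineq4)
    also have "\<dots> \<le> Lf * ?e + real ?n * b * ?e + real (2 * ?n) * b * ?e"
    proof (intro add_mono)
      have "norm (exp (- \<tau>) *\<^sub>R (g (z \<tau> + c, d) - g (z \<tau> + c', d'))) \<le> 1 * norm (g (z \<tau> + c, d) - g (z \<tau> + c', d'))"
        unfolding norm_scaleR using t by (intro mult_right_mono) auto
      also have "\<dots> \<le> 1 * (Lf * norm ((z \<tau> + c, d) - (z \<tau> + c', d')))" by (intro mult_left_mono g_lip) simp
      also have "\<dots> \<le> 1 * (Lf * ?e)"
        using norm_Pair_le[of "c - c'" "d - d'"] Lf(1) by (intro mult_left_mono) auto
      finally show "norm (exp (- \<tau>) *\<^sub>R (g (z \<tau> + c, d) - g (z \<tau> + c', d'))) \<le> Lf * ?e" by simp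
      show "norm (P_mat f 1 \<phi> xb \<tau> *v (c - c')) \<le> real ?n * b * ?e"
        by (rule order_trans[OF norm_matrix_vector_mult_le]) (use Pn[OF t] e b0 in \<open>intro mult_mono; simp\<close>)
      show "norm (Q_mat f 1 \<phi> xb \<tau> *v (d - d')) \<le> real (2 * ?n) * b * ?e"
        by (rule order_trans[OF norm_matrix_vector_mult_le]) (use Qn[OF t] e b0 in \<open>intro mult_mono; simp\<close>)
    qed
    finally show ?thesis by (simp add: distrib_right)
  qed
  have R'b: "norm (R' \<tau> c d) \<le> D * (exp (- \<tau>) ^ (4 * ?n) * norm xb + exp (- \<tau>) ^ (?n + 1) * norm c
       + exp (- \<tau>) ^ (2 * ?n + 1) * norm d + exp (- \<tau>) * (norm c + norm d)^2)"
    if "\<tau> \<ge> 0" "norm c \<le> \<rho>" "norm d \<le> \<rho>" for \<tau> c d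
    unfolding R'_eq[OF that] by (rule R[OF that])
  have \<rho>12: "C^2 \<le> \<rho>" "C / sqrt \<kappa> \<le> \<rho>" by (simp_all add: \<rho>)
  from closed_loop_solution[OF q m Rc lip D norm_ge_zero \<rho>12 R'b a \<Gamma> \<Lambda> c0 small]
  obtain c where c: "c 0 = - xb - (\<Sum>k=1..?K. \<phi> k xb)"
    "\<forall>\<tau>\<ge>0. (c has_vector_derivative (exp (- \<tau>) *\<^sub>R matrix_poly Pc ?n (exp (- \<tau>))) *v c \<tau>
        + (exp (- \<tau>) *\<^sub>R matrix_poly Qc (2 * ?n) (exp (- \<tau>))) *v (feedback \<tau> *v c \<tau>)
       + R' \<tau> (c \<tau>) (feedback \<tau> *v c \<tau>)) (at \<tau> within {0..}) \<and>
      norm (c \<tau>) \<le> a1 * sqrt \<Lambda> * norm xb * exp (- \<tau>) \<and> norm (feedback \<tau> *v c \<tau>) \<le> a2 * sqrt \<Lambda> * norm xb * exp (- \<tau>)"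
    by blast
  have a0: "a1 \<ge> 0" "a2 \<ge> 0" unfolding a using C_nonneg kappa by auto
  have e1: "sqrt \<Lambda> * norm xb \<le> 1"
  proof -
    have "sqrt (\<Lambda> * (norm xb)^2) \<le> 1" using small by simp
    then show ?thesis by (simp add: real_sqrt_mult)
  qed
  \<comment> \<open>Turns the a priori bounds into |c| \<le> a1 \<le> \<rho> and |d| \<le> a2 \<le>
    \<rho>, so the solution never leaves the region where \<open>R'\<close> is the true
    remainder.\<close>
  have small': "k * sqrt \<Lambda> * norm xb * exp (- \<tau>) \<le> k" if "k \<ge> 0" "\<tau> \<ge> 0" for k \<tau>
  proof -
    have "\<Lambda> \<ge> 0" unfolding \<Lambda> using kappa by simp
    then have "k * ((sqrt \<Lambda> * norm xb) * exp (- \<tau>)) \<le> k * 1"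
      by (intro mult_left_mono[OF mult_le_one[OF e1]]) (use that in auto)
    then show ?thesis by (simp add: mult.assoc)
  qed
  have aux: "auxiliary_ivp_solution f 1 \<phi> xb feedback c"
    unfolding auxiliary_ivp_solution_def
  proof (intro conjI allI impI c(1))
    fix \<tau> :: real assume t: "0 \<le> \<tau>"
    have "norm (c \<tau>) \<le> \<rho>" "norm (feedback \<tau> *v c \<tau>) \<le> \<rho>"
      using c(2)[rule_format, OF t] small'[OF a0(1) t] small'[OF a0(2) t] \<rho>12 unfolding a by linarith+
    from R'_eq[OF t this] c(2)[rule_format, OF t]
    show "(c has_vector_derivative P_mat f 1 \<phi> xb \<tau> *v c \<tau> + Q_mat f 1 \<phi> xb \<tau> *v (feedback \<tau> *v c \<tau>)
        + R_term f 1 \<phi> xb \<tau> (c \<tau>) (feedback \<tau> *v c \<tau>)) (at \<tau> within {0..})"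
      unfolding P Q by simp
  qed
  have stab: "stabilizing_feedback (P_mat f 1 \<phi> xb) (Q_mat f 1 \<phi> xb) feedback"
    using stabilizing unfolding P Q .
  have "\<exists>x u. bvp_solution f norm_u N xb x u \<and>
    (\<forall>c. auxiliary_ivp_solution f 1 \<phi> xb feedback c \<longrightarrow> recovered_from 1 \<phi> xb feedback c x u)"
  proof (rule recover_bvp_solution[OF f1 continuous_on_feedback aux])
    show "a2 * sqrt \<Lambda> * norm xb \<ge> 0"
      unfolding \<Lambda> using a0 kappa by (intro mult_nonneg_nonneg) auto
    show "norm (c \<tau>) \<le> a1 * sqrt \<Lambda> * norm xb * exp (- \<tau>)"
      "norm (feedback \<tau> *v c \<tau>) \<le> a2 * sqrt \<Lambda> * norm xb * exp (- \<tau>)" if "\<tau> \<ge> 0" for \<tau>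
      using c(2) that by blast+
    show "norm_u u < N" if "norm u \<le> a2 * sqrt \<Lambda> * norm xb" for u
      by (rule N[OF that])
  qed
  with aux stab show ?thesis by blast
qed

theorem mainTheorem1:
  fixes f :: "(real^'n) \<times> (real^'r) \<Rightarrow> real^'n"
    and norm_x :: "real^'n \<Rightarrow> real"
    and norm_u :: "real^'r \<Rightarrow> real"
    and N :: real
  assumes "CARD('r) \<le> CARD('n)"
    and "is_norm norm_x"
    and "is_norm norm_u"
    and "N > 0"
    and "C_upto (4 * CARD('n)) f"
    and "f (0, 0) = 0"
    and "rank (controllability_matrix
           (jacobian (\<lambda>x. f (x, 0)) (at 0)) (jacobian (\<lambda>u. f (0, u)) (at 0))) = CARD('n)"
  shows "\<exists>\<alpha>>0. \<exists>\<phi>. shift_functions f \<alpha> \<phi> \<and>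
    (\<exists>\<epsilon>>0. \<forall>xb. norm_x xb < \<epsilon> \<longrightarrow>
      (\<exists>x u. bvp_solution f norm_u N xb x u \<and>
        (\<exists>M. stabilizing_feedback (P_mat f \<alpha> \<phi> xb) (Q_mat f \<alpha> \<phi> xb) M \<and>
             (\<exists>c. auxiliary_ivp_solution f \<alpha> \<phi> xb M c) \<and>
             (\<forall>c. auxiliary_ivp_solution f \<alpha> \<phi> xb M c \<longrightarrow> recovered_from \<alpha> \<phi> xb M c x u))))"
proof -
  let ?n = "CARD('n)" and ?K = "4 * CARD('n) - 1" and ?\<phi> = "shift f"
  have n: "1 \<le> ?n" using one_le_card_finite[where 'a = 'n] by simp
  note f = assms(5)
  have f0: "f 0 = 0" using assms(6) by (simp add: zero_prod_def)
  define A where "A = jacobian (\<lambda>x. f (x, 0)) (at 0)"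
  define B where "B = jacobian (\<lambda>u. f (0, u)) (at 0)"
  \<comment> \<open>Padding by zeros leaves the matrix polynomials unchanged and lets the bound b
    hold for every index, as \<open>linear_control\<close> requires.\<close>
  define Pc where "Pc xb i = (if i < ?n then P_coef f ?\<phi> xb i else 0)" for xb i
  define Qc where "Qc xb i = (if i < 2 * ?n then Q_coef f ?\<phi> xb i else 0)" for xb i
  have Plim: "((\<lambda>xb. Pc xb i) \<longlongrightarrow> (if i = 0 then A else 0)) (nhds 0)" if "i < ?n" for i
    using tendsto_P_coef[OF f f0 that] that unfolding Pc_def A_def by simp
  have Qlim: "((\<lambda>xb. Qc xb i) \<longlongrightarrow> (if i = 0 then B else 0)) (nhds 0)" if "i < 2 * ?n" for i
    using tendsto_Q_coef[OF f f0 that] that unfolding Qc_def B_def by simp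
  have Pmat: "P_mat f 1 ?\<phi> xb = (\<lambda>\<tau>. exp (- \<tau>) *\<^sub>R matrix_poly (Pc xb) ?n (exp (- \<tau>)))" for xb
    by (simp add: fun_eq_iff P_mat_Q_mat_eq(3)[OF f] matrix_poly_def Pc_def)
  have Qmat: "Q_mat f 1 ?\<phi> xb = (\<lambda>\<tau>. exp (- \<tau>) *\<^sub>R matrix_poly (Qc xb) (2 * ?n) (exp (- \<tau>)))" for xb
    by (simp add: fun_eq_iff P_mat_Q_mat_eq(4)[OF f] matrix_poly_def Qc_def)
  have rk: "rank (controllability_matrix A B) = ?n" using assms(7) unfolding A_def B_def .
  have "((\<lambda>xb. Qc xb i) \<longlongrightarrow> (if i = 0 then B else 0)) (nhds 0)" if "i < ?n" for i
    using that by (intro Qlim) simp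
  from observability_eventually[OF rk Plim this] obtain \<kappa>0 where \<kappa>0: "\<kappa>0 > 0"
    "\<forall>\<^sub>F xb in nhds 0. \<forall>v. \<kappa>0 * (norm v)^2 \<le> (\<Sum>k<?n. (norm (transpose (obs_coef (Pc xb) (Qc xb) k) *v v))^2)"
    by blast
  \<comment> \<open>Near xb = 0 the leading coefficients are close to A and B and the others close
    to 0, so this bounds all of them.\<close>
  define b where "b = norm A + norm B + 1"
  have b: "b \<ge> 0" by (simp add: b_def)
  have evP: "\<forall>\<^sub>F xb in nhds 0. \<forall>i<?n. norm (Pc xb i) \<le> norm A + 1"
    by (rule eventually_norm_bounded_by_limit) (rule Plim)
  have evQ: "\<forall>\<^sub>F xb in nhds 0. \<forall>i<2 * ?n. norm (Qc xb i) \<le> norm B + 1"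
    by (rule eventually_norm_bounded_by_limit) (rule Qlim)
  \<comment> \<open>The smallest weight for which the quadratic terms of R are harmless. The
    exponent \<open>m\<close> of the lower bound on the Gramian is then 8n - 4.\<close>
  define q where "q = 6 * ?n - 3"
  define m where "m = q + 1 + 2 * (?n - 1)"
  from linear_control[where 'n = 'n and 'r = 'r, OF b \<kappa>0(1), of q] obtain \<kappa> C where \<kappa>: "\<kappa> > 0" and
    control: "\<forall>(Pc :: nat \<Rightarrow> real^'n^'n) (Qc :: nat \<Rightarrow> real^'r^'n).
    (\<forall>i. norm (Pc i) \<le> b) \<longrightarrow> (\<forall>i. norm (Qc i) \<le> b) \<longrightarrow>
    (\<forall>v. \<kappa>0 * (norm v)^2 \<le> (\<Sum>k<?n. (norm (transpose (obs_coef Pc Qc k) *v v))^2)) \<longrightarrow>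
    (\<exists>U V. ode_frame (matrix_poly Pc ?n) U V \<and>
      (\<forall>s\<in>{0..1}. norm (U s) \<le> C \<and> norm (V s) \<le> C \<and> norm (U s ** matrix_poly Qc (2 * ?n) s) \<le> C \<and>
        (\<forall>v. \<kappa> * s ^ m * (norm v)^2 \<le> v \<bullet> (gram q (\<lambda>s. U s ** matrix_poly Qc (2 * ?n) s) s *v v))))"
    unfolding m_def by blast
  have "C_upto (Suc ?K) f" using f n by simp
  from shift_bound[OF this f0] obtain \<delta> Cs where d: "\<delta> > 0" "Cs \<ge> 0" "\<delta> \<le> 1" "Cs * \<delta> \<le> 1"
    "\<And>k xb. k \<in> {1..?K} \<Longrightarrow> norm xb \<le> \<delta> \<Longrightarrow> norm (shift f k xb) \<le> Cs * norm xb"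
    by blast
  define \<rho> where "\<rho> = max (C^2) (C / sqrt \<kappa>)"
  from R_term_bound[OF f d(2-4), of \<rho>] d(5) obtain D where D: "D \<ge> 0"
    "\<And>xb \<tau> c d. norm xb \<le> \<delta> \<Longrightarrow> 0 \<le> \<tau> \<Longrightarrow> norm c \<le> \<rho> \<Longrightarrow> norm d \<le> \<rho> \<Longrightarrow>
    norm (R_term f 1 ?\<phi> xb \<tau> c d) \<le>
      D * (exp (- \<tau>) ^ (4 * ?n) * norm xb + exp (- \<tau>) ^ (?n + 1) * norm c
           + exp (- \<tau>) ^ (2 * ?n + 1) * norm d + exp (- \<tau>) * (norm c + norm d)^2)"
    by blast
  \<comment> \<open>For the initial value - xb - \<Sum> \<phi>_k(xb): there are 4n - 1 shifts of
    size at most \<open>Cs\<close> |xb| each.\<close>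
  define C0 where "C0 = 1 + real ?K * Cs"
  define a1 where "a1 = C^2"
  define a2 where "a2 = C / sqrt \<kappa>"
  define a3 where "a3 = 1 / sqrt \<kappa>"
  define \<Gamma> where "\<Gamma> = 2 * C * D * a3 * (1 + a1 + a2 + (a1 + a2)^2)"
  define \<Lambda> where "\<Lambda> = (C^2 * C0^2 / \<kappa> + 1) * exp \<Gamma>"
  obtain Cu where Cu: "Cu > 0" "\<And>u. norm_u u \<le> Cu * norm u"
    using is_norm_bounds(1)[OF assms(3)] by blast
  obtain cx where cx: "cx > 0" "\<And>x. cx * norm x \<le> norm_x x"
    using is_norm_bounds(2)[OF assms(2)] by blast
  have "((\<lambda>xb :: real^'n. norm xb) \<longlongrightarrow> norm (0 :: real^'n)) (nhds 0)"
    by (intro tendsto_norm filterlim_ident)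
  then have ev1: "\<forall>\<^sub>F xb :: real^'n in nhds 0. norm xb < \<delta>"
    by (rule order_tendstoD(2)) (use d in simp)
  have "((\<lambda>xb :: real^'n. \<Lambda> * (norm xb)^2) \<longlongrightarrow> \<Lambda> * (norm (0 :: real^'n))^2) (nhds 0)"
    by (intro tendsto_intros filterlim_ident)
  then have ev2: "\<forall>\<^sub>F xb :: real^'n in nhds 0. \<Lambda> * (norm xb)^2 < 1"
    by (rule order_tendstoD(2)) simp
  have "((\<lambda>xb :: real^'n. Cu * (a2 * sqrt \<Lambda> * norm xb)) \<longlongrightarrow> Cu * (a2 * sqrt \<Lambda> * norm (0 :: real^'n))) (nhds 0)"
    by (intro tendsto_intros filterlim_ident)
  then have ev3: "\<forall>\<^sub>F xb :: real^'n in nhds 0. Cu * (a2 * sqrt \<Lambda> * norm xb) < N"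
    by (rule order_tendstoD(2)) (use assms(4) in simp)
  \<comment> \<open>All of \<kappa>, C, \<delta>, D and \<Lambda> are fixed before xb. Only then is
    xb made small: for observability, for the bounds on the coefficients, for the remainder
    estimate, for the bootstrap and for the constraint on u.\<close>
  have "\<forall>\<^sub>F xb in nhds 0. \<exists>x u. bvp_solution f norm_u N xb x u \<and>
        (\<exists>M. stabilizing_feedback (P_mat f 1 ?\<phi> xb) (Q_mat f 1 ?\<phi> xb) M \<and>
             (\<exists>c. auxiliary_ivp_solution f 1 ?\<phi> xb M c) \<and>
             (\<forall>c. auxiliary_ivp_solution f 1 ?\<phi> xb M c \<longrightarrow> recovered_from 1 ?\<phi> xb M c x u))"
    using \<kappa>0(2) evP evQ ev1 ev2 ev3
  proof eventually_elim
    case (elim xb)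
    have Pb: "norm (Pc xb i) \<le> b" for i
    proof (cases "i < ?n")
      case True
      then have "norm (Pc xb i) \<le> norm A + 1" using elim(2) by blast
      then show ?thesis unfolding b_def using norm_ge_zero[of B] by linarith
    qed (use b in \<open>simp add: Pc_def\<close>)
    have Qb: "norm (Qc xb i) \<le> b" for i
    proof (cases "i < 2 * ?n")
      case True
      then have "norm (Qc xb i) \<le> norm B + 1" using elim(3) by blast
      then show ?thesis unfolding b_def using norm_ge_zero[of A] by linarith
    qed (use b in \<open>simp add: Qc_def\<close>)
    from control[rule_format, OF Pb Qb elim(1)[rule_format]] obtain U V where
      UV: "ode_frame (matrix_poly (Pc xb) ?n) U V" "\<And>s v. s \<in> {0..1} \<Longrightarrow> norm (U s) \<le> C \<and> norm (V s) \<le> C \<and>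
        norm (U s ** matrix_poly (Qc xb) (2 * ?n) s) \<le> C \<and>
        \<kappa> * s ^ m * (norm v)^2 \<le> v \<bullet> (gram q (\<lambda>s. U s ** matrix_poly (Qc xb) (2 * ?n) s) s *v v)"
      by blast
    have loop: "gram_feedback (matrix_poly (Pc xb) ?n) (matrix_poly (Qc xb) (2 * ?n)) U V C \<kappa> q m"
      by unfold_locales (use UV \<kappa> in \<open>auto intro: continuous_on_matrix_poly\<close>)
    have "norm (\<Sum>k=1..?K. ?\<phi> k xb) \<le> (\<Sum>k=1..?K. Cs * norm xb)"
      using d(5) elim(4) by (intro sum_norm_le) auto
    also have "\<dots> = real ?K * Cs * norm xb" by simp
    finally have c0: "norm (- xb - (\<Sum>k=1..?K. ?\<phi> k xb)) \<le> C0 * norm xb"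
      using norm_triangle_ineq4[of "- xb" "\<Sum>k=1..?K. ?\<phi> k xb"] unfolding C0_def distrib_right by simp
    have Nu: "norm_u u < N" if "norm u \<le> a2 * sqrt \<Lambda> * norm xb" for u
      using Cu(2)[of u] mult_left_mono[OF that, of Cu] Cu(1) elim(6) by linarith
    show ?case
      by (rule closed_loop_for_boundary_value[OF f loop Pmat Qmat Pb Qb q_def m_def D(1) \<rho>_def _
            a1_def a2_def a3_def \<Gamma>_def \<Lambda>_def c0 elim(5) Nu])
         (use D(2) elim(4) in \<open>auto intro: less_imp_le\<close>)
  qed
  then obtain \<eta> where \<eta>: "\<eta> > 0" "\<And>xb. dist xb 0 < \<eta> \<Longrightarrow> \<exists>x u. bvp_solution f norm_u N xb x u \<and>
        (\<exists>M. stabilizing_feedback (P_mat f 1 ?\<phi> xb) (Q_mat f 1 ?\<phi> xb) M \<and>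
             (\<exists>c. auxiliary_ivp_solution f 1 ?\<phi> xb M c) \<and>
             (\<forall>c. auxiliary_ivp_solution f 1 ?\<phi> xb M c \<longrightarrow> recovered_from 1 ?\<phi> xb M c x u))"
    unfolding eventually_nhds_metric by blast
  \<comment> \<open>The given norm of xb dominates \<open>cx\<close> times the Euclidean one, which
    explains the radius \<open>cx * \<eta>\<close>.\<close>
  have near: "dist xb 0 < \<eta>" if "norm_x xb < cx * \<eta>" for xb
  proof -
    have "cx * norm xb < cx * \<eta>" using cx(2)[of xb] that by linarith
    then show ?thesis using cx(1) by simp
  qed
  \<comment> \<open>Taking \<alpha> = 1 is enough, since another positive value would only rescale
    \<tau>.\<close>
  show ?thesis
  proof (rule exI[of _ 1], rule conjI[OF zero_less_one], rule exI[of _ ?\<phi>],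
      rule conjI[OF shift_functions_shift[OF f f0]], rule exI[of _ "cx * \<eta>"], intro conjI allI impI)
    show "cx * \<eta> > 0" using cx(1) \<eta>(1) by simp
  qed (rule \<eta>(2)[OF near])
qed

end
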